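(* Let $M$ be a continuous local $P$-martingale on $[0,T]$ with $M_0=0$ and $\langle M\rangle_T<\infty$ $P$-a.s., such that its stochastic exponential $\mathcal{E}(M)$ is a uniformly integrable martingale. Let $d\tilde P=\mathcal{E}_T(M)\,dP$, $\tilde M=\langle M\rangle-M$, and let $1<p<\infty$. (1) If $\mathcal{E}(M)$ satisfies the $(R_p)$ condition with constant $C_p$, then for every $\beta>\frac{p}{p-1}$ $$\|M\|^2_{BMO(P)}\le\frac{2\big(e^{\beta(C_p-1)}-1\big)}{p\big(\beta(p-1)-p\big)}.$$ (2) If $\mathcal{E}(M)$ satisfies the $(A_p)$ condition with constant $D_p$, then for every $\beta>p$ $$\|\tilde M\|^2_{BMO(\tilde P)}\le\frac{2(p-1)^2}{p(\beta-p)}\big(e^{\beta(D_p-1)}-1\big).$$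
   Context: Let $(\Omega,\mathcal{F},P)$ be a probability space, $0<T<\infty$ a finite time horizon, and $(\mathcal{F}_t)_{0\le t\le T}$ a filtration satisfying the usual conditions of right-continuity and completeness. Stopping times take values in $[0,T]$. $\langle M\rangle$ is the square characteristic (quadratic variation) of $M$. Stochastic exponential: $\mathcal{E}_t(M)=\exp\{M_t-\tfrac12\langle M\rangle_t\}$, and $\mathcal{E}_{\tau,T}(M)=\mathcal{E}_T(M)/\mathcal{E}_\tau(M)$. For $Q=P$ or $Q=\tilde P$ and a continuous local $Q$-martingale $N$ with $N_0=0$, $$\|N\|_{BMO(Q)}=\sup_\tau\Big\|E^{Q}\big[\langle N\rangle_T-\langle N\rangle_\tau\,\big|\,\mathcal{F}_\tau\big]^{1/2}\Big\|_\infty,$$ the supremum being over all stopping times $\tau\in[0,T]$. $(R_p)$ with constant $C_p$: $E\big[\{\mathcal{E}_{\tau,T}(M)\}^{p}\,\big|\,\mathcal{F}_\tau\big]\le C_p$ for every stopping time $\tau$ (expectation under $P$). $(A_p)$ with constant $D_p$: $E\big[\{\mathcal{E}_{\tau,T}(M)\}^{-\frac{1}{p-1}}\,\big|\,\mathcal{F}_\tau\big]\le D_p$ for every stopping time $\tau$ (expectation under $P$). *)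

theory Defs
  imports "HOL-Probability.Probability"
begin

text \<open>
  The filtration is indexed by all reals so that the library notions of filtration, stopping time
  and pre-sigma-algebra apply. Only the times in \<open>{0..T}\<close> carry assumptions beyond monotonicity,
  and a filtration on \<open>{0..T}\<close> can always be extended by constants; for stopping times with
  values in \<open>{0..T}\<close> the part outside \<open>{0..T}\<close> has no influence on \<open>stopping_time\<close> and
  \<open>pre_sigma\<close>.
\<close>

locale usual_filtration = prob_space P + filtration "space P" F
  for P :: "'a measure" and F :: "real \<Rightarrow> 'a measure" and T :: real +
  assumes horizon_pos: "0 < T"
    and subalgebra_F: "\<And>t. t \<in> {0..T} \<Longrightarrow> subalgebra P (F t)"
    and right_continuous: "\<And>t. t \<in> {0..<T} \<Longrightarrow> sets (F t) = (\<Inter>s\<in>{t<..T}. sets (F s))"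
    and complete: "\<And>N B. N \<in> null_sets P \<Longrightarrow> B \<subseteq> N \<Longrightarrow> B \<in> sets (F 0)"

definition stopping_times :: "'a set \<Rightarrow> (real \<Rightarrow> 'a measure) \<Rightarrow> real \<Rightarrow> ('a \<Rightarrow> real) set" where
  "stopping_times \<Omega> F T = {\<tau>. stopping_time F \<tau> \<and> (\<forall>\<omega>\<in>\<Omega>. \<tau> \<omega> \<in> {0..T})}"

definition adapted :: "(real \<Rightarrow> 'a measure) \<Rightarrow> real \<Rightarrow> (real \<Rightarrow> 'a \<Rightarrow> real) \<Rightarrow> bool" where
  "adapted F T X \<longleftrightarrow> (\<forall>t\<in>{0..T}. X t \<in> borel_measurable (F t))"

definition continuous_paths :: "'a measure \<Rightarrow> real \<Rightarrow> (real \<Rightarrow> 'a \<Rightarrow> real) \<Rightarrow> bool" where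
  "continuous_paths Q T X \<longleftrightarrow> (AE \<omega> in Q. continuous_on {0..T} (\<lambda>t. X t \<omega>))"

definition martingale ::
    "'a measure \<Rightarrow> (real \<Rightarrow> 'a measure) \<Rightarrow> real \<Rightarrow> (real \<Rightarrow> 'a \<Rightarrow> real) \<Rightarrow> bool" where
  "martingale Q F T X \<longleftrightarrow>
     adapted F T X \<and> (\<forall>t\<in>{0..T}. integrable Q (X t)) \<and>
     (\<forall>s\<in>{0..T}. \<forall>t\<in>{s..T}. AE \<omega> in Q. real_cond_exp Q (F s) (X t) \<omega> = X s \<omega>)"

definition uniformly_integrable ::
    "'a measure \<Rightarrow> real \<Rightarrow> (real \<Rightarrow> 'a \<Rightarrow> real) \<Rightarrow> bool" where
  "uniformly_integrable Q T X \<longleftrightarrow>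
     (\<forall>t\<in>{0..T}. X t \<in> borel_measurable Q) \<and>
     ((\<lambda>K. SUP t\<in>{0..T}. \<integral>\<^sup>+\<omega>. ennreal \<bar>X t \<omega>\<bar> * indicator {\<omega>. \<bar>X t \<omega>\<bar> > K} \<omega> \<partial>Q)
        \<longlongrightarrow> 0) at_top"

text \<open>
  On the closed interval \<open>{0..T}\<close> a localizing sequence increases and almost surely reaches \<open>T\<close>
  after finitely many steps.
\<close>

definition localizing_sequence ::
    "'a measure \<Rightarrow> (real \<Rightarrow> 'a measure) \<Rightarrow> real \<Rightarrow> (nat \<Rightarrow> 'a \<Rightarrow> real) \<Rightarrow> bool" where
  "localizing_sequence Q F T \<tau> \<longleftrightarrow>
     (\<forall>n. \<tau> n \<in> stopping_times (space Q) F T) \<and>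
     (AE \<omega> in Q. incseq (\<lambda>n. \<tau> n \<omega>)) \<and>
     (AE \<omega> in Q. \<forall>\<^sub>F n in sequentially. \<tau> n \<omega> = T)"

definition continuous_local_martingale ::
    "'a measure \<Rightarrow> (real \<Rightarrow> 'a measure) \<Rightarrow> real \<Rightarrow> (real \<Rightarrow> 'a \<Rightarrow> real) \<Rightarrow> bool" where
  "continuous_local_martingale Q F T N \<longleftrightarrow>
     adapted F T N \<and> continuous_paths Q T N \<and>
     (\<exists>\<tau>. localizing_sequence Q F T \<tau> \<and>
        (\<forall>n. martingale Q F T (\<lambda>t \<omega>. N (min t (\<tau> n \<omega>)) \<omega> - N 0 \<omega>)))"

text \<open>
  \<open>A\<close> is a version of the square characteristic of \<open>N\<close> under \<open>Q\<close>. Versions are real-valued, so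
  finiteness at time \<open>T\<close> is part of the notion. Two versions are indistinguishable.
\<close>

definition is_square_characteristic ::
    "'a measure \<Rightarrow> (real \<Rightarrow> 'a measure) \<Rightarrow> real \<Rightarrow> (real \<Rightarrow> 'a \<Rightarrow> real) \<Rightarrow>
     (real \<Rightarrow> 'a \<Rightarrow> real) \<Rightarrow> bool" where
  "is_square_characteristic Q F T N A \<longleftrightarrow>
     continuous_local_martingale Q F T N \<and>
     adapted F T A \<and> continuous_paths Q T A \<and>
     (AE \<omega> in Q. A 0 \<omega> = 0) \<and> (AE \<omega> in Q. mono_on {0..T} (\<lambda>t. A t \<omega>)) \<and>
     continuous_local_martingale Q F T (\<lambda>t \<omega>. (N t \<omega>)\<^sup>2 - A t \<omega>)"

definition square_characteristic ::
    "'a measure \<Rightarrow> (real \<Rightarrow> 'a measure) \<Rightarrow> real \<Rightarrow> (real \<Rightarrow> 'a \<Rightarrow> real) \<Rightarrow>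
     real \<Rightarrow> 'a \<Rightarrow> real" where
  "square_characteristic Q F T N = (SOME A. is_square_characteristic Q F T N A)"

definition nn_cond_exp_at ::
    "'a measure \<Rightarrow> (real \<Rightarrow> 'a measure) \<Rightarrow> ('a \<Rightarrow> real) \<Rightarrow> ('a \<Rightarrow> real) \<Rightarrow> 'a \<Rightarrow> ennreal" where
  "nn_cond_exp_at Q F \<tau> f =
     nn_cond_exp Q (filtration.pre_sigma (space Q) F \<tau>) (\<lambda>\<omega>. ennreal (f \<omega>))"

definition ennreal_sqrt :: "ennreal \<Rightarrow> ennreal" where
  "ennreal_sqrt x = (if x = \<infinity> then \<infinity> else ennreal (sqrt (enn2real x)))"

definition bmo_norm ::
    "'a measure \<Rightarrow> (real \<Rightarrow> 'a measure) \<Rightarrow> real \<Rightarrow> (real \<Rightarrow> 'a \<Rightarrow> real) \<Rightarrow> ennreal" where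
  "bmo_norm Q F T N =
     (SUP \<tau>\<in>stopping_times (space Q) F T.
        esssup Q (\<lambda>\<omega>. ennreal_sqrt (nn_cond_exp_at Q F \<tau>
          (\<lambda>\<omega>. square_characteristic Q F T N T \<omega> - square_characteristic Q F T N (\<tau> \<omega>) \<omega>) \<omega>)))"

text \<open>In the following, \<open>A\<close> stands for the square characteristic of \<open>M\<close>.\<close>

definition stoch_exp ::
    "(real \<Rightarrow> 'a \<Rightarrow> real) \<Rightarrow> (real \<Rightarrow> 'a \<Rightarrow> real) \<Rightarrow> real \<Rightarrow> 'a \<Rightarrow> real" where
  "stoch_exp M A t \<omega> = exp (M t \<omega> - A t \<omega> / 2)"

definition stoch_exp_from ::
    "(real \<Rightarrow> 'a \<Rightarrow> real) \<Rightarrow> (real \<Rightarrow> 'a \<Rightarrow> real) \<Rightarrow> ('a \<Rightarrow> real) \<Rightarrow> real \<Rightarrow> 'a \<Rightarrow> real" where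
  "stoch_exp_from M A \<tau> T \<omega> = stoch_exp M A T \<omega> / stoch_exp M A (\<tau> \<omega>) \<omega>"

definition R_condition ::
    "'a measure \<Rightarrow> (real \<Rightarrow> 'a measure) \<Rightarrow> real \<Rightarrow> (real \<Rightarrow> 'a \<Rightarrow> real) \<Rightarrow>
     (real \<Rightarrow> 'a \<Rightarrow> real) \<Rightarrow> real \<Rightarrow> real \<Rightarrow> bool" where
  "R_condition P F T M A p C \<longleftrightarrow>
     (\<forall>\<tau>\<in>stopping_times (space P) F T. AE \<omega> in P.
        nn_cond_exp_at P F \<tau> (\<lambda>\<omega>. stoch_exp_from M A \<tau> T \<omega> powr p) \<omega> \<le> ennreal C)"

definition A_condition ::
    "'a measure \<Rightarrow> (real \<Rightarrow> 'a measure) \<Rightarrow> real \<Rightarrow> (real \<Rightarrow> 'a \<Rightarrow> real) \<Rightarrow>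
     (real \<Rightarrow> 'a \<Rightarrow> real) \<Rightarrow> real \<Rightarrow> real \<Rightarrow> bool" where
  "A_condition P F T M A p D \<longleftrightarrow>
     (\<forall>\<tau>\<in>stopping_times (space P) F T. AE \<omega> in P.
        nn_cond_exp_at P F \<tau> (\<lambda>\<omega>. stoch_exp_from M A \<tau> T \<omega> powr (- 1 / (p - 1))) \<omega> \<le> ennreal D)"

end

(* The argument avoids stochastic integration. Between two stopping times on which M and its square
characteristic A move by at most eps, the increments x of M and b of A satisfy E[x] = 0 and
E[x^2 - b] = 0 conditionally on the past, so a Taylor expansion with an error of order eps (x^2 + b)
plays the role of Ito's formula; summing over a partition into such steps gives E[x^2 + b] = 2 E[b]
and hence a total error of order eps.

For part (1) let X_s = E[E_{s,T}(M)^p | F_s]; then 1 <= X <= C. With w = E_{s,s'}(M)^p the tower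
property reads E[w X_{s'} | F_s] = X_s, and minimising exp (- beta X') under this constraint gives
E[exp (- beta X_{s'}) | F_s] >= exp (- beta X_s) E[w - w ln w + beta X_s (w - 1) | F_s]. On a small step
the last expectation is at least 1 + (p (beta (p - 1) - p) / 2 - O(eps)) E[A_{s'} - A_s | F_s].
Telescoping bounds E[A_T - A_s | F_s].

Part (2) is part (1) for the conjugate exponent p / (p - 1) and the P'-martingale M' = A - M, whose
exponential is the inverse of that of M; that A is also the square characteristic of M' under P' is
Girsanov's theorem, obtained by the same partition argument. *)

theory Submission
  imports Defs
begin

section \<open>Taylor expansions of exponential increments\<close>

text \<open>No path regularity of the process X is available, and its martingale part need not be
  driven by M. X is therefore used only through its values at stopping times and the tower property,
  and the worst case over X' disposes of the rest. In Ito's calculus, if X moves along M with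
  coefficient \<psi>, its drift per unit of A is - (p (p - 1) X / 2 + p \<psi>), and exp (- \<beta>
  X) has relative drift \<beta> p (p - 1) X / 2 + \<beta> p \<psi> + \<beta>^2 \<psi>^2 / 2, up to a
  nonnegative term from the part of X orthogonal to M. The minimum, at \<psi> = - p / \<beta>, is
  (\<beta> p (p - 1) X - p^2) / 2; by X \<ge> 1 it is at least p (\<beta> (p - 1) - p) / 2, which is
  positive exactly for \<beta> > p / (p - 1). This is the origin of the denominator in the bound;
  the numerator comes from the range of exp (- \<beta> X) on 1 \<le> X \<le> C, divided by its least
  value. Since the norm is built on an unspecified version of the square characteristic, uniqueness
  of that process has to be proved as well.\<close>

definition negligible_increment :: "(real \<Rightarrow> real \<Rightarrow> real) \<Rightarrow> bool" where
  "negligible_increment r \<longleftrightarrow> (\<exists>K\<ge>0. \<forall>\<epsilon> x b. 0 < \<epsilon> \<longrightarrow> \<epsilon> \<le> 1 \<longrightarrow> \<bar>x\<bar> \<le> \<epsilon> \<longrightarrow> 0 \<le> b \<longrightarrow> b \<le> \<epsilon> \<longrightarrow>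
     \<bar>r x b\<bar> \<le> K * \<epsilon> * (x\<^sup>2 + b))"

lemma negligible_incrementI:
  assumes "0 \<le> K" "\<And>\<epsilon> x b. 0 < \<epsilon> \<Longrightarrow> \<epsilon> \<le> 1 \<Longrightarrow> \<bar>x\<bar> \<le> \<epsilon> \<Longrightarrow> 0 \<le> b \<Longrightarrow> b \<le> \<epsilon> \<Longrightarrow> \<bar>r x b\<bar> \<le> K * \<epsilon> * (x\<^sup>2 + b)"
  shows "negligible_increment r"
  using assms unfolding negligible_increment_def by blast

lemma negligible_incrementE:
  assumes "negligible_increment r"
  obtains K where "0 \<le> K" "\<And>\<epsilon> x b. 0 < \<epsilon> \<Longrightarrow> \<epsilon> \<le> 1 \<Longrightarrow> \<bar>x\<bar> \<le> \<epsilon> \<Longrightarrow> 0 \<le> b \<Longrightarrow> b \<le> \<epsilon> \<Longrightarrow> \<bar>r x b\<bar> \<le> K * \<epsilon> * (x\<^sup>2 + b)"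
  using assms unfolding negligible_increment_def by blast

text \<open>In the notion, K is fixed before \<epsilon>: a negligible remainder is at most a
  multiple of max |x| b times (x^2 + b) on the unit box, and one constant serves partitions of every
  mesh. As \<epsilon> never exceeds 1, a comparison on the unit box is enough.\<close>

lemma negligible_increment_bound:
  assumes r: "negligible_increment r" and C: "0 \<le> C"
    and le: "\<And>x b. \<bar>x\<bar> \<le> 1 \<Longrightarrow> 0 \<le> b \<Longrightarrow> b \<le> 1 \<Longrightarrow> \<bar>r' x b\<bar> \<le> C * \<bar>r x b\<bar>"
  shows "negligible_increment r'"
proof -
  from r obtain K where K: "0 \<le> K"
    "\<And>\<epsilon> x b. 0 < \<epsilon> \<Longrightarrow> \<epsilon> \<le> 1 \<Longrightarrow> \<bar>x\<bar> \<le> \<epsilon> \<Longrightarrow> 0 \<le> b \<Longrightarrow> b \<le> \<epsilon> \<Longrightarrow> \<bar>r x b\<bar> \<le> K * \<epsilon> * (x\<^sup>2 + b)"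
    by (rule negligible_incrementE) (rule that; assumption)
  show ?thesis
  proof (rule negligible_incrementI[of "C * K"])
    fix \<epsilon> x b :: real assume h: "0 < \<epsilon>" "\<epsilon> \<le> 1" "\<bar>x\<bar> \<le> \<epsilon>" "0 \<le> b" "b \<le> \<epsilon>"
    have "\<bar>r' x b\<bar> \<le> C * \<bar>r x b\<bar>" using h by (intro le) auto
    also have "\<dots> \<le> C * (K * \<epsilon> * (x\<^sup>2 + b))" by (intro mult_left_mono K h C)
    finally show "\<bar>r' x b\<bar> \<le> C * K * \<epsilon> * (x\<^sup>2 + b)" by (simp add: mult.assoc)
  qed (use K C in simp)
qed

lemma negligible_increment_add:
  assumes "negligible_increment r" "negligible_increment r'"
  shows "negligible_increment (\<lambda>x b. r x b + r' x b)"
proof -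
  from assms(1) obtain K where K: "0 \<le> K"
    "\<And>\<epsilon> x b. 0 < \<epsilon> \<Longrightarrow> \<epsilon> \<le> 1 \<Longrightarrow> \<bar>x\<bar> \<le> \<epsilon> \<Longrightarrow> 0 \<le> b \<Longrightarrow> b \<le> \<epsilon> \<Longrightarrow> \<bar>r x b\<bar> \<le> K * \<epsilon> * (x\<^sup>2 + b)"
    by (rule negligible_incrementE) (rule that; assumption)
  from assms(2) obtain K' where K': "0 \<le> K'"
    "\<And>\<epsilon> x b. 0 < \<epsilon> \<Longrightarrow> \<epsilon> \<le> 1 \<Longrightarrow> \<bar>x\<bar> \<le> \<epsilon> \<Longrightarrow> 0 \<le> b \<Longrightarrow> b \<le> \<epsilon> \<Longrightarrow> \<bar>r' x b\<bar> \<le> K' * \<epsilon> * (x\<^sup>2 + b)"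
    by (rule negligible_incrementE) (rule that; assumption)
  show ?thesis
  proof (rule negligible_incrementI[of "K + K'"])
    fix \<epsilon> x b :: real assume h: "0 < \<epsilon>" "\<epsilon> \<le> 1" "\<bar>x\<bar> \<le> \<epsilon>" "0 \<le> b" "b \<le> \<epsilon>"
    have "\<bar>r x b + r' x b\<bar> \<le> \<bar>r x b\<bar> + \<bar>r' x b\<bar>" by (rule abs_triangle_ineq)
    also have "\<dots> \<le> K * \<epsilon> * (x\<^sup>2 + b) + K' * \<epsilon> * (x\<^sup>2 + b)" by (intro add_mono K K' h)
    finally show "\<bar>r x b + r' x b\<bar> \<le> (K + K') * \<epsilon> * (x\<^sup>2 + b)" by (simp add: algebra_simps)
  qed (use K K' in simp)
qed

lemma negligible_increment_cmult:
  "negligible_increment r \<Longrightarrow> negligible_increment (\<lambda>x b. c * r x b)"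
  by (rule negligible_increment_bound[of r "\<bar>c\<bar>"]) (auto simp: abs_mult)

lemma negligible_increment_xb: "negligible_increment (\<lambda>x b. x * b)"
proof (rule negligible_incrementI[of 1])
  fix \<epsilon> x b :: real assume h: "0 < \<epsilon>" "\<epsilon> \<le> 1" "\<bar>x\<bar> \<le> \<epsilon>" "0 \<le> b" "b \<le> \<epsilon>"
  have "\<bar>x * b\<bar> \<le> \<epsilon> * b" using h by (auto simp: abs_mult intro: mult_right_mono)
  also have "\<dots> \<le> \<epsilon> * (x\<^sup>2 + b)" using h by (intro mult_left_mono) auto
  finally show "\<bar>x * b\<bar> \<le> 1 * \<epsilon> * (x\<^sup>2 + b)" by simp
qed simp

lemma negligible_increment_bb: "negligible_increment (\<lambda>x b. b\<^sup>2)"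
proof (rule negligible_incrementI[of 1])
  fix \<epsilon> x b :: real assume h: "0 < \<epsilon>" "\<epsilon> \<le> 1" "\<bar>x\<bar> \<le> \<epsilon>" "0 \<le> b" "b \<le> \<epsilon>"
  have "\<bar>b\<^sup>2\<bar> \<le> \<epsilon> * b" using h by (auto simp: power2_eq_square intro: mult_right_mono)
  also have "\<dots> \<le> \<epsilon> * (x\<^sup>2 + b)" using h by (intro mult_left_mono) auto
  finally show "\<bar>b\<^sup>2\<bar> \<le> 1 * \<epsilon> * (x\<^sup>2 + b)" by simp
qed simp

text \<open>y = x - b / 2 is the increment of the exponent M - A / 2. It is of order \<epsilon>, so
  its product with the second-order quantity x^2 + b is the model to which the remainders of the
  exponential are reduced.\<close>

lemma negligible_increment_yq: "negligible_increment (\<lambda>x b. (x - b / 2) * (x\<^sup>2 + b))"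
proof (rule negligible_incrementI[of 2])
  fix \<epsilon> x b :: real assume h: "0 < \<epsilon>" "\<epsilon> \<le> 1" "\<bar>x\<bar> \<le> \<epsilon>" "0 \<le> b" "b \<le> \<epsilon>"
  have "\<bar>x - b / 2\<bar> * (x\<^sup>2 + b) \<le> (2 * \<epsilon>) * (x\<^sup>2 + b)"
    using h by (intro mult_right_mono) auto
  then show "\<bar>(x - b / 2) * (x\<^sup>2 + b)\<bar> \<le> 2 * \<epsilon> * (x\<^sup>2 + b)" using h by (simp add: abs_mult)
qed simp

lemma negligible_increment_y3: "negligible_increment (\<lambda>x b. (x - b / 2) ^ 3)"
proof (rule negligible_increment_bound[OF negligible_increment_yq, of 3])
  fix x b :: real assume h: "\<bar>x\<bar> \<le> 1" "0 \<le> b" "b \<le> 1"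
  have "b\<^sup>2 \<le> b" using h by (simp add: power2_eq_square mult_left_le)
  \<comment> \<open>The parallelogram identity gives y^2 \<le> 2 x^2 + b^2 / 2, and b^2 \<le> b on
    the unit box; this is more than enough for the constant 3.\<close>
  moreover have "(x - b / 2)\<^sup>2 + (x + b / 2)\<^sup>2 = 2 * x\<^sup>2 + b\<^sup>2 / 2" by (simp add: power2_eq_square field_simps)
  ultimately have "(x - b / 2)\<^sup>2 \<le> 3 * (x\<^sup>2 + b)"
    using zero_le_power2[of "x + b / 2"] zero_le_power2[of x] h(2) unfolding distrib_left by linarith
  then have "\<bar>x - b / 2\<bar> * (x - b / 2)\<^sup>2 \<le> \<bar>x - b / 2\<bar> * (3 * (x\<^sup>2 + b))"
    by (intro mult_left_mono) auto
  moreover have "\<bar>(x - b / 2) ^ 3\<bar> = \<bar>x - b / 2\<bar> * (x - b / 2)\<^sup>2"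
    by (simp add: power3_eq_cube power2_eq_square abs_mult)
  moreover have "\<bar>(x - b / 2) * (x\<^sup>2 + b)\<bar> = \<bar>x - b / 2\<bar> * (x\<^sup>2 + b)"
    using h by (simp add: abs_mult)
  ultimately show "\<bar>(x - b / 2) ^ 3\<bar> \<le> 3 * \<bar>(x - b / 2) * (x\<^sup>2 + b)\<bar>"
    by (simp only: mult.left_commute)
qed simp

lemma exp_remainder1: "\<bar>exp u - 1\<bar> \<le> exp \<bar>u\<bar> * \<bar>u\<bar>" for u :: real
proof -
  obtain t where "\<bar>t\<bar> \<le> \<bar>u\<bar>" "exp u = (\<Sum>m<1. u ^ m / fact m) + exp t / fact 1 * u ^ 1"
    using Maclaurin_exp_le by blast
  then have "exp u - 1 = exp t * u" "exp t \<le> exp \<bar>u\<bar>" by simp_all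
  then show ?thesis by (simp add: abs_mult mult_right_mono)
qed

lemma exp_remainder2: "\<bar>exp u - 1 - u\<bar> \<le> exp \<bar>u\<bar> * u\<^sup>2" for u :: real
proof -
  obtain t where "\<bar>t\<bar> \<le> \<bar>u\<bar>" "exp u = (\<Sum>m<2. u ^ m / fact m) + exp t / fact 2 * u ^ 2"
    using Maclaurin_exp_le by blast
  moreover from this have "exp t \<le> exp \<bar>u\<bar>" by simp
  then have "exp t / 2 \<le> exp \<bar>u\<bar>" using exp_ge_zero[of "\<bar>u\<bar>"] by linarith
  ultimately have e: "exp u - 1 - u = exp t / 2 * u\<^sup>2" and le: "exp t / 2 \<le> exp \<bar>u\<bar>"
    by (auto simp: numeral_2_eq_2)
  have "\<bar>exp u - 1 - u\<bar> = exp t / 2 * u\<^sup>2" unfolding e by (simp add: abs_mult)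
  also have "\<dots> \<le> exp \<bar>u\<bar> * u\<^sup>2" by (intro mult_right_mono le) simp
  finally show ?thesis .
qed

lemma exp_remainder3: "\<bar>exp u - 1 - u - u\<^sup>2 / 2\<bar> \<le> exp \<bar>u\<bar> * \<bar>u\<bar> ^ 3" for u :: real
proof -
  obtain t where "\<bar>t\<bar> \<le> \<bar>u\<bar>" "exp u = (\<Sum>m<3. u ^ m / fact m) + exp t / fact 3 * u ^ 3"
    using Maclaurin_exp_le by blast
  moreover from this have "exp t \<le> exp \<bar>u\<bar>" by simp
  then have "exp t / 6 \<le> exp \<bar>u\<bar>" using exp_ge_zero[of "\<bar>u\<bar>"] by linarith
  ultimately have e: "exp u - 1 - u - u\<^sup>2 / 2 = exp t / 6 * u ^ 3" and le: "exp t / 6 \<le> exp \<bar>u\<bar>"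
    by (auto simp: numeral_2_eq_2 numeral_3_eq_3)
  have "\<bar>exp u - 1 - u - u\<^sup>2 / 2\<bar> = exp t / 6 * \<bar>u\<bar> ^ 3" unfolding e by (simp add: abs_mult power_abs)
  also have "\<dots> \<le> exp \<bar>u\<bar> * \<bar>u\<bar> ^ 3" by (intro mult_right_mono le) simp
  finally show ?thesis .
qed

lemma exp_abs_increment_bound:
  fixes x b l :: real
  assumes "\<bar>x\<bar> \<le> 1" "0 \<le> b" "b \<le> 1"
  shows "exp \<bar>l * (x - b / 2)\<bar> \<le> exp (2 * \<bar>l\<bar>)"
proof -
  have "\<bar>l\<bar> * \<bar>x - b / 2\<bar> \<le> \<bar>l\<bar> * 2" using assms by (intro mult_left_mono) auto
  then show ?thesis by (simp add: abs_mult mult.commute)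
qed

lemma exp_increment_expansion:
  "negligible_increment (\<lambda>x b. exp (l * (x - b / 2)) - 1 - (l * x - l * b / 2 + l\<^sup>2 * x\<^sup>2 / 2))"
proof -
  have "negligible_increment (\<lambda>x b. exp (l * (x - b / 2)) - 1 - l * (x - b / 2) - (l * (x - b / 2))\<^sup>2 / 2)"
  proof (rule negligible_increment_bound[OF negligible_increment_y3, of "exp (2 * \<bar>l\<bar>) * \<bar>l\<bar> ^ 3"])
    fix x b :: real assume h: "\<bar>x\<bar> \<le> 1" "0 \<le> b" "b \<le> 1"
    let ?u = "l * (x - b / 2)"
    have "\<bar>exp ?u - 1 - ?u - ?u\<^sup>2 / 2\<bar> \<le> exp \<bar>?u\<bar> * \<bar>?u\<bar> ^ 3" by (rule exp_remainder3)
    also have "\<dots> \<le> exp (2 * \<bar>l\<bar>) * \<bar>?u\<bar> ^ 3"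
      by (intro mult_right_mono exp_abs_increment_bound h) auto
    also have "\<dots> = exp (2 * \<bar>l\<bar>) * \<bar>l\<bar> ^ 3 * \<bar>(x - b / 2) ^ 3\<bar>"
      by (simp add: abs_mult power_mult_distrib power_abs)
    finally show "\<bar>exp ?u - 1 - ?u - ?u\<^sup>2 / 2\<bar> \<le> exp (2 * \<bar>l\<bar>) * \<bar>l\<bar> ^ 3 * \<bar>(x - b / 2) ^ 3\<bar>" .
  qed simp
  \<comment> \<open>The coefficients come from y^2 = x^2 - x b + b^2 / 4: replacing y^2 by x^2 in
    the quadratic term costs only multiples of x b and b^2.\<close>
  from negligible_increment_add[OF negligible_increment_add[OF this
      negligible_increment_cmult[OF negligible_increment_xb, of "- (l\<^sup>2 / 2)"]]
      negligible_increment_cmult[OF negligible_increment_bb, of "l\<^sup>2 / 8"]]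
  show ?thesis
    by (rule back_subst[of negligible_increment]) (simp add: fun_eq_iff power2_eq_square field_simps)
qed

text \<open>For l = p and w = exp (p y) this expands, up to the factor p, the entropy term w ln w of
  the reverse Hoelder step; the case l = 1 serves Girsanov's theorem.\<close>

lemma exp_mult_increment_expansion:
  "negligible_increment (\<lambda>x b. exp (l * (x - b / 2)) * (x - b / 2) - (x - b / 2 + l * x\<^sup>2))"
proof -
  have "negligible_increment (\<lambda>x b. (exp (l * (x - b / 2)) - 1 - l * (x - b / 2)) * (x - b / 2))"
  proof (rule negligible_increment_bound[OF negligible_increment_y3, of "exp (2 * \<bar>l\<bar>) * l\<^sup>2"])
    fix x b :: real assume h: "\<bar>x\<bar> \<le> 1" "0 \<le> b" "b \<le> 1"
    let ?u = "l * (x - b / 2)"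
    have "\<bar>(exp ?u - 1 - ?u) * (x - b / 2)\<bar> \<le> (exp \<bar>?u\<bar> * ?u\<^sup>2) * \<bar>x - b / 2\<bar>"
      unfolding abs_mult[of "exp ?u - 1 - ?u"] by (intro mult_right_mono exp_remainder2) auto
    also have "\<dots> \<le> (exp (2 * \<bar>l\<bar>) * ?u\<^sup>2) * \<bar>x - b / 2\<bar>"
      by (intro mult_right_mono exp_abs_increment_bound h) auto
    also have "\<dots> = exp (2 * \<bar>l\<bar>) * l\<^sup>2 * \<bar>(x - b / 2) ^ 3\<bar>"
    proof -
      have "\<bar>y ^ 3\<bar> = y\<^sup>2 * \<bar>y\<bar>" for y :: real
        by (simp add: power3_eq_cube power2_eq_square abs_mult)
      then show ?thesis by (simp add: power_mult_distrib)
    qed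
    finally show "\<bar>(exp ?u - 1 - ?u) * (x - b / 2)\<bar> \<le> exp (2 * \<bar>l\<bar>) * l\<^sup>2 * \<bar>(x - b / 2) ^ 3\<bar>" .
  qed simp
  from negligible_increment_add[OF negligible_increment_add[OF this
      negligible_increment_cmult[OF negligible_increment_xb, of "- l"]]
      negligible_increment_cmult[OF negligible_increment_bb, of "l / 4"]]
  show ?thesis
    by (rule back_subst[of negligible_increment]) (simp add: fun_eq_iff power2_eq_square field_simps)
qed

lemma exp_minus_one_increment:
  fixes x b :: real
  assumes "\<bar>x\<bar> \<le> 1" "0 \<le> b" "b \<le> 1"
  shows "\<bar>exp (x - b / 2) - 1\<bar> \<le> exp 2 * \<bar>x - b / 2\<bar>"
proof -
  have "\<bar>exp (x - b / 2) - 1\<bar> \<le> exp \<bar>x - b / 2\<bar> * \<bar>x - b / 2\<bar>" by (rule exp_remainder1)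
  also have "\<dots> \<le> exp 2 * \<bar>x - b / 2\<bar>"
    using exp_abs_increment_bound[OF assms, of 1] by (intro mult_right_mono) auto
  finally show ?thesis .
qed

text \<open>Since exp y - 1 is of order y, the weight exp y on a quantity that is already of second
  order may be replaced by 1.\<close>

lemma exp_times_increment:
  assumes "\<And>x b. 0 \<le> b \<Longrightarrow> \<bar>h x b\<bar> \<le> x\<^sup>2 + (b::real)"
  shows "negligible_increment (\<lambda>x b. (exp (x - b / 2) - 1) * h x b)"
proof (rule negligible_increment_bound[OF negligible_increment_yq, of "exp 2"])
  fix x b :: real assume h: "\<bar>x\<bar> \<le> 1" "0 \<le> b" "b \<le> 1"
  have "\<bar>(exp (x - b / 2) - 1) * h x b\<bar> \<le> (exp 2 * \<bar>x - b / 2\<bar>) * (x\<^sup>2 + b)"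
    unfolding abs_mult by (intro mult_mono exp_minus_one_increment h assms) auto
  then show "\<bar>(exp (x - b / 2) - 1) * h x b\<bar> \<le> exp 2 * \<bar>(x - b / 2) * (x\<^sup>2 + b)\<bar>"
    using h by (simp add: abs_mult mult.assoc)
qed simp

text \<open>Here and in the next two expansions the principal part combines only x and x^2 - b, both
  of conditional mean zero. This is the infinitesimal form of the statement that Z, Z M' and Z (M'^2
  - A) are local martingales, where Z is the exponential of M and M' = A - M.\<close>

lemma girsanov_expansion1:
  "negligible_increment (\<lambda>x b. exp (x - b / 2) - 1 - (x + (x\<^sup>2 - b) / 2))"
  using exp_increment_expansion[of 1] by (simp add: algebra_simps diff_divide_distrib)

lemma girsanov_expansion2:
  "negligible_increment (\<lambda>x b. exp (x - b / 2) * (b - x) - (- x - (x\<^sup>2 - b)))"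
proof -
  have "negligible_increment (\<lambda>x b. (exp (x - b / 2) - 1) * (b / 2))"
    by (rule exp_times_increment) (auto simp: add_increasing)
  from negligible_increment_add[OF negligible_increment_cmult[OF exp_mult_increment_expansion[of 1], of "-1"] this]
  show ?thesis
    by (rule back_subst[of negligible_increment]) (simp add: fun_eq_iff field_simps)
qed

lemma girsanov_expansion3:
  "negligible_increment (\<lambda>x b. exp (x - b / 2) * ((b - x)\<^sup>2 - b) - (x\<^sup>2 - b))"
proof -
  have 1: "negligible_increment (\<lambda>x b. (exp (x - b / 2) - 1) * (x\<^sup>2 - b))"
    by (rule exp_times_increment) (auto simp: abs_le_iff)
  have e: "\<bar>exp (x - b / 2)\<bar> \<le> exp 2" if "\<bar>x\<bar> \<le> 1" "0 \<le> b" for x b :: real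
    using that by auto
  have 2: "negligible_increment (\<lambda>x b. exp (x - b / 2) * b\<^sup>2)"
    by (rule negligible_increment_bound[OF negligible_increment_bb, of "exp 2"])
      (auto simp: abs_mult intro!: mult_right_mono)
  have 3: "negligible_increment (\<lambda>x b. exp (x - b / 2) * (x * b))"
    by (rule negligible_increment_bound[OF negligible_increment_xb, of "exp 2"])
      (auto simp: abs_mult intro!: mult_right_mono)
  \<comment> \<open>The three summands stem from (b - x)^2 - b = (x^2 - b) + b^2 - 2 x b; only the
    first leaves a principal part.\<close>
  from negligible_increment_add[OF negligible_increment_add[OF 1 2] negligible_increment_cmult[OF 3, of "-2"]]
  show ?thesis
    by (rule back_subst[of negligible_increment]) (simp add: fun_eq_iff power2_eq_square algebra_simps)
qed

section \<open>Expansions at a general starting point, uniform on compact boxes\<close>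

lemma continuous_bounded_on_box:
  fixes f :: "real \<Rightarrow> real \<Rightarrow> real"
  assumes "continuous_on UNIV (\<lambda>z. f (fst z) (snd z))"
  obtains C where "\<And>m a. \<bar>m\<bar> \<le> k \<Longrightarrow> 0 \<le> a \<Longrightarrow> a \<le> k \<Longrightarrow> \<bar>f m a\<bar> \<le> C"
proof -
  have "compact ((\<lambda>z. f (fst z) (snd z)) ` ({- k..k} \<times> {0..k}))"
    by (intro compact_continuous_image compact_Times continuous_on_subset[OF assms]) auto
  then have "bounded ((\<lambda>z. f (fst z) (snd z)) ` ({- k..k} \<times> {0..k}))" by (rule compact_imp_bounded)
  then obtain C where C: "\<forall>z\<in>{- k..k} \<times> {0..k}. \<bar>f (fst z) (snd z)\<bar> \<le> C" by (auto simp: bounded_iff)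
  show ?thesis
  proof (rule that[of C])
    fix m a :: real assume "\<bar>m\<bar> \<le> k" "0 \<le> a" "a \<le> k"
    then show "\<bar>f m a\<bar> \<le> C" using bspec[OF C, of "(m, a)"] by (auto simp: abs_le_iff)
  qed
qed

text \<open>With E = exp (m - a / 2), e = exp (x - b / 2) and u = a - m, the product changes by E (u
  (e - 1) + e (b - x)). Neither expansion leaves a term in b alone, so the drift vanishes, and E
  \<le> exp k and |u| \<le> 2 k make the constant uniform on the box.\<close>

lemma girsanov_first_order:
  fixes k :: real
  assumes k: "0 \<le> k"
  obtains K where "0 \<le> K" "\<And>\<epsilon> m a x b. 0 < \<epsilon> \<Longrightarrow> \<epsilon> \<le> 1 \<Longrightarrow> \<bar>m\<bar> \<le> k \<Longrightarrow> 0 \<le> a \<Longrightarrow> a \<le> k \<Longrightarrow> \<bar>x\<bar> \<le> \<epsilon> \<Longrightarrow> 0 \<le> b \<Longrightarrow> b \<le> \<epsilon> \<Longrightarrow>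
    \<bar>exp ((m + x) - (a + b) / 2) * ((a + b) - (m + x)) - exp (m - a / 2) * (a - m)
      - (exp (m - a / 2) * (a - m - 1)) * x - (exp (m - a / 2) * ((a - m) / 2 - 1)) * (x\<^sup>2 - b)\<bar> \<le> K * \<epsilon> * (x\<^sup>2 + b)"
proof -
  define r1 where "r1 x b = exp (x - b / 2) - 1 - (x + (x\<^sup>2 - b) / 2)" for x b :: real
  define r2 where "r2 x b = exp (x - b / 2) * (b - x) - (- x - (x\<^sup>2 - b))" for x b :: real
  obtain K1 where K1: "0 \<le> K1" "\<And>\<epsilon> x b. 0 < \<epsilon> \<Longrightarrow> \<epsilon> \<le> 1 \<Longrightarrow> \<bar>x\<bar> \<le> \<epsilon> \<Longrightarrow> 0 \<le> b \<Longrightarrow> b \<le> \<epsilon> \<Longrightarrow> \<bar>r1 x b\<bar> \<le> K1 * \<epsilon> * (x\<^sup>2 + b)"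
    by (rule negligible_incrementE[OF girsanov_expansion1[folded r1_def]]) (rule that; assumption)
  obtain K2 where K2: "0 \<le> K2" "\<And>\<epsilon> x b. 0 < \<epsilon> \<Longrightarrow> \<epsilon> \<le> 1 \<Longrightarrow> \<bar>x\<bar> \<le> \<epsilon> \<Longrightarrow> 0 \<le> b \<Longrightarrow> b \<le> \<epsilon> \<Longrightarrow> \<bar>r2 x b\<bar> \<le> K2 * \<epsilon> * (x\<^sup>2 + b)"
    by (rule negligible_incrementE[OF girsanov_expansion2[folded r2_def]]) (rule that; assumption)
  show ?thesis
  proof (rule that[of "exp k * (2 * k * K1 + K2)"])
    fix \<epsilon> m a x b :: real
    assume h: "0 < \<epsilon>" "\<epsilon> \<le> 1" "\<bar>m\<bar> \<le> k" "0 \<le> a" "a \<le> k" "\<bar>x\<bar> \<le> \<epsilon>" "0 \<le> b" "b \<le> \<epsilon>"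
    define E where "E = exp (m - a / 2)"
    define e where "e = exp (x - b / 2)"
    define u where "u = a - m"
    have E: "0 \<le> E" "E \<le> exp k" using h by (auto simp: E_def)
    have u: "\<bar>u\<bar> \<le> 2 * k" using h by (auto simp: u_def)
    have "exp ((m + x) - (a + b) / 2) = E * e"
      unfolding E_def e_def exp_add[symmetric] by (rule arg_cong[where f=exp]) (simp add: field_simps)
    then have "exp ((m + x) - (a + b) / 2) * ((a + b) - (m + x)) - E * (a - m)
      - (E * (a - m - 1)) * x - (E * ((a - m) / 2 - 1)) * (x\<^sup>2 - b) = E * (u * r1 x b + r2 x b)"
      unfolding r1_def r2_def e_def[symmetric] u_def by (simp add: algebra_simps)
    also have "\<bar>\<dots>\<bar> \<le> exp k * ((2 * k) * (K1 * \<epsilon> * (x\<^sup>2 + b)) + K2 * \<epsilon> * (x\<^sup>2 + b))"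
    proof -
      have "\<bar>u * r1 x b + r2 x b\<bar> \<le> \<bar>u\<bar> * \<bar>r1 x b\<bar> + \<bar>r2 x b\<bar>"
        using abs_triangle_ineq[of "u * r1 x b" "r2 x b"] by (simp only: abs_mult)
      also have "\<dots> \<le> (2 * k) * (K1 * \<epsilon> * (x\<^sup>2 + b)) + K2 * \<epsilon> * (x\<^sup>2 + b)"
        using k by (intro add_mono mult_mono u K1 K2 h) auto
      finally have *: "\<bar>u * r1 x b + r2 x b\<bar> \<le> (2 * k) * (K1 * \<epsilon> * (x\<^sup>2 + b)) + K2 * \<epsilon> * (x\<^sup>2 + b)" .
      show ?thesis unfolding abs_mult[of E] using E by (intro mult_mono *) auto
    qed
    also have "\<dots> = exp k * (2 * k * K1 + K2) * \<epsilon> * (x\<^sup>2 + b)" by (simp add: algebra_simps)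
    finally show "\<bar>exp ((m + x) - (a + b) / 2) * ((a + b) - (m + x)) - exp (m - a / 2) * (a - m)
      - (exp (m - a / 2) * (a - m - 1)) * x - (exp (m - a / 2) * ((a - m) / 2 - 1)) * (x\<^sup>2 - b)\<bar>
      \<le> exp k * (2 * k * K1 + K2) * \<epsilon> * (x\<^sup>2 + b)" unfolding E_def .
  qed (use K1 K2 k in simp)
qed

text \<open>The change is now E ((u^2 - a) (e - 1) + 2 u e (b - x) + e ((b - x)^2 - b)), so the
  three one-step expansions enter with weights u^2 - a, 2 u and 1. Again no term in b alone
  survives.\<close>

lemma girsanov_second_order:
  fixes k :: real
  assumes k: "0 \<le> k"
  obtains K where "0 \<le> K" "\<And>\<epsilon> m a x b. 0 < \<epsilon> \<Longrightarrow> \<epsilon> \<le> 1 \<Longrightarrow> \<bar>m\<bar> \<le> k \<Longrightarrow> 0 \<le> a \<Longrightarrow> a \<le> k \<Longrightarrow> \<bar>x\<bar> \<le> \<epsilon> \<Longrightarrow> 0 \<le> b \<Longrightarrow> b \<le> \<epsilon> \<Longrightarrow>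
    \<bar>exp ((m + x) - (a + b) / 2) * (((a + b) - (m + x))\<^sup>2 - (a + b)) - exp (m - a / 2) * ((a - m)\<^sup>2 - a)
      - (exp (m - a / 2) * ((a - m)\<^sup>2 - a - 2 * (a - m))) * x
      - (exp (m - a / 2) * (((a - m)\<^sup>2 - a) / 2 - 2 * (a - m) + 1)) * (x\<^sup>2 - b)\<bar> \<le> K * \<epsilon> * (x\<^sup>2 + b)"
proof -
  define r1 where "r1 x b = exp (x - b / 2) - 1 - (x + (x\<^sup>2 - b) / 2)" for x b :: real
  define r2 where "r2 x b = exp (x - b / 2) * (b - x) - (- x - (x\<^sup>2 - b))" for x b :: real
  define r3 where "r3 x b = exp (x - b / 2) * ((b - x)\<^sup>2 - b) - (x\<^sup>2 - b)" for x b :: real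
  obtain K1 where K1: "0 \<le> K1" "\<And>\<epsilon> x b. 0 < \<epsilon> \<Longrightarrow> \<epsilon> \<le> 1 \<Longrightarrow> \<bar>x\<bar> \<le> \<epsilon> \<Longrightarrow> 0 \<le> b \<Longrightarrow> b \<le> \<epsilon> \<Longrightarrow> \<bar>r1 x b\<bar> \<le> K1 * \<epsilon> * (x\<^sup>2 + b)"
    by (rule negligible_incrementE[OF girsanov_expansion1[folded r1_def]]) (rule that; assumption)
  obtain K2 where K2: "0 \<le> K2" "\<And>\<epsilon> x b. 0 < \<epsilon> \<Longrightarrow> \<epsilon> \<le> 1 \<Longrightarrow> \<bar>x\<bar> \<le> \<epsilon> \<Longrightarrow> 0 \<le> b \<Longrightarrow> b \<le> \<epsilon> \<Longrightarrow> \<bar>r2 x b\<bar> \<le> K2 * \<epsilon> * (x\<^sup>2 + b)"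
    by (rule negligible_incrementE[OF girsanov_expansion2[folded r2_def]]) (rule that; assumption)
  obtain K3 where K3: "0 \<le> K3" "\<And>\<epsilon> x b. 0 < \<epsilon> \<Longrightarrow> \<epsilon> \<le> 1 \<Longrightarrow> \<bar>x\<bar> \<le> \<epsilon> \<Longrightarrow> 0 \<le> b \<Longrightarrow> b \<le> \<epsilon> \<Longrightarrow> \<bar>r3 x b\<bar> \<le> K3 * \<epsilon> * (x\<^sup>2 + b)"
    by (rule negligible_incrementE[OF girsanov_expansion3[folded r3_def]]) (rule that; assumption)
  show ?thesis
  proof (rule that[of "exp k * (((2 * k)\<^sup>2 + k) * K1 + 4 * k * K2 + K3)"])
    fix \<epsilon> m a x b :: real
    assume h: "0 < \<epsilon>" "\<epsilon> \<le> 1" "\<bar>m\<bar> \<le> k" "0 \<le> a" "a \<le> k" "\<bar>x\<bar> \<le> \<epsilon>" "0 \<le> b" "b \<le> \<epsilon>"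
    define E where "E = exp (m - a / 2)"
    define e where "e = exp (x - b / 2)"
    define u where "u = a - m"
    have E: "0 \<le> E" "E \<le> exp k" using h by (auto simp: E_def)
    have u: "\<bar>u\<bar> \<le> 2 * k" using h by (auto simp: u_def)
    then have "u\<^sup>2 \<le> (2 * k)\<^sup>2" using k abs_le_square_iff[of u "2 * k"] by simp
    then have u2: "\<bar>u\<^sup>2 - a\<bar> \<le> (2 * k)\<^sup>2 + k"
      using h(4,5) zero_le_power2[of u] zero_le_power2[of "2 * k"] by (intro abs_leI) linarith+
    have "exp ((m + x) - (a + b) / 2) = E * e"
      unfolding E_def e_def exp_add[symmetric] by (rule arg_cong[where f=exp]) (simp add: field_simps)
    then have "exp ((m + x) - (a + b) / 2) * (((a + b) - (m + x))\<^sup>2 - (a + b)) - E * ((a - m)\<^sup>2 - a)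
      - (E * ((a - m)\<^sup>2 - a - 2 * (a - m))) * x - (E * (((a - m)\<^sup>2 - a) / 2 - 2 * (a - m) + 1)) * (x\<^sup>2 - b)
      = E * ((u\<^sup>2 - a) * r1 x b + 2 * u * r2 x b + r3 x b)"
      unfolding r1_def r2_def r3_def e_def[symmetric] u_def by (simp add: field_simps power2_eq_square)
    also have "\<bar>\<dots>\<bar> \<le> exp k * (((2 * k)\<^sup>2 + k) * (K1 * \<epsilon> * (x\<^sup>2 + b)) + (4 * k) * (K2 * \<epsilon> * (x\<^sup>2 + b)) + K3 * \<epsilon> * (x\<^sup>2 + b))"
    proof -
      have "\<bar>(u\<^sup>2 - a) * r1 x b + 2 * u * r2 x b + r3 x b\<bar> \<le> \<bar>u\<^sup>2 - a\<bar> * \<bar>r1 x b\<bar> + \<bar>2 * u\<bar> * \<bar>r2 x b\<bar> + \<bar>r3 x b\<bar>"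
        unfolding abs_mult[of "u\<^sup>2 - a", symmetric] abs_mult[of "2 * u", symmetric]
        using abs_triangle_ineq[of "(u\<^sup>2 - a) * r1 x b + 2 * u * r2 x b" "r3 x b"]
          abs_triangle_ineq[of "(u\<^sup>2 - a) * r1 x b" "2 * u * r2 x b"] by argo
      also have "\<dots> \<le> ((2 * k)\<^sup>2 + k) * (K1 * \<epsilon> * (x\<^sup>2 + b)) + (4 * k) * (K2 * \<epsilon> * (x\<^sup>2 + b)) + K3 * \<epsilon> * (x\<^sup>2 + b)"
        using k u by (intro add_mono mult_mono u2 K1 K2 K3 h) auto
      finally have *: "\<bar>(u\<^sup>2 - a) * r1 x b + 2 * u * r2 x b + r3 x b\<bar>
        \<le> ((2 * k)\<^sup>2 + k) * (K1 * \<epsilon> * (x\<^sup>2 + b)) + (4 * k) * (K2 * \<epsilon> * (x\<^sup>2 + b)) + K3 * \<epsilon> * (x\<^sup>2 + b)" .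
      show ?thesis unfolding abs_mult[of E] using E by (intro mult_mono *) auto
    qed
    also have "\<dots> = exp k * (((2 * k)\<^sup>2 + k) * K1 + 4 * k * K2 + K3) * \<epsilon> * (x\<^sup>2 + b)" by (simp add: algebra_simps)
    finally show "\<bar>exp ((m + x) - (a + b) / 2) * (((a + b) - (m + x))\<^sup>2 - (a + b)) - exp (m - a / 2) * ((a - m)\<^sup>2 - a)
      - (exp (m - a / 2) * ((a - m)\<^sup>2 - a - 2 * (a - m))) * x
      - (exp (m - a / 2) * (((a - m)\<^sup>2 - a) / 2 - 2 * (a - m) + 1)) * (x\<^sup>2 - b)\<bar>
      \<le> exp k * (((2 * k)\<^sup>2 + k) * K1 + 4 * k * K2 + K3) * \<epsilon> * (x\<^sup>2 + b)" unfolding E_def .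
  qed (use K1 K2 K3 k in simp)
qed

text \<open>For w = exp (p (x - b / 2)), the term w - 1 has drift (p^2 - p) / 2 per unit of b, and
  the entropy part w - w ln w - 1 has drift - p^2 / 2. Weighting the former by \<beta> X yields the
  coefficient of b; what remains besides the error is a combination of x and x^2 - b.\<close>

lemma reverse_hoelder_expansion:
  fixes p \<beta> C :: real
  assumes p: "0 \<le> p" and \<beta>: "0 \<le> \<beta>" and C: "1 \<le> C"
  obtains K where "0 \<le> K" "\<And>\<epsilon> X x b. 0 < \<epsilon> \<Longrightarrow> \<epsilon> \<le> 1 \<Longrightarrow> 1 \<le> X \<Longrightarrow> X \<le> C \<Longrightarrow> \<bar>x\<bar> \<le> \<epsilon> \<Longrightarrow> 0 \<le> b \<Longrightarrow> b \<le> \<epsilon> \<Longrightarrow>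
    \<beta> * p * X * x + (\<beta> * X * p\<^sup>2 - p\<^sup>2) / 2 * (x\<^sup>2 - b) + b * ((\<beta> * X * (p\<^sup>2 - p) - p\<^sup>2) / 2) - K * \<epsilon> * (x\<^sup>2 + b)
    \<le> exp (p * (x - b / 2)) - exp (p * (x - b / 2)) * (p * (x - b / 2)) + \<beta> * X * (exp (p * (x - b / 2)) - 1) - 1"
proof -
  define r1 where "r1 x b = exp (p * (x - b / 2)) - 1 - (p * x - p * b / 2 + p\<^sup>2 * x\<^sup>2 / 2)" for x b :: real
  define r2 where "r2 x b = exp (p * (x - b / 2)) * (x - b / 2) - (x - b / 2 + p * x\<^sup>2)" for x b :: real
  obtain K1 where K1: "0 \<le> K1" "\<And>\<epsilon> x b. 0 < \<epsilon> \<Longrightarrow> \<epsilon> \<le> 1 \<Longrightarrow> \<bar>x\<bar> \<le> \<epsilon> \<Longrightarrow> 0 \<le> b \<Longrightarrow> b \<le> \<epsilon> \<Longrightarrow> \<bar>r1 x b\<bar> \<le> K1 * \<epsilon> * (x\<^sup>2 + b)"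
    by (rule negligible_incrementE[OF exp_increment_expansion[of p, folded r1_def]]) (rule that; assumption)
  obtain K2 where K2: "0 \<le> K2" "\<And>\<epsilon> x b. 0 < \<epsilon> \<Longrightarrow> \<epsilon> \<le> 1 \<Longrightarrow> \<bar>x\<bar> \<le> \<epsilon> \<Longrightarrow> 0 \<le> b \<Longrightarrow> b \<le> \<epsilon> \<Longrightarrow> \<bar>r2 x b\<bar> \<le> K2 * \<epsilon> * (x\<^sup>2 + b)"
    by (rule negligible_incrementE[OF exp_mult_increment_expansion[of p, folded r2_def]]) (rule that; assumption)
  show ?thesis
  proof (rule that[of "(1 + \<beta> * C) * K1 + p * K2"])
    fix \<epsilon> X x b :: real
    assume h: "0 < \<epsilon>" "\<epsilon> \<le> 1" "1 \<le> X" "X \<le> C" "\<bar>x\<bar> \<le> \<epsilon>" "0 \<le> b" "b \<le> \<epsilon>"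
    define w where "w = exp (p * (x - b / 2))"
    have "\<bar>(1 + \<beta> * X) * r1 x b - p * r2 x b\<bar> \<le> \<bar>1 + \<beta> * X\<bar> * \<bar>r1 x b\<bar> + \<bar>p\<bar> * \<bar>r2 x b\<bar>"
      using abs_triangle_ineq4[of "(1 + \<beta> * X) * r1 x b" "p * r2 x b"] by (simp only: abs_mult)
    also have "\<dots> \<le> (1 + \<beta> * C) * (K1 * \<epsilon> * (x\<^sup>2 + b)) + p * (K2 * \<epsilon> * (x\<^sup>2 + b))"
      using \<beta> p h C by (intro add_mono mult_mono K1 K2) (auto intro: mult_left_mono)
    also have "\<dots> = ((1 + \<beta> * C) * K1 + p * K2) * \<epsilon> * (x\<^sup>2 + b)" by (simp add: algebra_simps)
    finally have "- (((1 + \<beta> * C) * K1 + p * K2) * \<epsilon> * (x\<^sup>2 + b)) \<le> (1 + \<beta> * X) * r1 x b - p * r2 x b"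
      by (simp only: abs_le_iff minus_le_iff)
    moreover have "w - w * (p * (x - b / 2)) + \<beta> * X * (w - 1) - 1
        = (\<beta> * p * X * x + (\<beta> * X * p\<^sup>2 - p\<^sup>2) / 2 * (x\<^sup>2 - b) + b * ((\<beta> * X * (p\<^sup>2 - p) - p\<^sup>2) / 2))
          + ((1 + \<beta> * X) * r1 x b - p * r2 x b)"
      unfolding r1_def r2_def w_def[symmetric] by (simp add: field_simps power2_eq_square)
    ultimately show "\<beta> * p * X * x + (\<beta> * X * p\<^sup>2 - p\<^sup>2) / 2 * (x\<^sup>2 - b) + b * ((\<beta> * X * (p\<^sup>2 - p) - p\<^sup>2) / 2)
        - ((1 + \<beta> * C) * K1 + p * K2) * \<epsilon> * (x\<^sup>2 + b)
      \<le> exp (p * (x - b / 2)) - exp (p * (x - b / 2)) * (p * (x - b / 2)) + \<beta> * X * (exp (p * (x - b / 2)) - 1) - 1"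
      unfolding w_def[symmetric] by simp
  qed (use K1 K2 p \<beta> C in auto)
qed

text \<open>The slope of this lower bound in \<open>X'\<close> is a multiple of \<open>exp z\<close> because the tower property
  determines the expectation of \<open>exp z * X'\<close>.\<close>

lemma exp_tangent_bound:
  fixes X X' z \<beta> :: real
  shows "exp (- \<beta> * X) * (exp z - exp z * z - \<beta> * (X' - X) * exp z) \<le> exp (- \<beta> * X')"
proof -
  let ?u = "- \<beta> * (X' - X)"
  have "1 + (?u - z) \<le> exp (?u - z)" by (rule exp_ge_add_one_self)
  then have "exp z * (1 + (?u - z)) \<le> exp z * exp (?u - z)" by (intro mult_left_mono) auto
  also have "\<dots> = exp ?u" by (simp add: exp_add[symmetric])
  finally have "exp (- \<beta> * X) * (exp z * (1 + (?u - z))) \<le> exp (- \<beta> * X) * exp ?u"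
    by (intro mult_left_mono) auto
  also have "\<dots> = exp (- \<beta> * X')" by (simp add: exp_add[symmetric] algebra_simps)
  finally show ?thesis by (simp add: algebra_simps)
qed

context usual_filtration
begin

section \<open>Stopping times and stopped values\<close>

abbreviation "ST \<equiv> stopping_times (space P) F T"

lemma ST_stopping_time: "\<tau> \<in> ST \<Longrightarrow> stopping_time F \<tau>"
  by (simp add: stopping_times_def)

lemma ST_range: "\<tau> \<in> ST \<Longrightarrow> \<omega> \<in> space P \<Longrightarrow> 0 \<le> \<tau> \<omega> \<and> \<tau> \<omega> \<le> T"
  by (auto simp: stopping_times_def)

lemma sets_F_subset: "t \<le> T \<Longrightarrow> sets (F t) \<subseteq> sets P"
proof -
  assume "t \<le> T"
  have "sets (F t) \<subseteq> sets (F T)" using \<open>t \<le> T\<close> by (rule sets_F_mono)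
  also have "\<dots> \<subseteq> sets P" using subalgebra_F[of T] horizon_pos by (auto simp: subalgebra_def)
  finally show ?thesis .
qed

text \<open>The range makes the sublevel sets empty before 0 and equal to the whole space from T on,
  which leaves exactly the times at which the filtration is right-continuous.\<close>

lemma stopping_timesI:
  assumes range: "\<And>\<omega>. \<omega> \<in> space P \<Longrightarrow> 0 \<le> \<tau> \<omega> \<and> \<tau> \<omega> \<le> T"
    and le: "\<And>t. 0 \<le> t \<Longrightarrow> t < T \<Longrightarrow> {\<omega> \<in> space P. \<tau> \<omega> \<le> t} \<in> sets (F t)"
  shows "\<tau> \<in> ST"
proof -
  have "{\<omega> \<in> space P. \<tau> \<omega> \<le> t} \<in> sets (F t)" for t
  proof -
    consider "t < 0" | "0 \<le> t" "t < T" | "T \<le> t" by linarith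
    then show ?thesis
    proof cases
      case 1
      then have "{\<omega> \<in> space P. \<tau> \<omega> \<le> t} = {}" using range by force
      then show ?thesis by (metis sets.empty_sets)
    next
      case 3
      then have "{\<omega> \<in> space P. \<tau> \<omega> \<le> t} = space (F t)"
        using range by (force simp: space_F)
      then show ?thesis by simp
    qed (rule le)
  qed
  then show ?thesis
    using range by (auto simp: stopping_times_def stopping_time_def pred_def space_F)
qed

text \<open>This is where right-continuity enters: the sublevel set at t is the intersection of the
  strict ones at t + (s - t) / (n + 1), hence it lies in \<open>F s\<close> for every s > t. Hitting
  times of open sets are stopping times for this reason.\<close>

lemma stopping_timesI_less:
  assumes range: "\<And>\<omega>. \<omega> \<in> space P \<Longrightarrow> 0 \<le> \<tau> \<omega> \<and> \<tau> \<omega> \<le> T"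
    and less: "\<And>t. 0 < t \<Longrightarrow> t \<le> T \<Longrightarrow> {\<omega> \<in> space P. \<tau> \<omega> < t} \<in> sets (F t)"
  shows "\<tau> \<in> ST"
proof (rule stopping_timesI[OF range])
  fix t assume t: "0 \<le> t" "t < T"
  have "{\<omega> \<in> space P. \<tau> \<omega> \<le> t} \<in> sets (F s)" if s: "s \<in> {t<..T}" for s
  proof -
    have eq: "{\<omega> \<in> space P. \<tau> \<omega> \<le> t} = (\<Inter>n. {\<omega> \<in> space P. \<tau> \<omega> < t + (s - t) / real (Suc n)})"
    proof (intro set_eqI iffI)
      fix \<omega> assume *: "\<omega> \<in> (\<Inter>n. {\<omega> \<in> space P. \<tau> \<omega> < t + (s - t) / real (Suc n)})"
      have "(\<lambda>n. t + (s - t) * inverse (real (Suc n))) \<longlonglongrightarrow> t + (s - t) * 0"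
        by (intro tendsto_intros LIMSEQ_inverse_real_of_nat)
      moreover have "\<tau> \<omega> \<le> t + (s - t) * inverse (real (Suc n))" for n
        using * by (auto simp: divide_inverse intro: less_imp_le)
      ultimately have "\<tau> \<omega> \<le> t"
        by (intro LIMSEQ_le_const[where a="\<tau> \<omega>"]) auto
      then show "\<omega> \<in> {\<omega> \<in> space P. \<tau> \<omega> \<le> t}" using * by auto
    next
      fix \<omega> assume *: "\<omega> \<in> {\<omega> \<in> space P. \<tau> \<omega> \<le> t}"
      have "0 < (s - t) / real (Suc n)" for n using s by simp
      then have "\<tau> \<omega> < t + (s - t) / real (Suc n)" for n using * by (smt (verit) mem_Collect_eq)
      then show "\<omega> \<in> (\<Inter>n. {\<omega> \<in> space P. \<tau> \<omega> < t + (s - t) / real (Suc n)})" using * by auto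
    qed
    have "{\<omega> \<in> space P. \<tau> \<omega> < t + (s - t) / real (Suc n)} \<in> sets (F s)" for n
    proof -
      have "(s - t) / real (Suc n) \<le> (s - t) / 1"
        using s by (intro divide_left_mono) auto
      moreover have "0 < (s - t) / real (Suc n)" using s by simp
      ultimately have "0 < t + (s - t) / real (Suc n)" "t + (s - t) / real (Suc n) \<le> T"
        "t + (s - t) / real (Suc n) \<le> s" using t s by auto
      with less[of "t + (s - t) / real (Suc n)"] sets_F_mono[of "t + (s - t) / real (Suc n)" s]
      show ?thesis by blast
    qed
    then show ?thesis unfolding eq by (intro sets.countable_INT) auto
  qed
  then show "{\<omega> \<in> space P. \<tau> \<omega> \<le> t} \<in> sets (F t)"
    using right_continuous[of t] t by auto
qed

lemma ST_const: "0 \<le> t \<Longrightarrow> t \<le> T \<Longrightarrow> (\<lambda>_. t) \<in> ST"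
  by (auto simp: stopping_times_def stopping_time_const)

lemma ST_min: "\<tau> \<in> ST \<Longrightarrow> \<sigma> \<in> ST \<Longrightarrow> (\<lambda>\<omega>. min (\<tau> \<omega>) (\<sigma> \<omega>)) \<in> ST"
  by (auto simp: stopping_times_def stopping_time_min min_le_iff_disj)

lemma ST_le_sets: "\<tau> \<in> ST \<Longrightarrow> {\<omega> \<in> space P. \<tau> \<omega> \<le> t} \<in> sets (F t)"
  using stopping_timeD[OF ST_stopping_time, of \<tau> t] by (simp add: pred_def space_F)

text \<open>Switching between two stopping times on an event known at the earlier one turns
  statements about expectations at all stopping times into statements about integrals over such
  events, that is, about conditional expectations.\<close>

lemma ST_if:
  assumes \<sigma>: "\<sigma> \<in> ST" and \<tau>: "\<tau> \<in> ST" and le: "\<And>\<omega>. \<omega> \<in> space P \<Longrightarrow> \<sigma> \<omega> \<le> \<tau> \<omega>"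
    and B: "B \<in> sets (pre_sigma \<sigma>)"
  shows "(\<lambda>\<omega>. if \<omega> \<in> B then \<sigma> \<omega> else \<tau> \<omega>) \<in> ST"
proof (rule stopping_timesI)
  show "0 \<le> (if \<omega> \<in> B then \<sigma> \<omega> else \<tau> \<omega>) \<and> (if \<omega> \<in> B then \<sigma> \<omega> else \<tau> \<omega>) \<le> T"
    if "\<omega> \<in> space P" for \<omega> using ST_range[OF \<sigma> that] ST_range[OF \<tau> that] by auto
  fix t
  have BP: "B \<subseteq> space P" using sets.sets_into_space[OF B] by (simp add: space_pre_sigma)
  have "space P - B \<in> sets (pre_sigma \<sigma>)"
    using sets.compl_sets[OF B] by (simp add: space_pre_sigma)
  then have "space P - B \<in> sets (pre_sigma \<tau>)"
    using mono_pre_sigma[OF ST_stopping_time[OF \<sigma>] ST_stopping_time[OF \<tau>] le] by auto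
  from sets_pre_sigmaD[OF ST_stopping_time[OF \<tau>] this, of t]
    sets_pre_sigmaD[OF ST_stopping_time[OF \<sigma>] B, of t]
  have "{\<omega> \<in> B. \<sigma> \<omega> \<le> t} \<union> {\<omega> \<in> space P - B. \<tau> \<omega> \<le> t} \<in> sets (F t)" by auto
  moreover have "{\<omega> \<in> B. \<sigma> \<omega> \<le> t} \<union> {\<omega> \<in> space P - B. \<tau> \<omega> \<le> t}
      = {\<omega> \<in> space P. (if \<omega> \<in> B then \<sigma> \<omega> else \<tau> \<omega>) \<le> t}" using BP by auto
  ultimately show "{\<omega> \<in> space P. (if \<omega> \<in> B then \<sigma> \<omega> else \<tau> \<omega>) \<le> t} \<in> sets (F t)"
    by (simp only:)
qed

lemma pre_sigma_mono:
  "\<sigma> \<in> ST \<Longrightarrow> \<tau> \<in> ST \<Longrightarrow> (\<And>\<omega>. \<omega> \<in> space P \<Longrightarrow> \<sigma> \<omega> \<le> \<tau> \<omega>) \<Longrightarrow> sets (pre_sigma \<sigma>) \<subseteq> sets (pre_sigma \<tau>)"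
  by (intro mono_pre_sigma ST_stopping_time) auto

lemma measurable_pre_sigma_mono:
  "\<sigma> \<in> ST \<Longrightarrow> \<tau> \<in> ST \<Longrightarrow> (\<And>\<omega>. \<omega> \<in> space P \<Longrightarrow> \<sigma> \<omega> \<le> \<tau> \<omega>) \<Longrightarrow>
    f \<in> borel_measurable (pre_sigma \<sigma>) \<Longrightarrow> f \<in> borel_measurable (pre_sigma \<tau>)"
  using pre_sigma_mono[of \<sigma> \<tau>] by (auto simp: measurable_def space_pre_sigma)

lemma subalgebra_pre_sigma: "\<tau> \<in> ST \<Longrightarrow> subalgebra P (pre_sigma \<tau>)"
proof -
  assume \<tau>: "\<tau> \<in> ST"
  have "B \<in> sets P" if B: "B \<in> sets (pre_sigma \<tau>)" for B
  proof -
    have BP: "B \<subseteq> space P" using sets.sets_into_space[OF B] by (simp add: space_pre_sigma)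
    have "{\<omega> \<in> B. \<tau> \<omega> \<le> T} \<in> sets (F T)" by (rule sets_pre_sigmaD[OF ST_stopping_time[OF \<tau>] B])
    also have "{\<omega> \<in> B. \<tau> \<omega> \<le> T} = B" using ST_range[OF \<tau>] BP by auto
    finally show ?thesis using sets_F_subset[of T] by auto
  qed
  then show ?thesis by (auto simp: subalgebra_def space_pre_sigma)
qed

lemma pre_sigma_finite_measure_subalgebra: "\<tau> \<in> ST \<Longrightarrow> finite_measure_subalgebra P (pre_sigma \<tau>)"
  by (intro finite_measure_subalgebra.intro finite_measure_subalgebra_axioms.intro)
    (auto intro: subalgebra_pre_sigma finite_measure_axioms)

lemma pre_sigma_sets_subset: "\<tau> \<in> ST \<Longrightarrow> B \<in> sets (pre_sigma \<tau>) \<Longrightarrow> B \<in> sets P"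
  using subalgebra_pre_sigma[of \<tau>] by (auto simp: subalgebra_def)

lemma sets_F_pre_sigma_const: "sets (pre_sigma (\<lambda>_. t)) = sets (F t)"
proof -
  have st: "stopping_time F (\<lambda>_. t)" by (rule stopping_time_const)
  have "{\<omega> \<in> A. t \<le> s} \<in> sets (F s)" if "A \<in> sets (F t)" for A s
    using that sets_F_mono[of t s] by (cases "t \<le> s") auto
  moreover have "A \<in> sets (F t)" if "\<forall>s. {\<omega> \<in> A. t \<le> s} \<in> sets (F s)" for A
    using that[rule_format, of t] by simp
  ultimately show ?thesis unfolding sets_pre_sigma[OF st] by blast
qed

text \<open>Completeness puts every subset of a null set into \<open>F 0\<close>, so a change on a
  null set preserves measurability with respect to any sigma-algebra that contains
  \<open>F 0\<close>.\<close>

lemma measurable_AE_eq: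
  fixes f g :: "'a \<Rightarrow> real"
  assumes G: "space G = space P" "sets (F 0) \<subseteq> sets G" and f: "f \<in> borel_measurable G"
    and ae: "AE \<omega> in P. f \<omega> = g \<omega>"
  shows "g \<in> borel_measurable G"
proof -
  obtain N where N: "N \<in> null_sets P" "\<And>\<omega>. \<omega> \<in> space P - N \<Longrightarrow> f \<omega> = g \<omega>"
    using AE_E3[OF ae] by blast
  have sub: "B \<in> sets G" if "B \<subseteq> N" for B using complete[OF N(1) that] G(2) by auto
  show ?thesis
  proof (rule measurableI)
    fix S :: "real set" assume S: "S \<in> sets borel"
    have NP: "N \<subseteq> space P" using N(1) sets.sets_into_space by (auto simp: null_sets_def)
    have "g -` S \<inter> space G = ((f -` S \<inter> space G) - N) \<union> (g -` S \<inter> N)"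
      using N(2) G(1) NP by force
    also have "\<dots> \<in> sets G"
      using measurable_sets[OF f S] sub[of N] sub[of "g -` S \<inter> N"] by auto
    finally show "g -` S \<inter> space G \<in> sets G" .
  qed simp
qed

text \<open>Continuity is required of every path and not merely of almost every one, so that stopped
  values and hitting times can be handled pointwise. Exceptional null sets are removed once, by
  passing to a modification.\<close>

definition regular :: "(real \<Rightarrow> 'a \<Rightarrow> real) \<Rightarrow> bool" where
  "regular N \<longleftrightarrow> adapted F T N \<and> (\<forall>\<omega>\<in>space P. continuous_on {0..T} (\<lambda>t. N t \<omega>))"

lemma regular_adapted: "regular N \<Longrightarrow> 0 \<le> t \<Longrightarrow> t \<le> T \<Longrightarrow> N t \<in> borel_measurable (F t)"
  by (auto simp: regular_def adapted_def)

lemma regular_cont: "regular N \<Longrightarrow> \<omega> \<in> space P \<Longrightarrow> continuous_on {0..T} (\<lambda>t. N t \<omega>)"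
  by (auto simp: regular_def)

text \<open>Floor plus one rounds strictly upwards before the cut at t. Hence, for s < t, the
  rounded time is at most s exactly when the original time is strictly below a grid point not
  exceeding s. The cut preserves an upper bound t, so that the stopped values are measurable at t
  itself and not only at slightly later times.\<close>

definition round_up :: "nat \<Rightarrow> real \<Rightarrow> real \<Rightarrow> real" where
  "round_up n t u = min t ((of_int \<lfloor>real (Suc n) * u\<rfloor> + 1) / real (Suc n))"

lemma round_up_bounds:
  assumes "u \<le> t" shows "u \<le> round_up n t u" "round_up n t u \<le> t" "round_up n t u \<le> u + 1 / real (Suc n)"
proof -
  have "real (Suc n) * u \<le> of_int \<lfloor>real (Suc n) * u\<rfloor> + 1" by linarith
  then have "u \<le> (of_int \<lfloor>real (Suc n) * u\<rfloor> + 1) / real (Suc n)" by (simp add: field_simps)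
  then show "u \<le> round_up n t u" using assms by (simp add: round_up_def)
  show "round_up n t u \<le> t" by (simp add: round_up_def)
  have "of_int \<lfloor>real (Suc n) * u\<rfloor> + 1 \<le> real (Suc n) * u + 1" by linarith
  then have "(of_int \<lfloor>real (Suc n) * u\<rfloor> + 1) / real (Suc n) \<le> (real (Suc n) * u + 1) / real (Suc n)"
    by (intro divide_right_mono) auto
  also have "\<dots> = u + 1 / real (Suc n)" by (simp add: field_simps)
  finally show "round_up n t u \<le> u + 1 / real (Suc n)" by (simp add: round_up_def)
qed

lemma round_up_tendsto:
  assumes "u \<le> t" shows "(\<lambda>n. round_up n t u) \<longlonglongrightarrow> u"
proof (rule tendsto_sandwich[where f="\<lambda>n. u" and h="\<lambda>n. u + 1 / real (Suc n)"])
  have "(\<lambda>n. u + inverse (real (Suc n))) \<longlonglongrightarrow> u + 0"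
    by (intro tendsto_intros LIMSEQ_inverse_real_of_nat)
  then show "(\<lambda>n. u + 1 / real (Suc n)) \<longlonglongrightarrow> u" by (simp add: inverse_eq_divide)
qed (auto intro!: always_eventually round_up_bounds[OF assms] simp del: of_nat_Suc)

lemma round_up_finite:
  assumes "0 \<le> t"
  shows "finite ((\<lambda>u. round_up n t u) ` {0..T})"
proof (rule finite_subset)
  show "(\<lambda>u. round_up n t u) ` {0..T} \<subseteq> (\<lambda>k. min t ((of_int k + 1) / real (Suc n))) ` {0..\<lfloor>real (Suc n) * T\<rfloor>}"
  proof (rule image_subsetI)
    fix u assume u: "u \<in> {0..T}"
    have "0 \<le> \<lfloor>real (Suc n) * u\<rfloor>" "\<lfloor>real (Suc n) * u\<rfloor> \<le> \<lfloor>real (Suc n) * T\<rfloor>"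
      using u by (auto intro!: floor_mono mult_left_mono simp del: of_nat_Suc)
    then show "round_up n t u \<in> (\<lambda>k. min t ((of_int k + 1) / real (Suc n))) ` {0..\<lfloor>real (Suc n) * T\<rfloor>}"
      unfolding round_up_def by (intro image_eqI[where x="\<lfloor>real (Suc n) * u\<rfloor>"]) auto
  qed
qed simp

lemma ST_round_up:
  assumes \<tau>: "\<tau> \<in> ST" and t: "0 \<le> t" "t \<le> T" and le: "\<And>\<omega>. \<omega> \<in> space P \<Longrightarrow> \<tau> \<omega> \<le> t"
  shows "(\<lambda>\<omega>. round_up n t (\<tau> \<omega>)) \<in> ST"
proof (rule stopping_timesI)
  fix \<omega> assume "\<omega> \<in> space P"
  then show "0 \<le> round_up n t (\<tau> \<omega>) \<and> round_up n t (\<tau> \<omega>) \<le> T"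
    using round_up_bounds[OF le, of \<omega> n] ST_range[OF \<tau>, of \<omega>] t by auto
next
  fix s assume s: "0 \<le> s" "s < T"
  show "{\<omega> \<in> space P. round_up n t (\<tau> \<omega>) \<le> s} \<in> sets (F s)"
  proof (cases "t \<le> s")
    case True
    then have "{\<omega> \<in> space P. round_up n t (\<tau> \<omega>) \<le> s} = space (F s)"
      by (auto simp: round_up_def space_F)
    then show ?thesis by simp
  next
    case False
    let ?q = "of_int \<lfloor>real (Suc n) * s\<rfloor> / real (Suc n)"
    have "round_up n t u \<le> s \<longleftrightarrow> u < ?q" for u
    proof -
      have "round_up n t u \<le> s \<longleftrightarrow> of_int \<lfloor>real (Suc n) * u\<rfloor> + 1 \<le> real (Suc n) * s"
        using False by (simp add: round_up_def min_le_iff_disj field_simps)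
      also have "\<dots> \<longleftrightarrow> \<lfloor>real (Suc n) * u\<rfloor> + 1 \<le> \<lfloor>real (Suc n) * s\<rfloor>"
        by (simp add: le_floor_iff)
      also have "\<dots> \<longleftrightarrow> \<lfloor>real (Suc n) * u\<rfloor> < \<lfloor>real (Suc n) * s\<rfloor>" by linarith
      also have "\<dots> \<longleftrightarrow> real (Suc n) * u < of_int \<lfloor>real (Suc n) * s\<rfloor>"
        by (simp add: floor_less_iff)
      also have "\<dots> \<longleftrightarrow> u < ?q" by (simp add: field_simps)
      finally show ?thesis .
    qed
    then have "{\<omega> \<in> space P. round_up n t (\<tau> \<omega>) \<le> s} = {\<omega> \<in> space P. \<tau> \<omega> < ?q}" by auto
    also have "\<dots> \<in> sets (F ?q)"
      using stopping_time_less_const[OF ST_stopping_time[OF \<tau>]] by (simp add: pred_def space_F)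
    also have "sets (F ?q) \<subseteq> sets (F s)"
      by (rule sets_F_mono) (simp add: divide_le_eq mult.commute del: of_nat_Suc)
    finally show ?thesis .
  qed
qed

lemma stopped_value_finite_range:
  assumes N: "adapted F T N" and \<tau>: "\<tau> \<in> ST" and t: "0 \<le> t" "t \<le> T" and le: "\<And>\<omega>. \<omega> \<in> space P \<Longrightarrow> \<tau> \<omega> \<le> t"
    and fin: "finite (\<tau> ` space P)"
  shows "(\<lambda>\<omega>. N (\<tau> \<omega>) \<omega>) \<in> borel_measurable (F t)"
proof (rule measurable_compose_countable'[where f=N and g=\<tau> and I="\<tau> ` space P"])
  fix s assume s: "s \<in> \<tau> ` space P"
  then have "0 \<le> s" "s \<le> t" using ST_range[OF \<tau>] le by auto
  then have "N s \<in> borel_measurable (F s)" using N t by (auto simp: adapted_def)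
  then show "N s \<in> borel_measurable (F t)"
    using sets_F_mono[OF \<open>s \<le> t\<close>] by (auto simp: measurable_def space_F)
next
  show "\<tau> \<in> measurable (F t) (count_space (\<tau> ` space P))"
  proof (subst measurable_count_space_eq2[OF fin], intro conjI ballI)
    fix s assume "s \<in> \<tau> ` space P"
    then have st: "s \<le> t" using le by auto
    have "{\<omega> \<in> space P. \<tau> \<omega> = s} \<in> sets (F s)"
      using stopping_time_eq_const[OF ST_stopping_time[OF \<tau>]] by (simp add: pred_def space_F)
    moreover have "\<tau> -` {s} \<inter> space (F t) = {\<omega> \<in> space P. \<tau> \<omega> = s}" by (auto simp: space_F)
    ultimately show "\<tau> -` {s} \<inter> space (F t) \<in> sets (F t)" using sets_F_mono[OF st] by auto
  qed (auto simp: space_F)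
qed (use fin in \<open>simp add: countable_finite\<close>)

lemma regular_round_up_tendsto:
  assumes N: "regular N" and \<omega>: "\<omega> \<in> space P" and u: "0 \<le> u" "u \<le> t" "t \<le> T"
  shows "(\<lambda>n. N (round_up n t u) \<omega>) \<longlonglongrightarrow> N u \<omega>"
proof -
  have "round_up n t u \<in> {0..T}" for n
    using round_up_bounds[OF u(2), of n] u by auto
  then show ?thesis
    using u by (intro continuous_on_tendsto_compose[OF regular_cont[OF N \<omega>] round_up_tendsto]) auto
qed

text \<open>Path continuity takes the place of progressive measurability: the stopped value is the
  limit of the values at finite-range roundings, all bounded by t.\<close>

lemma stopped_value_F:
  assumes N: "regular N" and \<tau>: "\<tau> \<in> ST" and t: "0 \<le> t" "t \<le> T" and le: "\<And>\<omega>. \<omega> \<in> space P \<Longrightarrow> \<tau> \<omega> \<le> t"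
  shows "(\<lambda>\<omega>. N (\<tau> \<omega>) \<omega>) \<in> borel_measurable (F t)"
proof (rule borel_measurable_LIMSEQ_metric)
  fix n
  have "finite ((\<lambda>\<omega>. round_up n t (\<tau> \<omega>)) ` space P)"
    by (rule finite_subset[OF _ round_up_finite[OF t(1), of n]]) (use ST_range[OF \<tau>] in auto)
  then show "(\<lambda>\<omega>. N (round_up n t (\<tau> \<omega>)) \<omega>) \<in> borel_measurable (F t)"
    using N round_up_bounds[OF le]
    by (intro stopped_value_finite_range[OF _ ST_round_up[OF \<tau> t le] t]) (auto simp: regular_def)
next
  fix \<omega> assume "\<omega> \<in> space (F t)"
  then show "(\<lambda>n. N (round_up n t (\<tau> \<omega>)) \<omega>) \<longlonglongrightarrow> N (\<tau> \<omega>) \<omega>"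
    using N t le ST_range[OF \<tau>] by (intro regular_round_up_tendsto) (auto simp: space_F)
qed

text \<open>On the event that \<tau> is at most s, the stopped value coincides with the value at the
  minimum of \<tau> and s, which is measurable with respect to \<open>F s\<close>.\<close>

lemma stopped_value_measurable:
  assumes N: "regular N" and \<tau>: "\<tau> \<in> ST"
  shows "(\<lambda>\<omega>. N (\<tau> \<omega>) \<omega>) \<in> borel_measurable (pre_sigma \<tau>)"
proof (rule measurableI)
  fix S :: "real set" assume S: "S \<in> sets borel"
  show "(\<lambda>\<omega>. N (\<tau> \<omega>) \<omega>) -` S \<inter> space (pre_sigma \<tau>) \<in> sets (pre_sigma \<tau>)"
  proof (rule sets_pre_sigmaI[OF ST_stopping_time[OF \<tau>]])
    fix t
    let ?A = "{\<omega> \<in> (\<lambda>\<omega>. N (\<tau> \<omega>) \<omega>) -` S \<inter> space (pre_sigma \<tau>). \<tau> \<omega> \<le> t}"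
    show "?A \<in> sets (F t)"
    proof (cases "0 \<le> t")
      case False
      then have "?A = {}" using ST_range[OF \<tau>] by (force simp: space_pre_sigma)
      then show ?thesis by (metis (no_types, lifting) sets.empty_sets)
    next
      case True
      \<comment> \<open>Adaptedness holds only up to T, so t is cut there; as \<tau> never exceeds
        T, the event \<tau> \<le> t stays the same.\<close>
      define s where "s = min t T"
      have s: "0 \<le> s" "s \<le> T" "s \<le> t" using True horizon_pos by (auto simp: s_def)
      have m: "(\<lambda>\<omega>. N (min (\<tau> \<omega>) s) \<omega>) \<in> borel_measurable (F s)"
        by (rule stopped_value_F[OF N ST_min[OF \<tau> ST_const]]) (use s in auto)
      have "\<tau> \<omega> \<le> t \<longleftrightarrow> \<tau> \<omega> \<le> s" if "\<omega> \<in> space P" for \<omega>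
        using ST_range[OF \<tau> that] by (auto simp: s_def)
      then have "?A = ((\<lambda>\<omega>. N (min (\<tau> \<omega>) s) \<omega>) -` S \<inter> space (F s)) \<inter> {\<omega> \<in> space P. \<tau> \<omega> \<le> s}"
        by (auto simp: space_pre_sigma space_F min_absorb1)
      also have "\<dots> \<in> sets (F s)"
        using measurable_sets[OF m S] ST_le_sets[OF \<tau>] by auto
      finally show ?thesis using sets_F_mono[OF s(3)] by auto
    qed
  qed
qed simp

lemma stopped_value_measurable_P:
  "regular N \<Longrightarrow> \<tau> \<in> ST \<Longrightarrow> (\<lambda>\<omega>. N (\<tau> \<omega>) \<omega>) \<in> borel_measurable P"
  using measurable_from_subalg[OF subalgebra_pre_sigma stopped_value_measurable] by auto

lemma regular_stopped:
  assumes N: "regular N" and \<tau>: "\<tau> \<in> ST"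
  shows "regular (\<lambda>t \<omega>. N (min t (\<tau> \<omega>)) \<omega>)"
  unfolding regular_def adapted_def
proof (intro conjI ballI)
  fix t assume t: "t \<in> {0..T}"
  then show "(\<lambda>\<omega>. N (min t (\<tau> \<omega>)) \<omega>) \<in> borel_measurable (F t)"
    by (intro stopped_value_F[OF N ST_min[OF ST_const \<tau>]]) auto
next
  fix \<omega> assume \<omega>: "\<omega> \<in> space P"
  show "continuous_on {0..T} (\<lambda>t. N (min t (\<tau> \<omega>)) \<omega>)"
    by (rule continuous_on_compose2[OF regular_cont[OF N \<omega>], where f="\<lambda>t. min t (\<tau> \<omega>)"])
      (use ST_range[OF \<tau> \<omega>] in \<open>auto intro!: continuous_intros\<close>)
qed

lemma regular_add: "regular N \<Longrightarrow> regular N' \<Longrightarrow> regular (\<lambda>t \<omega>. N t \<omega> + N' t \<omega>)"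
  by (auto simp: regular_def adapted_def intro!: continuous_intros borel_measurable_add)

lemma regular_diff: "regular N \<Longrightarrow> regular N' \<Longrightarrow> regular (\<lambda>t \<omega>. N t \<omega> - N' t \<omega>)"
  by (auto simp: regular_def adapted_def intro!: continuous_intros borel_measurable_diff)

lemma regular_abs: "regular N \<Longrightarrow> regular (\<lambda>t \<omega>. \<bar>N t \<omega>\<bar>)"
  by (auto simp: regular_def adapted_def intro!: continuous_intros)

lemma regular_comp2:
  assumes "regular N" "regular N'" "continuous_on UNIV (\<lambda>z. f (fst z) (snd z))"
  shows "regular (\<lambda>t \<omega>. f (N t \<omega>) (N' t \<omega>))"
  unfolding regular_def adapted_def
proof (intro conjI ballI)
  fix t assume t: "t \<in> {0..T}"
  have [measurable]: "(\<lambda>z. f (fst z) (snd z)) \<in> borel_measurable (borel :: (real \<times> real) measure)"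
    using assms(3) by (rule borel_measurable_continuous_onI)
  have [measurable]: "N t \<in> borel_measurable (F t)" "N' t \<in> borel_measurable (F t)"
    using assms t by (auto simp: regular_def adapted_def)
  have "(\<lambda>\<omega>. (\<lambda>z. f (fst z) (snd z)) (N t \<omega>, N' t \<omega>)) \<in> borel_measurable (F t)"
    by measurable
  then show "(\<lambda>\<omega>. f (N t \<omega>) (N' t \<omega>)) \<in> borel_measurable (F t)" by simp
next
  fix \<omega> assume \<omega>: "\<omega> \<in> space P"
  have "continuous_on {0..T} (\<lambda>t. (\<lambda>z. f (fst z) (snd z)) (N t \<omega>, N' t \<omega>))"
    by (rule continuous_on_compose2[OF assms(3)])
      (auto intro!: continuous_intros regular_cont[OF assms(1) \<omega>] regular_cont[OF assms(2) \<omega>])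
  then show "continuous_on {0..T} (\<lambda>t. f (N t \<omega>) (N' t \<omega>))" by simp
qed

text \<open>First entry into the open half-line above c; the inserted T is the value for paths that
  never enter. Openness reduces the event of an entry before t to rational times, at the price of
  measurability that uses right-continuity of the filtration.\<close>

definition hitting_time :: "(real \<Rightarrow> 'a \<Rightarrow> real) \<Rightarrow> real \<Rightarrow> 'a \<Rightarrow> real" where
  "hitting_time Y c \<omega> = Inf (insert T {t \<in> {0..T}. c < Y t \<omega>})"

lemma hitting_time_bounds: "0 \<le> hitting_time Y c \<omega>" "hitting_time Y c \<omega> \<le> T"
proof -
  have bdd: "bdd_below (insert T {t \<in> {0..T}. c < Y t \<omega>})"
    using horizon_pos by (intro bdd_belowI[of _ 0]) auto
  show "0 \<le> hitting_time Y c \<omega>" unfolding hitting_time_def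
    using horizon_pos by (intro cInf_greatest) auto
  show "hitting_time Y c \<omega> \<le> T" unfolding hitting_time_def
    by (intro cInf_lower bdd) auto
qed

lemma hitting_time_less_iff:
  assumes "t \<le> T"
  shows "hitting_time Y c \<omega> < t \<longleftrightarrow> (\<exists>s\<in>{0..<t}. c < Y s \<omega>)"
proof -
  have bdd: "bdd_below (insert T {t \<in> {0..T}. c < Y t \<omega>})"
    using horizon_pos by (intro bdd_belowI[of _ 0]) auto
  show ?thesis
    unfolding hitting_time_def using assms
    by (subst cInf_less_iff[OF _ bdd]) auto
qed

lemma hitting_time_ST:
  assumes Y: "regular Y"
  shows "hitting_time Y c \<in> ST"
proof (rule stopping_timesI_less)
  fix t assume t: "0 < t" "t \<le> T"
  \<comment> \<open>By continuity the strict inequality persists slightly to the right of s, where a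
    rational time before t is found.\<close>
  have "(\<exists>s\<in>{0..<t}. c < Y s \<omega>) \<longleftrightarrow> (\<exists>q\<in>\<rat> \<inter> {0..<t}. c < Y q \<omega>)" if \<omega>: "\<omega> \<in> space P" for \<omega>
  proof
    assume "\<exists>s\<in>{0..<t}. c < Y s \<omega>"
    then obtain s where s: "0 \<le> s" "s < t" "c < Y s \<omega>" by auto
    have "continuous (at s within {0..T}) (\<lambda>t. Y t \<omega>)"
      using regular_cont[OF Y \<omega>] s t by (auto simp: continuous_on_eq_continuous_within)
    then have "\<forall>\<^sub>F u in at s within {0..T}. c < Y u \<omega>"
      using s(3) by (intro order_tendstoD(1)) (auto simp: continuous_within)
    then obtain d where d: "d > 0" "\<And>u. u \<in> {0..T} \<Longrightarrow> u \<noteq> s \<Longrightarrow> dist u s < d \<Longrightarrow> c < Y u \<omega>"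
      unfolding eventually_at by auto
    obtain q where q: "q \<in> \<rat>" "s < q" "q < min t (s + d)"
      using Rats_dense_in_real[of s "min t (s + d)"] s d by auto
    then have "c < Y q \<omega>" using s t by (intro d(2)) (auto simp: dist_real_def)
    then show "\<exists>q\<in>\<rat> \<inter> {0..<t}. c < Y q \<omega>" using q s by auto
  qed auto
  then have "{\<omega> \<in> space P. hitting_time Y c \<omega> < t} =
      (\<Union>q\<in>\<rat> \<inter> {0..<t}. {\<omega> \<in> space P. c < Y q \<omega>})"
    unfolding hitting_time_less_iff[OF t(2)] by blast
  also have "\<dots> \<in> sets (F t)"
  proof (rule sets.countable_UN'')
    show "countable (\<rat> \<inter> {0..<t})" using countable_rat by blast
    fix q assume q: "q \<in> \<rat> \<inter> {0..<t}"
    then have [measurable]: "Y q \<in> borel_measurable (F q)" using Y t by (intro regular_adapted) auto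
    have "{\<omega> \<in> space (F q). c < Y q \<omega>} \<in> sets (F q)" by measurable
    then show "{\<omega> \<in> space P. c < Y q \<omega>} \<in> sets (F t)"
      using sets_F_mono[of q t] q by (auto simp: space_F)
  qed
  finally show "{\<omega> \<in> space P. hitting_time Y c \<omega> < t} \<in> sets (F t)" .
qed (use hitting_time_bounds in auto)

text \<open>Strictly before the hitting time this is the definition of the infimum; at the hitting
  time it follows by continuity from the left. The initial condition covers time 0, which has
  nothing to its left.\<close>

lemma le_hitting_time:
  assumes Y: "regular Y" and \<omega>: "\<omega> \<in> space P" and 0: "Y 0 \<omega> \<le> c" and t: "0 \<le> t" "t \<le> hitting_time Y c \<omega>"
  shows "Y t \<omega> \<le> c"
proof -
  have lt: "Y s \<omega> \<le> c" if "0 \<le> s" "s < hitting_time Y c \<omega>" for s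
    using that hitting_time_less_iff[OF hitting_time_bounds(2), of Y c \<omega> Y c] 
    by (metis atLeastLessThan_iff less_irrefl not_le)
  show ?thesis
  proof (cases "t = 0")
    case False
    show ?thesis
    proof (rule ccontr)
      assume "\<not> Y t \<omega> \<le> c"
      then have c: "c < Y t \<omega>" by simp
      have tT: "t \<le> T" using t hitting_time_bounds[of Y c \<omega>] by linarith
      have "continuous (at t within {0..T}) (\<lambda>t. Y t \<omega>)"
        using regular_cont[OF Y \<omega>] t tT by (auto simp: continuous_on_eq_continuous_within)
      then have "\<forall>\<^sub>F u in at t within {0..T}. c < Y u \<omega>"
        using c by (intro order_tendstoD(1)) (auto simp: continuous_within)
      then obtain d where d: "d > 0" "\<And>u. u \<in> {0..T} \<Longrightarrow> u \<noteq> t \<Longrightarrow> dist u t < d \<Longrightarrow> c < Y u \<omega>"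
        unfolding eventually_at by auto
      define u where "u = max 0 (t - d/2)"
      have "c < Y u \<omega>" using False t tT d(1) by (intro d(2)) (auto simp: u_def dist_real_def)
      moreover have "Y u \<omega> \<le> c" using False t d(1) by (intro lt) (auto simp: u_def)
      ultimately show False by simp
    qed
  qed (use 0 in simp)
qed

text \<open>If Y were below c at the hitting time, continuity would keep it there on an interval to
  the right, against the choice of the infimum. The case of the value T is excluded because T may be
  the inserted value.\<close>

lemma hitting_time_ge:
  assumes Y: "regular Y" and \<omega>: "\<omega> \<in> space P" and lt: "hitting_time Y c \<omega> < T"
  shows "c \<le> Y (hitting_time Y c \<omega>) \<omega>"
proof (rule ccontr)
  let ?h = "hitting_time Y c \<omega>"
  assume "\<not> c \<le> Y ?h \<omega>"
  then have c: "Y ?h \<omega> < c" by simp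
  have "continuous (at ?h within {0..T}) (\<lambda>t. Y t \<omega>)"
    using regular_cont[OF Y \<omega>] hitting_time_bounds[of Y c \<omega>] by (auto simp: continuous_on_eq_continuous_within)
  then have "\<forall>\<^sub>F u in at ?h within {0..T}. Y u \<omega> < c"
    using c by (intro order_tendstoD(2)) (auto simp: continuous_within)
  then obtain d where d: "d > 0" "\<And>u. u \<in> {0..T} \<Longrightarrow> u \<noteq> ?h \<Longrightarrow> dist u ?h < d \<Longrightarrow> Y u \<omega> < c"
    unfolding eventually_at by auto
  define t where "t = min T (?h + d)"
  have "?h < t" using d lt by (auto simp: t_def)
  then obtain s where s: "0 \<le> s" "s < t" "c < Y s \<omega>"
    using hitting_time_less_iff[of t Y c \<omega>] by (auto simp: t_def)
  have "\<not> s < ?h"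
    using s(1,3) hitting_time_less_iff[OF hitting_time_bounds(2), of Y c \<omega> Y c]
    by (metis atLeastLessThan_iff less_irrefl)
  moreover have "s \<noteq> ?h" using s c by auto
  ultimately have "Y s \<omega> < c" using s by (intro d(2)) (auto simp: t_def dist_real_def)
  with s show False by simp
qed

text \<open>A continuous path is bounded on the compact interval, so the hitting times of the levels
  k can serve as a localizing sequence.\<close>

lemma hitting_time_eventually:
  assumes Y: "regular Y" and \<omega>: "\<omega> \<in> space P"
  shows "\<forall>\<^sub>F k in sequentially. hitting_time Y (real k) \<omega> = T"
proof -
  have "compact ((\<lambda>t. Y t \<omega>) ` {0..T})"
    by (intro compact_continuous_image regular_cont[OF Y \<omega>]) simp
  then have "bounded ((\<lambda>t. Y t \<omega>) ` {0..T})" by (rule compact_imp_bounded)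
  then obtain C where "\<forall>x\<in>{0..T}. \<bar>Y x \<omega>\<bar> \<le> C" by (auto simp: bounded_iff)
  then have C: "\<And>t. t \<in> {0..T} \<Longrightarrow> \<bar>Y t \<omega>\<bar> \<le> C" by blast
  have "hitting_time Y (real k) \<omega> = T" if "k \<ge> nat \<lceil>C\<rceil>" for k
  proof (rule antisym[OF hitting_time_bounds(2)], rule ccontr)
    assume "\<not> T \<le> hitting_time Y (real k) \<omega>"
    then obtain s where "s \<in> {0..<T}" "real k < Y s \<omega>"
      using hitting_time_less_iff[of T Y "real k" \<omega>] by auto
    moreover have "C \<le> real k" using that by linarith
    ultimately show False using C[of s] by auto
  qed
  then show ?thesis unfolding eventually_sequentially by blast
qed

lemma hitting_time_mono: "c \<le> d \<Longrightarrow> hitting_time Y c \<omega> \<le> hitting_time Y d \<omega>"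
  unfolding hitting_time_def using horizon_pos
  by (intro cInf_superset_mono bdd_belowI[of _ 0]) auto

section \<open>Optional stopping\<close>

lemma integrable_indicator_mult:
  fixes f :: "'a \<Rightarrow> real"
  shows "B \<in> sets P \<Longrightarrow> integrable P f \<Longrightarrow> integrable P (\<lambda>\<omega>. indicator B \<omega> * f \<omega>)"
  using integrable_mult_indicator[of B P f] by simp

lemma integrable_mult_bounded:
  fixes f g :: "'a \<Rightarrow> real"
  assumes "f \<in> borel_measurable P" "\<And>\<omega>. \<omega> \<in> space P \<Longrightarrow> \<bar>f \<omega>\<bar> \<le> C" "integrable P g"
  shows "integrable P (\<lambda>\<omega>. f \<omega> * g \<omega>)"
proof (rule Bochner_Integration.integrable_bound[where f="\<lambda>\<omega>. C * g \<omega>"])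
  show "AE \<omega> in P. norm (f \<omega> * g \<omega>) \<le> norm (C * g \<omega>)"
  proof (rule AE_I2)
    fix \<omega> assume "\<omega> \<in> space P"
    then have "\<bar>f \<omega>\<bar> * \<bar>g \<omega>\<bar> \<le> \<bar>C\<bar> * \<bar>g \<omega>\<bar>"
      using assms(2)[of \<omega>] by (intro mult_right_mono) auto
    then show "norm (f \<omega> * g \<omega>) \<le> norm (C * g \<omega>)" by (simp add: abs_mult)
  qed
qed (use assms in auto)

lemma integrable_bounded:
  fixes f :: "'a \<Rightarrow> real"
  assumes "f \<in> borel_measurable P" "\<And>\<omega>. \<omega> \<in> space P \<Longrightarrow> \<bar>f \<omega>\<bar> \<le> C"
  shows "integrable P f"
  using assms by (intro integrable_const_bound[where B=C]) auto

lemma martingale_set_integral: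
  assumes N: "martingale P F T N" and t: "0 \<le> t" "t \<le> T" and B: "B \<in> sets (F t)"
  shows "(\<integral>\<omega>. indicator B \<omega> * N t \<omega> \<partial>P) = (\<integral>\<omega>. indicator B \<omega> * N T \<omega> \<partial>P)"
proof -
  interpret sub: finite_measure_subalgebra P "F t"
    using subalgebra_F t by unfold_locales auto
  have [measurable]: "B \<in> sets P" using sets_F_subset[OF t(2)] B by auto
  have int: "integrable P (N T)" "integrable P (N t)" using N t horizon_pos by (auto simp: martingale_def)
  have "AE \<omega> in P. real_cond_exp P (F t) (N T) \<omega> = N t \<omega>"
    using N t horizon_pos by (auto simp: martingale_def)
  then have "(\<integral>\<omega>. indicator B \<omega> * N t \<omega> \<partial>P)
      = (\<integral>\<omega>. indicator B \<omega> * real_cond_exp P (F t) (N T) \<omega> \<partial>P)"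
    using int by (intro integral_cong_AE) auto
  also have "\<dots> = (\<integral>\<omega>. indicator B \<omega> * N T \<omega> \<partial>P)"
    using sub.real_cond_exp_intA[OF int(1) B] by (simp add: set_lebesgue_integral_def)
  finally show ?thesis .
qed

text \<open>The integrals split over the finitely many values s of \<tau>. The part of B on which
  \<tau> = s belongs to \<open>F s\<close>, and there the martingale property between s and T
  applies.\<close>

lemma optional_stopping_finite_range:
  assumes N: "martingale P F T N" and \<tau>: "\<tau> \<in> ST" and fin: "finite (\<tau> ` space P)"
  shows "integrable P (\<lambda>\<omega>. N (\<tau> \<omega>) \<omega>)"
    and "\<And>B. B \<in> sets (pre_sigma \<tau>) \<Longrightarrow>
      (\<integral>\<omega>. indicator B \<omega> * N (\<tau> \<omega>) \<omega> \<partial>P) = (\<integral>\<omega>. indicator B \<omega> * N T \<omega> \<partial>P)"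
proof -
  let ?R = "\<tau> ` space P"
  have \<tau>_eq: "{\<omega> \<in> space P. \<tau> \<omega> = s} \<in> sets (F s)" for s
    using stopping_time_eq_const[OF ST_stopping_time[OF \<tau>]] by (simp add: pred_def space_F)
  have R: "0 \<le> s" "s \<le> T" if "s \<in> ?R" for s using that ST_range[OF \<tau>] by auto
  have int: "integrable P (N s)" if "s \<in> ?R" for s
    using N R[OF that] by (auto simp: martingale_def)
  have decomp: "f \<omega> = (\<Sum>s\<in>?R. indicator {\<omega> \<in> space P. \<tau> \<omega> = s} \<omega> * f \<omega>)" if "\<omega> \<in> space P" for f :: "'a \<Rightarrow> real" and \<omega>
  proof -
    have "(\<Sum>s\<in>?R. indicator {\<omega> \<in> space P. \<tau> \<omega> = s} \<omega> * f \<omega>) = (\<Sum>s\<in>?R. if s = \<tau> \<omega> then f \<omega> else 0)"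
      using that by (intro sum.cong) (auto simp: indicator_def)
    also have "\<dots> = f \<omega>" using fin that by simp
    finally show ?thesis by simp
  qed
  have decompN: "N (\<tau> \<omega>) \<omega> = (\<Sum>s\<in>?R. indicator {\<omega> \<in> space P. \<tau> \<omega> = s} \<omega> * N s \<omega>)" if "\<omega> \<in> space P" for \<omega>
  proof -
    have "N (\<tau> \<omega>) \<omega> = (\<Sum>s\<in>?R. indicator {\<omega> \<in> space P. \<tau> \<omega> = s} \<omega> * N (\<tau> \<omega>) \<omega>)"
      by (rule decomp[OF that, of "\<lambda>\<omega>. N (\<tau> \<omega>) \<omega>"])
    also have "\<dots> = (\<Sum>s\<in>?R. indicator {\<omega> \<in> space P. \<tau> \<omega> = s} \<omega> * N s \<omega>)"
      by (intro sum.cong) (auto simp: indicator_def)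
    finally show ?thesis .
  qed
  have sP: "{\<omega> \<in> space P. \<tau> \<omega> = s} \<in> sets P" if "s \<in> ?R" for s
    using \<tau>_eq[of s] sets_F_subset[OF R(2)[OF that]] by auto
  have "integrable P (\<lambda>\<omega>. \<Sum>s\<in>?R. indicator {\<omega> \<in> space P. \<tau> \<omega> = s} \<omega> * N s \<omega>)"
    by (intro Bochner_Integration.integrable_sum integrable_indicator_mult sP int)
  then show "integrable P (\<lambda>\<omega>. N (\<tau> \<omega>) \<omega>)"
    by (subst Bochner_Integration.integrable_cong[OF refl decompN])
  fix B assume B: "B \<in> sets (pre_sigma \<tau>)"
  have BP: "B \<in> sets P" by (rule pre_sigma_sets_subset[OF \<tau> B])
  have Bs: "B \<inter> {\<omega> \<in> space P. \<tau> \<omega> = s} \<in> sets (F s)" for s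
  proof -
    have "{\<omega> \<in> B. \<tau> \<omega> \<le> s} \<inter> {\<omega> \<in> space P. \<tau> \<omega> = s} \<in> sets (F s)"
      using sets_pre_sigmaD[OF ST_stopping_time[OF \<tau>] B, of s] \<tau>_eq[of s] by auto
    moreover have "{\<omega> \<in> B. \<tau> \<omega> \<le> s} \<inter> {\<omega> \<in> space P. \<tau> \<omega> = s} = B \<inter> {\<omega> \<in> space P. \<tau> \<omega> = s}" by auto
    ultimately show ?thesis by simp
  qed
  have "(\<integral>\<omega>. indicator B \<omega> * N (\<tau> \<omega>) \<omega> \<partial>P)
      = (\<integral>\<omega>. (\<Sum>s\<in>?R. indicator (B \<inter> {\<omega> \<in> space P. \<tau> \<omega> = s}) \<omega> * N s \<omega>) \<partial>P)"
    by (intro Bochner_Integration.integral_cong refl)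
      (simp add: decompN sum_distrib_left indicator_inter_arith mult.assoc)
  also have "\<dots> = (\<Sum>s\<in>?R. \<integral>\<omega>. indicator (B \<inter> {\<omega> \<in> space P. \<tau> \<omega> = s}) \<omega> * N s \<omega> \<partial>P)"
    by (intro Bochner_Integration.integral_sum integrable_indicator_mult sets.Int BP sP int)
  also have "\<dots> = (\<Sum>s\<in>?R. \<integral>\<omega>. indicator (B \<inter> {\<omega> \<in> space P. \<tau> \<omega> = s}) \<omega> * N T \<omega> \<partial>P)"
    by (intro sum.cong refl martingale_set_integral[OF N] R Bs)
  also have "\<dots> = (\<integral>\<omega>. (\<Sum>s\<in>?R. indicator (B \<inter> {\<omega> \<in> space P. \<tau> \<omega> = s}) \<omega> * N T \<omega>) \<partial>P)"
    by (intro Bochner_Integration.integral_sum[symmetric] integrable_indicator_mult sets.Int BP sP)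
      (use N horizon_pos in \<open>auto simp: martingale_def\<close>)
  also have "\<dots> = (\<integral>\<omega>. indicator B \<omega> * N T \<omega> \<partial>P)"
  proof (intro Bochner_Integration.integral_cong refl)
    fix \<omega> assume \<omega>: "\<omega> \<in> space P"
    have "(\<Sum>s\<in>?R. indicator (B \<inter> {\<omega> \<in> space P. \<tau> \<omega> = s}) \<omega> * N T \<omega>)
        = (\<Sum>s\<in>?R. indicator {\<omega> \<in> space P. \<tau> \<omega> = s} \<omega> * (indicator B \<omega> * N T \<omega>))"
      by (intro sum.cong) (auto simp: indicator_def)
    also have "\<dots> = indicator B \<omega> * N T \<omega>"
      by (rule decomp[OF \<omega>, of "\<lambda>\<omega>. indicator B \<omega> * N T \<omega>", symmetric])
    finally show "(\<Sum>s\<in>?R. indicator (B \<inter> {\<omega> \<in> space P. \<tau> \<omega> = s}) \<omega> * N T \<omega>) = indicator B \<omega> * N T \<omega>" .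
  qed
  finally show "(\<integral>\<omega>. indicator B \<omega> * N (\<tau> \<omega>) \<omega> \<partial>P) = (\<integral>\<omega>. indicator B \<omega> * N T \<omega> \<partial>P)" .
qed

text \<open>Uniform integrability of the stopped values in a form that survives limits. It is
  conditional Jensen for the function (|v| - K)^+, obtained by testing optional stopping on the
  events where the stopped value is above K or below -K; on these the same affine functions of N T
  lie below its own excess.\<close>

lemma optional_stopping_tail:
  assumes N: "martingale P F T N" "regular N" and \<tau>: "\<tau> \<in> ST" and fin: "finite (\<tau> ` space P)" and K: "0 \<le> K"
  shows "(\<integral>\<omega>. max (\<bar>N (\<tau> \<omega>) \<omega>\<bar> - K) 0 \<partial>P) \<le> (\<integral>\<omega>. max (\<bar>N T \<omega>\<bar> - K) 0 \<partial>P)"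
proof -
  note os = optional_stopping_finite_range[OF N(1) \<tau> fin]
  have m[measurable]: "(\<lambda>\<omega>. N (\<tau> \<omega>) \<omega>) \<in> borel_measurable (pre_sigma \<tau>)"
    by (rule stopped_value_measurable[OF N(2) \<tau>])
  define B1 where "B1 = {\<omega> \<in> space (pre_sigma \<tau>). K < N (\<tau> \<omega>) \<omega>}"
  define B2 where "B2 = {\<omega> \<in> space (pre_sigma \<tau>). N (\<tau> \<omega>) \<omega> < - K}"
  have B: "B1 \<in> sets (pre_sigma \<tau>)" "B2 \<in> sets (pre_sigma \<tau>)" unfolding B1_def B2_def by measurable
  note BP = B[THEN pre_sigma_sets_subset[OF \<tau>]]
  have NT: "integrable P (N T)" using N(1) horizon_pos by (auto simp: martingale_def)
  note int = integrable_indicator_mult[OF BP(1)] integrable_indicator_mult[OF BP(2)]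
  have expand: "(\<integral>\<omega>. indicator B1 \<omega> * (f \<omega> - K) + indicator B2 \<omega> * (- f \<omega> - K) \<partial>P)
      = (\<integral>\<omega>. indicator B1 \<omega> * f \<omega> \<partial>P) - (\<integral>\<omega>. indicator B2 \<omega> * f \<omega> \<partial>P) - K * measure P B1 - K * measure P B2"
    if "integrable P f" for f
  proof -
    have "(\<integral>\<omega>. indicator B1 \<omega> * (f \<omega> - K) + indicator B2 \<omega> * (- f \<omega> - K) \<partial>P)
        = (\<integral>\<omega>. (indicator B1 \<omega> * f \<omega> - indicator B2 \<omega> * f \<omega>) - (indicator B1 \<omega> * K + indicator B2 \<omega> * K) \<partial>P)"
      by (intro Bochner_Integration.integral_cong) (auto simp: algebra_simps)
    also have "\<dots> = (\<integral>\<omega>. indicator B1 \<omega> * f \<omega> \<partial>P) - (\<integral>\<omega>. indicator B2 \<omega> * f \<omega> \<partial>P) - (K * measure P B1 + K * measure P B2)"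
    proof -
      have i: "integrable P (\<lambda>\<omega>. indicator B1 \<omega> * K)" "integrable P (\<lambda>\<omega>. indicator B2 \<omega> * K)"
        by (intro int; simp)+
      have e: "(\<integral>\<omega>. indicator B1 \<omega> * K \<partial>P) = K * measure P B1" "(\<integral>\<omega>. indicator B2 \<omega> * K \<partial>P) = K * measure P B2"
        using BP by simp_all
      show ?thesis
        unfolding e[symmetric] using int[OF that] i
        by (simp only: Bochner_Integration.integral_diff Bochner_Integration.integral_add
            Bochner_Integration.integrable_diff Bochner_Integration.integrable_add)
    qed
    finally show ?thesis by simp
  qed
  have "(\<integral>\<omega>. max (\<bar>N (\<tau> \<omega>) \<omega>\<bar> - K) 0 \<partial>P)
      = (\<integral>\<omega>. indicator B1 \<omega> * (N (\<tau> \<omega>) \<omega> - K) + indicator B2 \<omega> * (- N (\<tau> \<omega>) \<omega> - K) \<partial>P)"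
    using K by (intro Bochner_Integration.integral_cong) (auto simp: B1_def B2_def indicator_def space_pre_sigma)
  also have "\<dots> = (\<integral>\<omega>. indicator B1 \<omega> * N (\<tau> \<omega>) \<omega> \<partial>P) - (\<integral>\<omega>. indicator B2 \<omega> * N (\<tau> \<omega>) \<omega> \<partial>P)
      - K * measure P B1 - K * measure P B2"
    by (rule expand[OF os(1)])
  also have "\<dots> = (\<integral>\<omega>. indicator B1 \<omega> * (N T \<omega> - K) + indicator B2 \<omega> * (- N T \<omega> - K) \<partial>P)"
    unfolding os(2)[OF B(1)] os(2)[OF B(2)] by (rule expand[OF NT, symmetric])
  also have "\<dots> \<le> (\<integral>\<omega>. max (\<bar>N T \<omega>\<bar> - K) 0 \<partial>P)"
  proof (rule integral_mono)
    show "integrable P (\<lambda>\<omega>. indicator B1 \<omega> * (N T \<omega> - K) + indicator B2 \<omega> * (- N T \<omega> - K))"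
      using NT by (intro Bochner_Integration.integrable_add int) auto
    show "integrable P (\<lambda>\<omega>. max (\<bar>N T \<omega>\<bar> - K) 0)" using NT by auto
  qed (use K in \<open>auto simp: B1_def B2_def indicator_def\<close>)
  finally show ?thesis .
qed

text \<open>The time \<tau> is approximated by finite-range roundings. Truncation to [-K, K] permits
  bounded convergence, the truncation error is at most r K at every time involved, and r K vanishes
  as K grows.\<close>

theorem optional_stopping:
  assumes N: "martingale P F T N" "regular N" and \<tau>: "\<tau> \<in> ST"
  shows "integrable P (\<lambda>\<omega>. N (\<tau> \<omega>) \<omega>)" "(\<integral>\<omega>. N (\<tau> \<omega>) \<omega> \<partial>P) = (\<integral>\<omega>. N T \<omega> \<partial>P)"
proof -
  define s where "s n \<omega> = round_up n T (\<tau> \<omega>)" for n \<omega>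
  define r where "r K = (\<integral>\<omega>. max (\<bar>N T \<omega>\<bar> - K) 0 \<partial>P)" for K
  have NT: "integrable P (N T)" using N(1) horizon_pos by (auto simp: martingale_def)
  then have [measurable]: "N T \<in> borel_measurable P" by auto
  have s: "s n \<in> ST" for n
    unfolding s_def using ST_range[OF \<tau>] horizon_pos by (intro ST_round_up[OF \<tau>]) auto
  have fin: "finite (s n ` space P)" for n
    by (rule finite_subset[OF _ round_up_finite[of T n]]) (use ST_range[OF \<tau>] horizon_pos in \<open>auto simp: s_def\<close>)
  have lim: "(\<lambda>n. N (s n \<omega>) \<omega>) \<longlonglongrightarrow> N (\<tau> \<omega>) \<omega>" if "\<omega> \<in> space P" for \<omega>
    unfolding s_def using ST_range[OF \<tau> that] that by (intro regular_round_up_tendsto N) auto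
  note os = optional_stopping_finite_range[OF N(1) s fin]
  have [measurable]: "(\<lambda>\<omega>. N (\<tau> \<omega>) \<omega>) \<in> borel_measurable P" "(\<lambda>\<omega>. N (s n \<omega>) \<omega>) \<in> borel_measurable P" for n
    by (intro stopped_value_measurable_P N \<tau> s)+
  \<comment> \<open>Fatou's lemma transfers the tail bound to \<tau>; the case K = 0 is
    integrability.\<close>
  have tail: "(\<integral>\<^sup>+\<omega>. ennreal (max (\<bar>N (\<tau> \<omega>) \<omega>\<bar> - K) 0) \<partial>P) \<le> ennreal (r K)" if K: "0 \<le> K" for K
  proof -
    have "(\<integral>\<^sup>+\<omega>. ennreal (max (\<bar>N (\<tau> \<omega>) \<omega>\<bar> - K) 0) \<partial>P)
        = (\<integral>\<^sup>+\<omega>. liminf (\<lambda>n. ennreal (max (\<bar>N (s n \<omega>) \<omega>\<bar> - K) 0)) \<partial>P)"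
    proof (intro nn_integral_cong)
      fix \<omega> assume "\<omega> \<in> space P"
      then have "(\<lambda>n. ennreal (max (\<bar>N (s n \<omega>) \<omega>\<bar> - K) 0)) \<longlonglongrightarrow> ennreal (max (\<bar>N (\<tau> \<omega>) \<omega>\<bar> - K) 0)"
        by (intro tendsto_intros lim)
      then show "ennreal (max (\<bar>N (\<tau> \<omega>) \<omega>\<bar> - K) 0) = liminf (\<lambda>n. ennreal (max (\<bar>N (s n \<omega>) \<omega>\<bar> - K) 0))"
        by (intro lim_imp_Liminf[symmetric]) auto
    qed
    also have "\<dots> \<le> liminf (\<lambda>n. \<integral>\<^sup>+\<omega>. ennreal (max (\<bar>N (s n \<omega>) \<omega>\<bar> - K) 0) \<partial>P)"
      by (intro nn_integral_liminf) measurable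
    also have "\<dots> \<le> ennreal (r K)"
    proof (rule Liminf_le)
      have "(\<integral>\<^sup>+\<omega>. ennreal (max (\<bar>N (s n \<omega>) \<omega>\<bar> - K) 0) \<partial>P) \<le> ennreal (r K)" for n
        unfolding r_def using os(1)
        by (subst nn_integral_eq_integral) (auto intro!: ennreal_leI optional_stopping_tail N s fin K)
      then show "\<forall>\<^sub>F n in sequentially. (\<integral>\<^sup>+\<omega>. ennreal (max (\<bar>N (s n \<omega>) \<omega>\<bar> - K) 0) \<partial>P) \<le> ennreal (r K)"
        by simp
    qed simp
    finally show ?thesis .
  qed
  show int: "integrable P (\<lambda>\<omega>. N (\<tau> \<omega>) \<omega>)"
  proof (rule integrableI_bounded)
    have "(\<integral>\<^sup>+\<omega>. ennreal (norm (N (\<tau> \<omega>) \<omega>)) \<partial>P) \<le> ennreal (r 0)"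
      using tail[of 0] by simp
    also have "\<dots> < \<infinity>" by simp
    finally show "(\<integral>\<^sup>+\<omega>. ennreal (norm (N (\<tau> \<omega>) \<omega>)) \<partial>P) < \<infinity>" .
  qed simp
  have r0: "0 \<le> r K" for K by (auto simp: r_def)
  have tail': "(\<integral>\<omega>. max (\<bar>N (\<tau> \<omega>) \<omega>\<bar> - K) 0 \<partial>P) \<le> r K" if K: "0 \<le> K" for K
    using tail[OF K] r0 int by (subst (asm) nn_integral_eq_integral) auto
  \<comment> \<open>One r K accounts for the truncation at \<tau>, the other for the truncation at
    the rounded times.\<close>
  have diff: "\<bar>(\<integral>\<omega>. N (\<tau> \<omega>) \<omega> \<partial>P) - (\<integral>\<omega>. N T \<omega> \<partial>P)\<bar> \<le> 2 * r K" if K: "0 \<le> K" for K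
  proof -
    let ?f = "\<lambda>x. max (- K) (min K (x :: real))"
    have fd: "\<bar>(\<integral>\<omega>. N (t \<omega>) \<omega> \<partial>P) - (\<integral>\<omega>. ?f (N (t \<omega>) \<omega>) \<partial>P)\<bar> \<le> (\<integral>\<omega>. max (\<bar>N (t \<omega>) \<omega>\<bar> - K) 0 \<partial>P)"
      if i: "integrable P (\<lambda>\<omega>. N (t \<omega>) \<omega>)" for t
    proof -
      have "integrable P (\<lambda>\<omega>. ?f (N (t \<omega>) \<omega>))"
        using i K by (intro integrable_bounded[where C=K]) auto
      then have "(\<integral>\<omega>. N (t \<omega>) \<omega> \<partial>P) - (\<integral>\<omega>. ?f (N (t \<omega>) \<omega>) \<partial>P) = (\<integral>\<omega>. N (t \<omega>) \<omega> - ?f (N (t \<omega>) \<omega>) \<partial>P)"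
        using i by simp
      also have "\<bar>\<dots>\<bar> \<le> (\<integral>\<omega>. \<bar>N (t \<omega>) \<omega> - ?f (N (t \<omega>) \<omega>)\<bar> \<partial>P)"
        by (rule integral_abs_bound)
      also have "\<dots> = (\<integral>\<omega>. max (\<bar>N (t \<omega>) \<omega>\<bar> - K) 0 \<partial>P)"
        using K by (intro Bochner_Integration.integral_cong) auto
      finally show ?thesis .
    qed
    have "(\<lambda>n. \<integral>\<omega>. ?f (N (s n \<omega>) \<omega>) \<partial>P) \<longlonglongrightarrow> (\<integral>\<omega>. ?f (N (\<tau> \<omega>) \<omega>) \<partial>P)"
    proof (rule integral_dominated_convergence[where w="\<lambda>_. K"])
      show "AE \<omega> in P. (\<lambda>n. ?f (N (s n \<omega>) \<omega>)) \<longlonglongrightarrow> ?f (N (\<tau> \<omega>) \<omega>)"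
        by (intro AE_I2 tendsto_intros lim)
    qed (use K in auto)
    then have "(\<lambda>n. \<bar>(\<integral>\<omega>. N T \<omega> \<partial>P) - (\<integral>\<omega>. ?f (N (s n \<omega>) \<omega>) \<partial>P)\<bar>)
        \<longlonglongrightarrow> \<bar>(\<integral>\<omega>. N T \<omega> \<partial>P) - (\<integral>\<omega>. ?f (N (\<tau> \<omega>) \<omega>) \<partial>P)\<bar>"
      by (intro tendsto_intros)
    moreover have "\<bar>(\<integral>\<omega>. N T \<omega> \<partial>P) - (\<integral>\<omega>. ?f (N (s n \<omega>) \<omega>) \<partial>P)\<bar> \<le> r K" for n
    proof -
      have "space P \<in> sets (pre_sigma (s n))"
        using sets.top[of "pre_sigma (s n)"] by (simp add: space_pre_sigma)
      from os(2)[OF this] have "(\<integral>\<omega>. N (s n \<omega>) \<omega> \<partial>P) = (\<integral>\<omega>. N T \<omega> \<partial>P)"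
        by (simp cong: Bochner_Integration.integral_cong)
      then show ?thesis
        using fd[OF os(1)[of n]] optional_stopping_tail[OF N s fin K, of n] by (simp add: r_def)
    qed
    ultimately have "\<bar>(\<integral>\<omega>. N T \<omega> \<partial>P) - (\<integral>\<omega>. ?f (N (\<tau> \<omega>) \<omega>) \<partial>P)\<bar> \<le> r K"
      by (intro LIMSEQ_le_const2) auto
    with fd[OF int] tail'[OF K] show ?thesis by linarith
  qed
  have "(\<lambda>n. r (real n)) \<longlonglongrightarrow> (\<integral>\<omega>. 0 \<partial>P)"
    unfolding r_def
  proof (rule integral_dominated_convergence[where w="\<lambda>\<omega>. \<bar>N T \<omega>\<bar>"])
    show "AE \<omega> in P. (\<lambda>n. max (\<bar>N T \<omega>\<bar> - real n) 0) \<longlonglongrightarrow> 0"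
    proof (rule AE_I2, rule tendsto_eventually)
      fix \<omega>
      show "\<forall>\<^sub>F n in sequentially. max (\<bar>N T \<omega>\<bar> - real n) 0 = 0"
        using eventually_ge_at_top[of "nat \<lceil>\<bar>N T \<omega>\<bar>\<rceil>"] by eventually_elim linarith
    qed
  qed (use NT in auto)
  then have "(\<lambda>n. 2 * r (real n)) \<longlonglongrightarrow> 2 * 0" by (intro tendsto_intros) simp
  then have "\<bar>(\<integral>\<omega>. N (\<tau> \<omega>) \<omega> \<partial>P) - (\<integral>\<omega>. N T \<omega> \<partial>P)\<bar> \<le> 2 * 0"
    by (rule LIMSEQ_le_const) (use diff in auto)
  then show "(\<integral>\<omega>. N (\<tau> \<omega>) \<omega> \<partial>P) = (\<integral>\<omega>. N T \<omega> \<partial>P)" by simp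
qed

section \<open>Optional stopping on events and its converse\<close>

lemma split_stopped_integral:
  fixes N :: "real \<Rightarrow> 'a \<Rightarrow> real"
  assumes "integrable P (\<lambda>\<omega>. N (\<sigma> \<omega>) \<omega>)" "integrable P (\<lambda>\<omega>. N (\<tau> \<omega>) \<omega>)" "B \<in> sets P"
  shows "(\<integral>\<omega>. N (if \<omega> \<in> B then \<sigma> \<omega> else \<tau> \<omega>) \<omega> \<partial>P)
    = (\<integral>\<omega>. indicator B \<omega> * N (\<sigma> \<omega>) \<omega> \<partial>P) + (\<integral>\<omega>. N (\<tau> \<omega>) \<omega> \<partial>P) - (\<integral>\<omega>. indicator B \<omega> * N (\<tau> \<omega>) \<omega> \<partial>P)"
proof -
  have "(\<integral>\<omega>. N (if \<omega> \<in> B then \<sigma> \<omega> else \<tau> \<omega>) \<omega> \<partial>P)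
      = (\<integral>\<omega>. indicator B \<omega> * N (\<sigma> \<omega>) \<omega> + N (\<tau> \<omega>) \<omega> - indicator B \<omega> * N (\<tau> \<omega>) \<omega> \<partial>P)"
    by (intro Bochner_Integration.integral_cong) (auto simp: indicator_def)
  also have "\<dots> = (\<integral>\<omega>. indicator B \<omega> * N (\<sigma> \<omega>) \<omega> \<partial>P) + (\<integral>\<omega>. N (\<tau> \<omega>) \<omega> \<partial>P) - (\<integral>\<omega>. indicator B \<omega> * N (\<tau> \<omega>) \<omega> \<partial>P)"
    using assms by (simp add: integrable_indicator_mult)
  finally show ?thesis .
qed

lemma optional_stopping_set:
  assumes N: "martingale P F T N" "regular N" and \<tau>: "\<tau> \<in> ST" and B: "B \<in> sets (pre_sigma \<tau>)"
  shows "(\<integral>\<omega>. indicator B \<omega> * N (\<tau> \<omega>) \<omega> \<partial>P) = (\<integral>\<omega>. indicator B \<omega> * N T \<omega> \<partial>P)"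
proof -
  have "(\<lambda>\<omega>. if \<omega> \<in> B then \<tau> \<omega> else T) \<in> ST"
    using ST_if[OF \<tau> ST_const[of T] _ B] horizon_pos ST_range[OF \<tau>] by auto
  from optional_stopping(2)[OF N this]
  have "(\<integral>\<omega>. N (if \<omega> \<in> B then \<tau> \<omega> else T) \<omega> \<partial>P) = (\<integral>\<omega>. N T \<omega> \<partial>P)" .
  moreover have "integrable P (N T)" using N(1) horizon_pos by (auto simp: martingale_def)
  ultimately show ?thesis
    using split_stopped_integral[of N \<tau> "\<lambda>_. T" B] optional_stopping(1)[OF N \<tau>] pre_sigma_sets_subset[OF \<tau> B]
    by simp
qed

text \<open>Converse of optional stopping: comparing the time that is s on B and t off B with the
  constant time t isolates the integrals over B. In this form the martingale property follows from
  unconditional expectations, which is what the Dynkin formula supplies.\<close>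

lemma martingaleI_stopping_times:
  assumes N: "adapted F T N"
    and int: "\<And>\<sigma>. \<sigma> \<in> ST \<Longrightarrow> integrable P (\<lambda>\<omega>. N (\<sigma> \<omega>) \<omega>)"
    and const: "\<And>\<sigma>. \<sigma> \<in> ST \<Longrightarrow> (\<integral>\<omega>. N (\<sigma> \<omega>) \<omega> \<partial>P) = c"
  shows "martingale P F T N"
  unfolding martingale_def
proof (intro conjI ballI)
  fix s t assume s: "s \<in> {0..T}" and t: "t \<in> {s..T}"
  interpret sub: finite_measure_subalgebra P "F s"
    using subalgebra_F s by unfold_locales auto
  have st: "(\<lambda>_. s) \<in> ST" "(\<lambda>_. t) \<in> ST" using s t by (auto intro: ST_const)
  show "AE \<omega> in P. real_cond_exp P (F s) (N t) \<omega> = N s \<omega>"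
  proof (rule sub.real_cond_exp_charact)
    fix B assume B: "B \<in> sets (F s)"
    then have "B \<in> sets (pre_sigma (\<lambda>_. s))" by (simp add: sets_F_pre_sigma_const)
    then have "(\<lambda>\<omega>. if \<omega> \<in> B then s else t) \<in> ST" using ST_if[OF st] t by auto
    from const[OF this] const[OF st(2)] split_stopped_integral[of N "\<lambda>_. s" "\<lambda>_. t" B, OF int[OF st(1)] int[OF st(2)]]
    have "(\<integral>\<omega>. indicator B \<omega> * N s \<omega> \<partial>P) = (\<integral>\<omega>. indicator B \<omega> * N t \<omega> \<partial>P)"
      using B sets_F_subset[of s] s by auto
    then show "(\<integral>\<omega>\<in>B. N t \<omega> \<partial>P) = (\<integral>\<omega>\<in>B. N s \<omega> \<partial>P)"
      by (simp add: set_lebesgue_integral_def)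
  qed (use int[OF st(1)] int[OF st(2)] N s in \<open>auto simp: adapted_def\<close>)
qed (use N int[OF ST_const] in \<open>auto simp: adapted_def\<close>)

lemma martingale_AE_cong:
  assumes N: "martingale P F T N" and eq: "\<And>t. t \<in> {0..T} \<Longrightarrow> AE \<omega> in P. N t \<omega> = N' t \<omega>"
  shows "martingale P F T N'"
proof -
  have adapted: "adapted F T N'"
    unfolding adapted_def
  proof
    fix t assume t: "t \<in> {0..T}"
    then show "N' t \<in> borel_measurable (F t)"
      using N by (intro measurable_AE_eq[OF _ _ _ eq[OF t]] sets_F_mono)
        (auto simp: space_F martingale_def adapted_def)
  qed
  then have mP: "N' t \<in> borel_measurable P" if "t \<in> {0..T}" for t
    using that adapted by (intro measurable_from_subalg[OF subalgebra_F[OF that]]) (auto simp: adapted_def)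
  have int: "integrable P (N t)" if "t \<in> {0..T}" for t using N that by (auto simp: martingale_def)
  show ?thesis
    unfolding martingale_def
  proof (intro conjI ballI adapted)
    fix t assume t: "t \<in> {0..T}"
    show "integrable P (N' t)"
      using int[OF t] integrable_cong_AE[of "N t" P "N' t"] mP[OF t] eq[OF t] by auto
  next
    fix s t assume s: "s \<in> {0..T}" and t: "t \<in> {s..T}"
    interpret sub: finite_measure_subalgebra P "F s"
      using subalgebra_F s by unfold_locales auto
    have t': "t \<in> {0..T}" using s t by auto
    have "AE \<omega> in P. real_cond_exp P (F s) (N t) \<omega> = real_cond_exp P (F s) (N' t) \<omega>"
      using eq[OF t'] mP[OF t'] int[OF t'] by (intro sub.real_cond_exp_cong) auto
    moreover have "AE \<omega> in P. real_cond_exp P (F s) (N t) \<omega> = N s \<omega>"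
      using N s t by (auto simp: martingale_def)
    ultimately show "AE \<omega> in P. real_cond_exp P (F s) (N' t) \<omega> = N' s \<omega>"
      using eq[OF s] by eventually_elim simp
  qed
qed

text \<open>A local martingale null at 0, expressed by optional stopping: unlike the martingale property of
  the stopped process, this form can be stopped further, and hence is closed under differences.\<close>

definition centered_local :: "(real \<Rightarrow> 'a \<Rightarrow> real) \<Rightarrow> bool" where
  "centered_local N \<longleftrightarrow> (\<exists>\<tau>. localizing_sequence P F T \<tau> \<and>
     (\<forall>n. \<forall>\<sigma>\<in>ST. integrable P (\<lambda>\<omega>. N (min (\<sigma> \<omega>) (\<tau> n \<omega>)) \<omega>) \<and>
       (\<integral>\<omega>. N (min (\<sigma> \<omega>) (\<tau> n \<omega>)) \<omega> \<partial>P) = 0))"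

text \<open>The stopped process is a martingale with regular paths, so by optional stopping its
  expectation is the same at all stopping times; at time 0 it is zero.\<close>

lemma centered_localI:
  assumes N: "continuous_local_martingale P F T N" and N': "regular N'"
    and eq: "AE \<omega> in P. \<forall>t\<in>{0..T}. N t \<omega> = N' t \<omega>" and 0: "AE \<omega> in P. N' 0 \<omega> = 0"
  shows "centered_local N'"
proof -
  from N obtain \<tau> where \<tau>: "localizing_sequence P F T \<tau>"
    and mart: "\<And>n. martingale P F T (\<lambda>t \<omega>. N (min t (\<tau> n \<omega>)) \<omega> - N 0 \<omega>)"
    by (auto simp: continuous_local_martingale_def)
  have ST: "\<tau> n \<in> ST" for n using \<tau> by (auto simp: localizing_sequence_def)
  have "integrable P (\<lambda>\<omega>. N' (min (\<sigma> \<omega>) (\<tau> n \<omega>)) \<omega>) \<and> (\<integral>\<omega>. N' (min (\<sigma> \<omega>) (\<tau> n \<omega>)) \<omega> \<partial>P) = 0"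
    if \<sigma>: "\<sigma> \<in> ST" for n \<sigma>
  proof -
    let ?X = "\<lambda>t \<omega>. N' (min t (\<tau> n \<omega>)) \<omega>"
    have X: "martingale P F T ?X"
    proof (rule martingale_AE_cong[OF mart[of n]])
      fix t assume t: "t \<in> {0..T}"
      show "AE \<omega> in P. N (min t (\<tau> n \<omega>)) \<omega> - N 0 \<omega> = ?X t \<omega>"
        using eq 0 AE_space
      proof eventually_elim
        case (elim \<omega>)
        have "min t (\<tau> n \<omega>) \<in> {0..T}" "0 \<in> {0..T}" using ST_range[OF ST elim(3), of n] t by auto
        then show ?case using elim by auto
      qed
    qed
    note os = optional_stopping[OF X regular_stopped[OF N' ST]]
    have "(\<integral>\<omega>. N' (min (\<sigma> \<omega>) (\<tau> n \<omega>)) \<omega> \<partial>P) = (\<integral>\<omega>. N' (min 0 (\<tau> n \<omega>)) \<omega> \<partial>P)"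
      using os(2)[OF \<sigma>] os(2)[OF ST_const[of 0]] horizon_pos by simp
    also have "\<dots> = (\<integral>\<omega>. 0 \<partial>P)"
    proof (rule integral_cong_AE)
      show "AE \<omega> in P. N' (min 0 (\<tau> n \<omega>)) \<omega> = 0"
        using 0 AE_space by eventually_elim (use ST_range[OF ST, of _ n] in \<open>simp add: min_absorb1\<close>)
      show "(\<lambda>\<omega>. N' (min 0 (\<tau> n \<omega>)) \<omega>) \<in> borel_measurable P"
        using os(1)[OF ST_const[of 0]] horizon_pos by auto
    qed simp
    finally show ?thesis using os(1)[OF \<sigma>] by simp
  qed
  with \<tau> show ?thesis unfolding centered_local_def by blast
qed

lemma localizing_sequence_min:
  assumes "localizing_sequence P F T \<sigma>" "localizing_sequence P F T \<tau>"
  shows "localizing_sequence P F T (\<lambda>n \<omega>. min (\<sigma> n \<omega>) (\<tau> n \<omega>))"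
proof -
  have "AE \<omega> in P. incseq (\<lambda>n. \<sigma> n \<omega>)" "AE \<omega> in P. incseq (\<lambda>n. \<tau> n \<omega>)"
    using assms by (auto simp: localizing_sequence_def)
  then have 1: "AE \<omega> in P. incseq (\<lambda>n. min (\<sigma> n \<omega>) (\<tau> n \<omega>))"
    by eventually_elim (auto simp: incseq_def intro: min.coboundedI1 min.coboundedI2)
  have "AE \<omega> in P. \<forall>\<^sub>F n in sequentially. \<sigma> n \<omega> = T" "AE \<omega> in P. \<forall>\<^sub>F n in sequentially. \<tau> n \<omega> = T"
    using assms by (auto simp: localizing_sequence_def)
  then have 2: "AE \<omega> in P. \<forall>\<^sub>F n in sequentially. min (\<sigma> n \<omega>) (\<tau> n \<omega>) = T"
  proof eventually_elim
    case (elim \<omega>)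
    then show ?case by eventually_elim simp
  qed
  show ?thesis using 1 2 assms by (auto simp: localizing_sequence_def intro: ST_min)
qed

lemma centered_local_diff:
  assumes N: "centered_local N" and N': "centered_local N'"
  shows "centered_local (\<lambda>t \<omega>. N t \<omega> - N' t \<omega>)"
proof -
  from N obtain \<sigma> where \<sigma>: "localizing_sequence P F T \<sigma>"
    and 1: "\<And>n \<rho>. \<rho> \<in> ST \<Longrightarrow> integrable P (\<lambda>\<omega>. N (min (\<rho> \<omega>) (\<sigma> n \<omega>)) \<omega>)"
      "\<And>n \<rho>. \<rho> \<in> ST \<Longrightarrow> (\<integral>\<omega>. N (min (\<rho> \<omega>) (\<sigma> n \<omega>)) \<omega> \<partial>P) = 0"
    by (auto simp: centered_local_def)
  from N' obtain \<tau> where \<tau>: "localizing_sequence P F T \<tau>"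
    and 2: "\<And>n \<rho>. \<rho> \<in> ST \<Longrightarrow> integrable P (\<lambda>\<omega>. N' (min (\<rho> \<omega>) (\<tau> n \<omega>)) \<omega>)"
      "\<And>n \<rho>. \<rho> \<in> ST \<Longrightarrow> (\<integral>\<omega>. N' (min (\<rho> \<omega>) (\<tau> n \<omega>)) \<omega> \<partial>P) = 0"
    by (auto simp: centered_local_def)
  have ST: "\<sigma> n \<in> ST" "\<tau> n \<in> ST" for n using \<sigma> \<tau> by (auto simp: localizing_sequence_def)
  have "integrable P (\<lambda>\<omega>. N (min (\<rho> \<omega>) (min (\<sigma> n \<omega>) (\<tau> n \<omega>))) \<omega> - N' (min (\<rho> \<omega>) (min (\<sigma> n \<omega>) (\<tau> n \<omega>))) \<omega>) \<and>
      (\<integral>\<omega>. N (min (\<rho> \<omega>) (min (\<sigma> n \<omega>) (\<tau> n \<omega>))) \<omega> - N' (min (\<rho> \<omega>) (min (\<sigma> n \<omega>) (\<tau> n \<omega>))) \<omega> \<partial>P) = 0"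
    if \<rho>: "\<rho> \<in> ST" for n \<rho>
  proof -
    \<comment> \<open>The localizing time of the other process is absorbed into the free stopping
      time.\<close>
    have eq: "min (\<rho> \<omega>) (min (\<sigma> n \<omega>) (\<tau> n \<omega>)) = min (min (\<rho> \<omega>) (\<tau> n \<omega>)) (\<sigma> n \<omega>)"
      "min (\<rho> \<omega>) (min (\<sigma> n \<omega>) (\<tau> n \<omega>)) = min (min (\<rho> \<omega>) (\<sigma> n \<omega>)) (\<tau> n \<omega>)" for \<omega>
      by (auto simp: min_def)
    have "integrable P (\<lambda>\<omega>. N (min (\<rho> \<omega>) (min (\<sigma> n \<omega>) (\<tau> n \<omega>))) \<omega>)"
      "(\<integral>\<omega>. N (min (\<rho> \<omega>) (min (\<sigma> n \<omega>) (\<tau> n \<omega>))) \<omega> \<partial>P) = 0"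
      unfolding eq(1) by (intro 1 ST_min \<rho> ST)+
    moreover have "integrable P (\<lambda>\<omega>. N' (min (\<rho> \<omega>) (min (\<sigma> n \<omega>) (\<tau> n \<omega>))) \<omega>)"
      "(\<integral>\<omega>. N' (min (\<rho> \<omega>) (min (\<sigma> n \<omega>) (\<tau> n \<omega>))) \<omega> \<partial>P) = 0"
      unfolding eq(2) by (intro 2 ST_min \<rho> ST)+
    ultimately show ?thesis by simp
  qed
  with localizing_sequence_min[OF \<sigma> \<tau>] show ?thesis unfolding centered_local_def by blast
qed

text \<open>The bound K concerns the product of G with the increment stopped at an arbitrary time.
  This dominates the passage to the limit along the localizing sequence and allows N to have
  unbounded increments where G vanishes.\<close>

lemma centered_local_increment:
  assumes N: "centered_local N" "regular N" and \<sigma>: "\<sigma> \<in> ST" and \<tau>: "\<tau> \<in> ST"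
    and le: "\<And>\<omega>. \<omega> \<in> space P \<Longrightarrow> \<sigma> \<omega> \<le> \<tau> \<omega>"
    and G: "G \<in> borel_measurable (pre_sigma \<sigma>)" "\<And>\<omega>. \<omega> \<in> space P \<Longrightarrow> \<bar>G \<omega>\<bar> \<le> C"
    and K: "\<And>\<omega> t. \<omega> \<in> space P \<Longrightarrow> t \<in> {0..T} \<Longrightarrow> \<bar>G \<omega> * (N (min (\<tau> \<omega>) t) \<omega> - N (min (\<sigma> \<omega>) t) \<omega>)\<bar> \<le> K"
  shows "(\<integral>\<omega>. G \<omega> * (N (\<tau> \<omega>) \<omega> - N (\<sigma> \<omega>) \<omega>) \<partial>P) = 0"
proof -
  from N(1) obtain \<rho> where \<rho>: "localizing_sequence P F T \<rho>"
    and int: "\<And>n \<sigma>. \<sigma> \<in> ST \<Longrightarrow> integrable P (\<lambda>\<omega>. N (min (\<sigma> \<omega>) (\<rho> n \<omega>)) \<omega>)"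
    and zero: "\<And>n \<sigma>. \<sigma> \<in> ST \<Longrightarrow> (\<integral>\<omega>. N (min (\<sigma> \<omega>) (\<rho> n \<omega>)) \<omega> \<partial>P) = 0"
    by (auto simp: centered_local_def)
  have ST: "\<rho> n \<in> ST" for n using \<rho> by (auto simp: localizing_sequence_def)
  interpret sub: finite_measure_subalgebra P "pre_sigma \<sigma>"
    by (rule pre_sigma_finite_measure_subalgebra[OF \<sigma>])
  have GP[measurable]: "G \<in> borel_measurable P"
    by (rule measurable_from_subalg[OF subalgebra_pre_sigma[OF \<sigma>] G(1)])
  define D where "D n \<omega> = N (min (\<tau> \<omega>) (\<rho> n \<omega>)) \<omega> - N (min (\<sigma> \<omega>) (\<rho> n \<omega>)) \<omega>" for n \<omega>
  have D: "integrable P (D n)" for n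
    unfolding D_def by (intro Bochner_Integration.integrable_diff int \<sigma> \<tau>)
  have [measurable]: "(\<lambda>\<omega>. N (\<tau> \<omega>) \<omega>) \<in> borel_measurable P" "(\<lambda>\<omega>. N (\<sigma> \<omega>) \<omega>) \<in> borel_measurable P"
    by (intro stopped_value_measurable_P N \<sigma> \<tau>)+
  have GD: "(\<integral>\<omega>. G \<omega> * D n \<omega> \<partial>P) = 0" for n
  proof -
    have "AE \<omega> in P. real_cond_exp P (pre_sigma \<sigma>) (D n) \<omega> = 0"
    proof (rule sub.real_cond_exp_charact)
      fix B assume B: "B \<in> sets (pre_sigma \<sigma>)"
      have BP: "B \<in> sets P" by (rule pre_sigma_sets_subset[OF \<sigma> B])
      \<comment> \<open>Stopping at \<open>?s\<close> instead of \<tau> changes the value by exactly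
        the negative increment on B, and both expectations vanish.\<close>
      let ?s = "\<lambda>\<omega>. if \<omega> \<in> B then \<sigma> \<omega> else \<tau> \<omega>"
      have "?s \<in> ST" by (rule ST_if[OF \<sigma> \<tau> le B])
      from zero[OF this, of n]
      have "0 = (\<integral>\<omega>. N (if \<omega> \<in> B then min (\<sigma> \<omega>) (\<rho> n \<omega>) else min (\<tau> \<omega>) (\<rho> n \<omega>)) \<omega> \<partial>P)"
        by (simp add: if_distrib[where f="\<lambda>x. min x _"])
      also have "\<dots> = (\<integral>\<omega>. indicator B \<omega> * N (min (\<sigma> \<omega>) (\<rho> n \<omega>)) \<omega> \<partial>P) - (\<integral>\<omega>. indicator B \<omega> * N (min (\<tau> \<omega>) (\<rho> n \<omega>)) \<omega> \<partial>P)"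
        using split_stopped_integral[of N "\<lambda>\<omega>. min (\<sigma> \<omega>) (\<rho> n \<omega>)" "\<lambda>\<omega>. min (\<tau> \<omega>) (\<rho> n \<omega>)", OF int[OF \<sigma>] int[OF \<tau>] BP]
          zero[OF \<tau>] by simp
      also have "\<dots> = - (\<integral>\<omega>. indicator B \<omega> * D n \<omega> \<partial>P)"
        using int[OF \<sigma>] int[OF \<tau>] BP by (simp add: D_def right_diff_distrib integrable_indicator_mult)
      finally show "(\<integral>\<omega>\<in>B. D n \<omega> \<partial>P) = (\<integral>\<omega>\<in>B. 0 \<partial>P)"
        by (simp add: set_lebesgue_integral_def)
    qed (use D in auto)
    then have "(\<integral>\<omega>. G \<omega> * real_cond_exp P (pre_sigma \<sigma>) (D n) \<omega> \<partial>P) = (\<integral>\<omega>. 0 \<partial>P)"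
      using D by (intro integral_cong_AE) auto
    then show ?thesis
      using sub.real_cond_exp_intg(2)[OF integrable_mult_bounded[OF GP G(2) D] G(1)] D by simp
  qed
  have "(\<lambda>n. \<integral>\<omega>. G \<omega> * D n \<omega> \<partial>P) \<longlonglongrightarrow> (\<integral>\<omega>. G \<omega> * (N (\<tau> \<omega>) \<omega> - N (\<sigma> \<omega>) \<omega>) \<partial>P)"
  proof (rule integral_dominated_convergence[where w="\<lambda>_. K"])
    have "AE \<omega> in P. \<forall>\<^sub>F n in sequentially. \<rho> n \<omega> = T"
      using \<rho> by (auto simp: localizing_sequence_def)
    then show "AE \<omega> in P. (\<lambda>n. G \<omega> * D n \<omega>) \<longlonglongrightarrow> G \<omega> * (N (\<tau> \<omega>) \<omega> - N (\<sigma> \<omega>) \<omega>)"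
      using AE_space
    proof eventually_elim
      case (elim \<omega>)
      from elim(1) have "\<forall>\<^sub>F n in sequentially. G \<omega> * D n \<omega> = G \<omega> * (N (\<tau> \<omega>) \<omega> - N (\<sigma> \<omega>) \<omega>)"
        by eventually_elim (use ST_range[OF \<sigma> elim(2)] ST_range[OF \<tau> elim(2)] in \<open>simp add: D_def min_absorb1\<close>)
      then show ?case by (rule tendsto_eventually)
    qed
    show "AE \<omega> in P. norm (G \<omega> * D n \<omega>) \<le> K" for n
      using ST_range[OF ST] by (intro AE_I2) (auto simp: D_def intro!: K)
  qed (use D in \<open>auto intro: borel_measurable_times\<close>)
  from LIMSEQ_unique[OF tendsto_const this[unfolded GD]] show ?thesis by simp
qed

text \<open>The increment of M^2 - A is 2 m x + x^2 - b with m the value of M at \<sigma>, and the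
  cross term has mean zero because m is known at \<sigma>. As m may be unbounded, \<open>H j\<close>
  restricts to |m| \<le> j first; then j tends to infinity, with x^2 - b bounded throughout.\<close>

lemma centered_square_increment:
  assumes M: "centered_local M" "regular M" and A: "centered_local (\<lambda>t \<omega>. (M t \<omega>)\<^sup>2 - A t \<omega>)" "regular A"
    and \<sigma>: "\<sigma> \<in> ST" and \<tau>: "\<tau> \<in> ST" and le: "\<And>\<omega>. \<omega> \<in> space P \<Longrightarrow> \<sigma> \<omega> \<le> \<tau> \<omega>"
    and G: "G \<in> borel_measurable (pre_sigma \<sigma>)" "\<And>\<omega>. \<omega> \<in> space P \<Longrightarrow> \<bar>G \<omega>\<bar> \<le> C"
    and K: "\<And>\<omega> t. \<omega> \<in> space P \<Longrightarrow> t \<in> {0..T} \<Longrightarrow> \<bar>M (min (\<tau> \<omega>) t) \<omega> - M (min (\<sigma> \<omega>) t) \<omega>\<bar> \<le> K"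
      "\<And>\<omega> t. \<omega> \<in> space P \<Longrightarrow> t \<in> {0..T} \<Longrightarrow> \<bar>A (min (\<tau> \<omega>) t) \<omega> - A (min (\<sigma> \<omega>) t) \<omega>\<bar> \<le> K"
  shows "(\<integral>\<omega>. G \<omega> * ((M (\<tau> \<omega>) \<omega> - M (\<sigma> \<omega>) \<omega>)\<^sup>2 - (A (\<tau> \<omega>) \<omega> - A (\<sigma> \<omega>) \<omega>)) \<partial>P) = 0"
proof -
  define m where "m \<omega> = M (\<sigma> \<omega>) \<omega>" for \<omega>
  define x where "x \<omega> = M (\<tau> \<omega>) \<omega> - M (\<sigma> \<omega>) \<omega>" for \<omega>
  define b where "b \<omega> = A (\<tau> \<omega>) \<omega> - A (\<sigma> \<omega>) \<omega>" for \<omega>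
  have mm[measurable]: "m \<in> borel_measurable (pre_sigma \<sigma>)"
    unfolding m_def by (rule stopped_value_measurable[OF M(2) \<sigma>])
  define H where "H j \<omega> = G \<omega> * indicator {\<omega> \<in> space (pre_sigma \<sigma>). \<bar>m \<omega>\<bar> \<le> real j} \<omega>" for j \<omega>
  note [measurable] = G(1)
  have H: "H j \<in> borel_measurable (pre_sigma \<sigma>)" for j unfolding H_def by measurable
  note fromP = measurable_from_subalg[OF subalgebra_pre_sigma[OF \<sigma>]]
  have [measurable]: "H j \<in> borel_measurable P" "m \<in> borel_measurable P" "G \<in> borel_measurable P" for j
    by (intro fromP H mm G(1))+
  have [measurable]: "x \<in> borel_measurable P" "b \<in> borel_measurable P" unfolding x_def b_def
    by (intro borel_measurable_diff stopped_value_measurable_P M A \<sigma> \<tau>)+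
  have C0: "0 \<le> C" and K0: "0 \<le> K"
  proof -
    obtain \<omega> where \<omega>: "\<omega> \<in> space P" using not_empty by auto
    show "0 \<le> C" using G(2)[OF \<omega>] by linarith
    show "0 \<le> K" using K(1)[OF \<omega>, of 0] horizon_pos by auto
  qed
  have HC: "\<bar>H j \<omega>\<bar> \<le> C" if "\<omega> \<in> space P" for j \<omega>
    using G(2)[OF that] C0 by (auto simp: H_def indicator_def)
  have Hm: "\<bar>H j \<omega> * m \<omega>\<bar> \<le> C * real j" if "\<omega> \<in> space P" for j \<omega>
    using G(2)[OF that] C0 by (auto simp: H_def indicator_def abs_mult intro!: mult_mono)
  have xK: "\<bar>x \<omega>\<bar> \<le> K" and bK: "\<bar>b \<omega>\<bar> \<le> K" if "\<omega> \<in> space P" for \<omega>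
    using K[OF that, of T] ST_range[OF \<sigma> that] ST_range[OF \<tau> that] horizon_pos
    by (auto simp: x_def b_def min_absorb1)
  have regQ: "regular (\<lambda>t \<omega>. (M t \<omega>)\<^sup>2 - A t \<omega>)"
    by (rule regular_comp2[OF M(2) A(2)]) (auto intro!: continuous_intros)
  have x2K: "(x \<omega>)\<^sup>2 \<le> K\<^sup>2" if "\<omega> \<in> space P" for \<omega>
    using xK[OF that] K0 by (simp add: abs_le_square_iff[symmetric])
  have Hj: "(\<integral>\<omega>. H j \<omega> * ((x \<omega>)\<^sup>2 - b \<omega>) \<partial>P) = 0" for j
  proof -
    have 1: "(\<integral>\<omega>. (H j \<omega> * m \<omega>) * (M (\<tau> \<omega>) \<omega> - M (\<sigma> \<omega>) \<omega>) \<partial>P) = 0"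
    proof (rule centered_local_increment[OF M \<sigma> \<tau> le _ Hm])
      show "\<bar>(H j \<omega> * m \<omega>) * (M (min (\<tau> \<omega>) t) \<omega> - M (min (\<sigma> \<omega>) t) \<omega>)\<bar> \<le> (C * real j) * K"
        if "\<omega> \<in> space P" "t \<in> {0..T}" for \<omega> t
        unfolding abs_mult[of "H j \<omega> * m \<omega>"]
        by (intro mult_mono Hm K that mult_nonneg_nonneg C0) auto
    qed (use H mm in auto)
    have 2: "(\<integral>\<omega>. H j \<omega> * (((M (\<tau> \<omega>) \<omega>)\<^sup>2 - A (\<tau> \<omega>) \<omega>) - ((M (\<sigma> \<omega>) \<omega>)\<^sup>2 - A (\<sigma> \<omega>) \<omega>)) \<partial>P) = 0"
    proof (rule centered_local_increment[OF A(1) regQ \<sigma> \<tau> le H HC])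
      fix \<omega> t assume \<omega>: "\<omega> \<in> space P" and t: "t \<in> {0..T}"
      let ?x = "M (min (\<tau> \<omega>) t) \<omega> - M (min (\<sigma> \<omega>) t) \<omega>"
      let ?b = "A (min (\<tau> \<omega>) t) \<omega> - A (min (\<sigma> \<omega>) t) \<omega>"
      \<comment> \<open>Up to \<sigma> the stopped increment is zero, and afterwards M stopped at
        \<sigma> equals m; so m may stand for the stopped value in the product, and the difference
        of squares becomes \<open>?x\<close> squared plus twice m times \<open>?x\<close>.\<close>
      have mx: "m \<omega> * ?x = M (min (\<sigma> \<omega>) t) \<omega> * ?x"
        using le[OF \<omega>] by (cases "t \<le> \<sigma> \<omega>") (auto simp: m_def min_absorb2 min_absorb1)
      have "H j \<omega> * (((M (min (\<tau> \<omega>) t) \<omega>)\<^sup>2 - A (min (\<tau> \<omega>) t) \<omega>) - ((M (min (\<sigma> \<omega>) t) \<omega>)\<^sup>2 - A (min (\<sigma> \<omega>) t) \<omega>))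
        = H j \<omega> * (?x\<^sup>2 + 2 * (m \<omega> * ?x) - ?b)"
        unfolding mx by (simp add: power2_eq_square algebra_simps)
      also have "\<dots> = H j \<omega> * ?x\<^sup>2 + 2 * ((H j \<omega> * m \<omega>) * ?x) - H j \<omega> * ?b"
        by (simp add: algebra_simps)
      also have "\<bar>\<dots>\<bar> \<le> C * K\<^sup>2 + 2 * ((C * real j) * K) + C * K"
      proof -
        have tri: "\<bar>u + 2 * v - w\<bar> \<le> u' + 2 * v' + w'" if "\<bar>u\<bar> \<le> u'" "\<bar>v\<bar> \<le> v'" "\<bar>w\<bar> \<le> w'"
          for u v w u' v' w' :: real using that by linarith
        have "?x\<^sup>2 \<le> K\<^sup>2" using K(1)[OF \<omega> t] K0 by (simp add: abs_le_square_iff[symmetric])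
        then have "\<bar>H j \<omega> * ?x\<^sup>2\<bar> \<le> C * K\<^sup>2"
          unfolding abs_mult by (intro mult_mono HC[OF \<omega>] C0) auto
        moreover have "\<bar>(H j \<omega> * m \<omega>) * ?x\<bar> \<le> (C * real j) * K"
          unfolding abs_mult[of "H j \<omega> * m \<omega>"]
          by (intro mult_mono Hm K \<omega> t mult_nonneg_nonneg C0) auto
        moreover have "\<bar>H j \<omega> * ?b\<bar> \<le> C * K"
          unfolding abs_mult by (intro mult_mono HC[OF \<omega>] C0 K \<omega> t) auto
        ultimately show ?thesis by (rule tri)
      qed
      finally show "\<bar>H j \<omega> * (((M (min (\<tau> \<omega>) t) \<omega>)\<^sup>2 - A (min (\<tau> \<omega>) t) \<omega>) - ((M (min (\<sigma> \<omega>) t) \<omega>)\<^sup>2 - A (min (\<sigma> \<omega>) t) \<omega>))\<bar>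
          \<le> C * K\<^sup>2 + 2 * ((C * real j) * K) + C * K" .
    qed
    have i1: "integrable P (\<lambda>\<omega>. (H j \<omega> * m \<omega>) * x \<omega>)"
      by (intro integrable_mult_bounded[OF _ Hm] integrable_bounded[OF _ xK]) measurable
    have i2: "integrable P (\<lambda>\<omega>. H j \<omega> * (x \<omega>)\<^sup>2)"
      by (intro integrable_mult_bounded[OF _ HC] integrable_bounded[where C="K\<^sup>2"]) (auto simp: x2K)
    have i3: "integrable P (\<lambda>\<omega>. H j \<omega> * b \<omega>)"
      by (intro integrable_mult_bounded[OF _ HC] integrable_bounded[OF _ bK]) measurable
    have "0 = (\<integral>\<omega>. H j \<omega> * (x \<omega>)\<^sup>2 + 2 * ((H j \<omega> * m \<omega>) * x \<omega>) - H j \<omega> * b \<omega> \<partial>P)"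
      unfolding 2[symmetric]
      by (intro Bochner_Integration.integral_cong refl) (simp add: x_def b_def m_def power2_eq_square algebra_simps)
    also have "\<dots> = (\<integral>\<omega>. H j \<omega> * (x \<omega>)\<^sup>2 \<partial>P) - (\<integral>\<omega>. H j \<omega> * b \<omega> \<partial>P)"
      using i1 i2 i3 1 by (simp add: x_def)
    also have "\<dots> = (\<integral>\<omega>. H j \<omega> * ((x \<omega>)\<^sup>2 - b \<omega>) \<partial>P)"
      using i2 i3 by (simp add: right_diff_distrib)
    finally show ?thesis by simp
  qed
  have "(\<lambda>j. \<integral>\<omega>. H j \<omega> * ((x \<omega>)\<^sup>2 - b \<omega>) \<partial>P) \<longlonglongrightarrow> (\<integral>\<omega>. G \<omega> * ((x \<omega>)\<^sup>2 - b \<omega>) \<partial>P)"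
  proof (rule integral_dominated_convergence[where w="\<lambda>_. C * (K\<^sup>2 + K)"])
    show "AE \<omega> in P. (\<lambda>j. H j \<omega> * ((x \<omega>)\<^sup>2 - b \<omega>)) \<longlonglongrightarrow> G \<omega> * ((x \<omega>)\<^sup>2 - b \<omega>)"
    proof (rule AE_I2, rule tendsto_eventually)
      fix \<omega> assume \<omega>: "\<omega> \<in> space P"
      show "\<forall>\<^sub>F j in sequentially. H j \<omega> * ((x \<omega>)\<^sup>2 - b \<omega>) = G \<omega> * ((x \<omega>)\<^sup>2 - b \<omega>)"
        by (rule eventually_mono[OF eventually_ge_at_top[of "nat \<lceil>\<bar>m \<omega>\<bar>\<rceil>"]])
          (use \<omega> in \<open>auto simp: H_def space_pre_sigma indicator_def nat_ceiling_le_eq\<close>)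
    qed
    show "AE \<omega> in P. norm (H j \<omega> * ((x \<omega>)\<^sup>2 - b \<omega>)) \<le> C * (K\<^sup>2 + K)" for j
    proof (rule AE_I2)
      fix \<omega> assume \<omega>: "\<omega> \<in> space P"
      have "\<bar>u - v\<bar> \<le> u' + v'" if "0 \<le> u" "u \<le> u'" "\<bar>v\<bar> \<le> v'" for u v u' v' :: real
        using that by linarith
      from this[OF zero_le_power2 x2K[OF \<omega>] bK[OF \<omega>]]
      show "norm (H j \<omega> * ((x \<omega>)\<^sup>2 - b \<omega>)) \<le> C * (K\<^sup>2 + K)"
        unfolding real_norm_def abs_mult by (rule mult_mono[OF HC[OF \<omega>] _ C0 abs_ge_zero])
    qed
  qed auto
  from LIMSEQ_unique[OF tendsto_const this[unfolded Hj]] show ?thesis by (simp add: x_def b_def)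
qed

text \<open>Each time is the first at which the joint displacement of U and V from their values at
  the previous time exceeds \<epsilon>. The bounds are stated for increments stopped at any t
  because the mean-zero lemmas ask for bounds at all intermediate times.\<close>

lemma fine_partition:
  assumes U: "regular U" and V: "regular V" and \<epsilon>: "0 < \<epsilon>" and \<tau>: "\<tau> \<in> ST"
  obtains \<rho> :: "nat \<Rightarrow> 'a \<Rightarrow> real" where "\<rho> 0 = \<tau>" "\<And>n. \<rho> n \<in> ST"
    "\<And>n \<omega>. \<omega> \<in> space P \<Longrightarrow> \<rho> n \<omega> \<le> \<rho> (Suc n) \<omega>"
    "\<And>n \<omega> t. \<omega> \<in> space P \<Longrightarrow> t \<in> {0..T} \<Longrightarrow> \<bar>U (min (\<rho> (Suc n) \<omega>) t) \<omega> - U (min (\<rho> n \<omega>) t) \<omega>\<bar> \<le> \<epsilon>"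
    "\<And>n \<omega> t. \<omega> \<in> space P \<Longrightarrow> t \<in> {0..T} \<Longrightarrow> \<bar>V (min (\<rho> (Suc n) \<omega>) t) \<omega> - V (min (\<rho> n \<omega>) t) \<omega>\<bar> \<le> \<epsilon>"
    "\<And>\<omega>. \<omega> \<in> space P \<Longrightarrow> \<forall>\<^sub>F n in sequentially. \<rho> n \<omega> = T"
proof -
  define Y where "Y \<sigma> t \<omega> = \<bar>U t \<omega> - U (min t (\<sigma> \<omega>)) \<omega>\<bar> + \<bar>V t \<omega> - V (min t (\<sigma> \<omega>)) \<omega>\<bar>" for \<sigma> :: "'a \<Rightarrow> real" and t \<omega>
  define \<rho> where "\<rho> = rec_nat \<tau> (\<lambda>_ \<sigma>. hitting_time (Y \<sigma>) \<epsilon>)"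
  have \<rho>0: "\<rho> 0 = \<tau>" and \<rho>S: "\<rho> (Suc n) = hitting_time (Y (\<rho> n)) \<epsilon>" for n
    by (simp_all add: \<rho>_def)
  have Y: "regular (Y \<sigma>)" if "\<sigma> \<in> ST" for \<sigma>
    unfolding Y_def by (intro regular_add regular_abs regular_diff U V regular_stopped that)
  have ST: "\<rho> n \<in> ST" for n
    by (induction n) (auto simp: \<rho>0 \<rho>S \<tau> intro!: hitting_time_ST Y)
  have Y0: "Y (\<rho> n) t \<omega> = 0" if "t \<le> \<rho> n \<omega>" for n t \<omega> using that by (simp add: Y_def min_absorb1)
  have mono: "\<rho> n \<omega> \<le> \<rho> (Suc n) \<omega>" if \<omega>: "\<omega> \<in> space P" for n \<omega>
  proof (rule ccontr)
    assume "\<not> \<rho> n \<omega> \<le> \<rho> (Suc n) \<omega>"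
    then have "hitting_time (Y (\<rho> n)) \<epsilon> \<omega> < \<rho> n \<omega>" by (simp add: \<rho>S)
    then obtain s where "s < \<rho> n \<omega>" "\<epsilon> < Y (\<rho> n) s \<omega>"
      using hitting_time_less_iff ST_range[OF ST \<omega>] by fastforce
    then show False using Y0[of s n \<omega>] \<epsilon> by simp
  qed
  have Yle: "Y (\<rho> n) s \<omega> \<le> \<epsilon>" if \<omega>: "\<omega> \<in> space P" and s: "0 \<le> s" "s \<le> \<rho> (Suc n) \<omega>" for n s \<omega>
  proof (rule le_hitting_time[OF Y[OF ST] \<omega>])
    show "Y (\<rho> n) 0 \<omega> \<le> \<epsilon>" using Y0[of 0 n \<omega>] ST_range[OF ST \<omega>] \<epsilon> by auto
    show "0 \<le> s" "s \<le> hitting_time (Y (\<rho> n)) \<epsilon> \<omega>" using s by (auto simp: \<rho>S)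
  qed
  have min_eq: "min (min (\<rho> (Suc n) \<omega>) t) (\<rho> n \<omega>) = min (\<rho> n \<omega>) t" if "\<omega> \<in> space P" for n t \<omega>
    using mono[OF that, of n] by (auto simp: min_def)
  have inc: "Y (\<rho> n) (min (\<rho> (Suc n) \<omega>) t) \<omega> \<le> \<epsilon>" if \<omega>: "\<omega> \<in> space P" and "t \<in> {0..T}" for n t \<omega>
    using Yle[OF \<omega>, of "min (\<rho> (Suc n) \<omega>) t" n] ST_range[OF ST \<omega>] that by auto
  \<comment> \<open>Infinitely many steps before T would accumulate at some L. Every step has joint
    displacement at least \<epsilon>, whereas continuity at L forces the displacements to
    zero.\<close>
  have ev: "\<forall>\<^sub>F n in sequentially. \<rho> n \<omega> = T" if \<omega>: "\<omega> \<in> space P" for \<omega>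
  proof (rule ccontr)
    assume nev: "\<not> (\<forall>\<^sub>F n in sequentially. \<rho> n \<omega> = T)"
    have inc': "incseq (\<lambda>n. \<rho> n \<omega>)" using mono[OF \<omega>] by (simp add: incseq_SucI)
    have lt: "\<rho> n \<omega> < T" for n
    proof (rule ccontr)
      assume "\<not> \<rho> n \<omega> < T"
      then have "\<rho> n \<omega> = T" using ST_range[OF ST \<omega>, of n] by simp
      then have "\<rho> k \<omega> = T" if "k \<ge> n" for k
        using incseqD[OF inc' that] ST_range[OF ST \<omega>, of k] by simp
      then show False using nev unfolding eventually_sequentially by blast
    qed
    obtain L where L: "(\<lambda>n. \<rho> n \<omega>) \<longlonglongrightarrow> L"
      using incseq_convergent[OF inc', of T] lt less_imp_le by metis
    have "0 \<le> L" "L \<le> T"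
      using ST_range[OF ST \<omega>] by (auto intro!: LIMSEQ_le_const[OF L] LIMSEQ_le_const2[OF L])
    then have LT: "L \<in> {0..T}" by simp
    have lim: "(\<lambda>n. W (\<rho> n \<omega>) \<omega>) \<longlonglongrightarrow> W L \<omega>" if "regular W" for W
      using ST_range[OF ST \<omega>] by (intro continuous_on_tendsto_compose[OF regular_cont[OF that \<omega>] L LT]) auto
    have "(\<lambda>n. \<bar>U (\<rho> (Suc n) \<omega>) \<omega> - U (\<rho> n \<omega>) \<omega>\<bar> + \<bar>V (\<rho> (Suc n) \<omega>) \<omega> - V (\<rho> n \<omega>) \<omega>\<bar>)
        \<longlonglongrightarrow> \<bar>U L \<omega> - U L \<omega>\<bar> + \<bar>V L \<omega> - V L \<omega>\<bar>"
      by (intro tendsto_intros lim[OF U] lim[OF V] LIMSEQ_Suc[OF lim[OF U]] LIMSEQ_Suc[OF lim[OF V]])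
    moreover have "\<epsilon> \<le> \<bar>U (\<rho> (Suc n) \<omega>) \<omega> - U (\<rho> n \<omega>) \<omega>\<bar> + \<bar>V (\<rho> (Suc n) \<omega>) \<omega> - V (\<rho> n \<omega>) \<omega>\<bar>" for n
    proof -
      have "hitting_time (Y (\<rho> n)) \<epsilon> \<omega> < T" using lt[of "Suc n"] by (simp add: \<rho>S)
      from hitting_time_ge[OF Y[OF ST] \<omega> this] show ?thesis
        using mono[OF \<omega>, of n] by (simp add: Y_def \<rho>S[symmetric] min_absorb2)
    qed
    ultimately have "\<epsilon> \<le> \<bar>U L \<omega> - U L \<omega>\<bar> + \<bar>V L \<omega> - V L \<omega>\<bar>"
      by (intro LIMSEQ_le_const) auto
    then show False using \<epsilon> by simp
  qed
  have "\<bar>U (min (\<rho> (Suc n) \<omega>) t) \<omega> - U (min (\<rho> n \<omega>) t) \<omega>\<bar> \<le> \<epsilon>"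
    "\<bar>V (min (\<rho> (Suc n) \<omega>) t) \<omega> - V (min (\<rho> n \<omega>) t) \<omega>\<bar> \<le> \<epsilon>"
    if "\<omega> \<in> space P" "t \<in> {0..T}" for n t \<omega>
    using inc[OF that, of n] unfolding Y_def min_eq[OF that(1)] by auto
  with \<rho>0 ST mono ev show ?thesis by (intro that[of \<rho>]) auto
qed

section \<open>Partitions and uniqueness of the square characteristic\<close>

text \<open>Cutting the partition at \<sigma> keeps the bounds, since an increment cut at \<sigma>
  and stopped at t is the original increment stopped at the minimum of \<sigma> and t.\<close>

lemma fine_partition_until:
  assumes U: "regular U" and V: "regular V" and \<epsilon>: "0 < \<epsilon>" and \<tau>: "\<tau> \<in> ST" and \<sigma>: "\<sigma> \<in> ST"
    and le: "\<And>\<omega>. \<omega> \<in> space P \<Longrightarrow> \<tau> \<omega> \<le> \<sigma> \<omega>"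
  obtains \<rho> :: "nat \<Rightarrow> 'a \<Rightarrow> real" where "\<And>\<omega>. \<omega> \<in> space P \<Longrightarrow> \<rho> 0 \<omega> = \<tau> \<omega>" "\<And>n. \<rho> n \<in> ST"
    "\<And>n \<omega>. \<omega> \<in> space P \<Longrightarrow> \<rho> n \<omega> \<le> \<rho> (Suc n) \<omega>" "\<And>n \<omega>. \<rho> n \<omega> \<le> \<sigma> \<omega>"
    "\<And>n \<omega> t. \<omega> \<in> space P \<Longrightarrow> t \<in> {0..T} \<Longrightarrow> \<bar>U (min (\<rho> (Suc n) \<omega>) t) \<omega> - U (min (\<rho> n \<omega>) t) \<omega>\<bar> \<le> \<epsilon>"
    "\<And>n \<omega> t. \<omega> \<in> space P \<Longrightarrow> t \<in> {0..T} \<Longrightarrow> \<bar>V (min (\<rho> (Suc n) \<omega>) t) \<omega> - V (min (\<rho> n \<omega>) t) \<omega>\<bar> \<le> \<epsilon>"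
    "\<And>n \<omega>. \<omega> \<in> space P \<Longrightarrow> \<bar>U (\<rho> (Suc n) \<omega>) \<omega> - U (\<rho> n \<omega>) \<omega>\<bar> \<le> \<epsilon>"
    "\<And>n \<omega>. \<omega> \<in> space P \<Longrightarrow> \<bar>V (\<rho> (Suc n) \<omega>) \<omega> - V (\<rho> n \<omega>) \<omega>\<bar> \<le> \<epsilon>"
    "\<And>\<omega>. \<omega> \<in> space P \<Longrightarrow> \<forall>\<^sub>F n in sequentially. \<rho> n \<omega> = \<sigma> \<omega>"
proof -
  obtain \<rho> :: "nat \<Rightarrow> 'a \<Rightarrow> real" where \<rho>: "\<rho> 0 = \<tau>" "\<And>n. \<rho> n \<in> ST"
    "\<And>n \<omega>. \<omega> \<in> space P \<Longrightarrow> \<rho> n \<omega> \<le> \<rho> (Suc n) \<omega>"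
    "\<And>n \<omega> t. \<omega> \<in> space P \<Longrightarrow> t \<in> {0..T} \<Longrightarrow> \<bar>U (min (\<rho> (Suc n) \<omega>) t) \<omega> - U (min (\<rho> n \<omega>) t) \<omega>\<bar> \<le> \<epsilon>"
    "\<And>n \<omega> t. \<omega> \<in> space P \<Longrightarrow> t \<in> {0..T} \<Longrightarrow> \<bar>V (min (\<rho> (Suc n) \<omega>) t) \<omega> - V (min (\<rho> n \<omega>) t) \<omega>\<bar> \<le> \<epsilon>"
    "\<And>\<omega>. \<omega> \<in> space P \<Longrightarrow> \<forall>\<^sub>F n in sequentially. \<rho> n \<omega> = T"
    by (rule fine_partition[OF U V \<epsilon> \<tau>]) (rule that; assumption)
  let ?s = "\<lambda>n \<omega>. min (\<rho> n \<omega>) (\<sigma> \<omega>)"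
  have inc: "\<bar>U (min (?s (Suc n) \<omega>) t) \<omega> - U (min (?s n \<omega>) t) \<omega>\<bar> \<le> \<epsilon>"
    "\<bar>V (min (?s (Suc n) \<omega>) t) \<omega> - V (min (?s n \<omega>) t) \<omega>\<bar> \<le> \<epsilon>"
    if \<omega>: "\<omega> \<in> space P" and t: "t \<in> {0..T}" for n \<omega> t
    using \<rho>(4,5)[OF \<omega>, of "min (\<sigma> \<omega>) t" n] ST_range[OF \<sigma> \<omega>] t by (auto simp: min.assoc)
  have T: "min (?s n \<omega>) T = ?s n \<omega>" if "\<omega> \<in> space P" for n \<omega>
    using ST_range[OF \<sigma> that] by (auto simp: min_def)
  show ?thesis
  proof (rule that[of ?s])
    show "\<And>\<omega>. \<omega> \<in> space P \<Longrightarrow> ?s 0 \<omega> = \<tau> \<omega>" using le by (simp add: \<rho>(1) min_absorb1)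
    show "\<And>n. ?s n \<in> ST" by (intro ST_min \<rho> \<sigma>)
    show "\<And>n \<omega>. \<omega> \<in> space P \<Longrightarrow> ?s n \<omega> \<le> ?s (Suc n) \<omega>" using \<rho>(3) by (auto intro: min.coboundedI1)
    show "\<bar>U (?s (Suc n) \<omega>) \<omega> - U (?s n \<omega>) \<omega>\<bar> \<le> \<epsilon>" "\<bar>V (?s (Suc n) \<omega>) \<omega> - V (?s n \<omega>) \<omega>\<bar> \<le> \<epsilon>"
      if "\<omega> \<in> space P" for n \<omega>
      using inc[OF that, of T n] horizon_pos unfolding T[OF that] by auto
    show "\<forall>\<^sub>F n in sequentially. ?s n \<omega> = \<sigma> \<omega>" if "\<omega> \<in> space P" for \<omega>
      using \<rho>(6)[OF that] by eventually_elim (use ST_range[OF \<sigma> that] in simp)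
  qed (use inc in auto)
qed

text \<open>A continuous local martingale that is a difference of increasing processes vanishes.
  Along a partition the increments of V are orthogonal, so E[V^2] is the sum of the expected squared
  increments; each of these is at most \<epsilon> times the expected increment of A + A', which the
  hitting times \<open>h k\<close> keep bounded.\<close>

lemma finite_variation_centered_local_zero:
  assumes A: "regular A" "\<And>\<omega>. \<omega> \<in> space P \<Longrightarrow> mono_on {0..T} (\<lambda>t. A t \<omega>)" "\<And>\<omega>. \<omega> \<in> space P \<Longrightarrow> A 0 \<omega> = 0"
    and A': "regular A'" "\<And>\<omega>. \<omega> \<in> space P \<Longrightarrow> mono_on {0..T} (\<lambda>t. A' t \<omega>)" "\<And>\<omega>. \<omega> \<in> space P \<Longrightarrow> A' 0 \<omega> = 0"
    and cl: "centered_local (\<lambda>t \<omega>. A t \<omega> - A' t \<omega>)"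
  shows "AE \<omega> in P. \<forall>t\<in>{0..T}. A t \<omega> = A' t \<omega>"
proof -
  define V where "V t \<omega> = A t \<omega> - A' t \<omega>" for t \<omega>
  define h where "h k = hitting_time (\<lambda>t \<omega>. A t \<omega> + A' t \<omega>) (real k)" for k
  have regV: "regular V" unfolding V_def by (intro regular_diff A A')
  have regS: "regular (\<lambda>t \<omega>. A t \<omega> + A' t \<omega>)" by (intro regular_add A A')
  have h: "h k \<in> ST" for k unfolding h_def by (rule hitting_time_ST[OF regS])
  have nonneg: "0 \<le> A t \<omega>" "0 \<le> A' t \<omega>" if "\<omega> \<in> space P" "t \<in> {0..T}" for t \<omega>
    using mono_onD[OF A(2)[OF that(1)], of 0 t] mono_onD[OF A'(2)[OF that(1)], of 0 t] A(3) A'(3) that by auto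
  have zero: "AE \<omega> in P. V (min t (h k \<omega>)) \<omega> = 0" if t: "t \<in> {0..T}" for t k
  proof -
    define \<sigma> where "\<sigma> \<omega> = min t (h k \<omega>)" for \<omega>
    have \<sigma>: "\<sigma> \<in> ST" unfolding \<sigma>_def using t by (intro ST_min ST_const h) auto
    have bound: "A s \<omega> + A' s \<omega> \<le> real k" if "\<omega> \<in> space P" "0 \<le> s" "s \<le> \<sigma> \<omega>" for s \<omega>
    proof (rule le_hitting_time[OF regS that(1) _ that(2)])
      show "A 0 \<omega> + A' 0 \<omega> \<le> real k" using A(3) A'(3) that(1) by simp
      show "s \<le> hitting_time (\<lambda>t \<omega>. A t \<omega> + A' t \<omega>) (real k) \<omega>" using that(3) by (simp add: \<sigma>_def h_def)
    qed
    have Vb: "\<bar>V s \<omega>\<bar> \<le> real k" if "\<omega> \<in> space P" "0 \<le> s" "s \<le> \<sigma> \<omega>" for s \<omega>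
      using bound[OF that] nonneg[OF that(1), of s] that(2,3) ST_range[OF \<sigma> that(1)] unfolding V_def by auto
    have [measurable]: "(\<lambda>\<omega>. V (\<sigma> \<omega>) \<omega>) \<in> borel_measurable P" by (rule stopped_value_measurable_P[OF regV \<sigma>])
    have V2b: "(V s \<omega>)\<^sup>2 \<le> (real k)\<^sup>2" if "\<omega> \<in> space P" "0 \<le> s" "s \<le> \<sigma> \<omega>" for s \<omega>
      using Vb[OF that] by (simp add: abs_le_square_iff[symmetric])
    have int\<sigma>: "integrable P (\<lambda>\<omega>. (V (\<sigma> \<omega>) \<omega>)\<^sup>2)"
      using ST_range[OF \<sigma>] by (intro integrable_bounded[where C="(real k)\<^sup>2"]) (auto intro!: V2b)
    have small: "(\<integral>\<omega>. (V (\<sigma> \<omega>) \<omega>)\<^sup>2 \<partial>P) \<le> \<epsilon> * real k" if \<epsilon>: "0 < \<epsilon>" for \<epsilon>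
    proof -
      have st0: "(\<lambda>_. 0) \<in> ST" using horizon_pos by (intro ST_const) auto
      have le0: "0 \<le> \<sigma> \<omega>" if "\<omega> \<in> space P" for \<omega> using ST_range[OF \<sigma> that] by simp
      obtain \<rho> :: "nat \<Rightarrow> 'a \<Rightarrow> real" where \<rho>0: "\<And>\<omega>. \<omega> \<in> space P \<Longrightarrow> \<rho> 0 \<omega> = 0" and \<rho>: "\<And>n. \<rho> n \<in> ST"
        and mono: "\<And>n \<omega>. \<omega> \<in> space P \<Longrightarrow> \<rho> n \<omega> \<le> \<rho> (Suc n) \<omega>" and le: "\<And>n \<omega>. \<rho> n \<omega> \<le> \<sigma> \<omega>"
        and "\<And>n \<omega> t. \<omega> \<in> space P \<Longrightarrow> t \<in> {0..T} \<Longrightarrow> \<bar>A (min (\<rho> (Suc n) \<omega>) t) \<omega> - A (min (\<rho> n \<omega>) t) \<omega>\<bar> \<le> \<epsilon>"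
        and "\<And>n \<omega> t. \<omega> \<in> space P \<Longrightarrow> t \<in> {0..T} \<Longrightarrow> \<bar>A' (min (\<rho> (Suc n) \<omega>) t) \<omega> - A' (min (\<rho> n \<omega>) t) \<omega>\<bar> \<le> \<epsilon>"
        and inc: "\<And>n \<omega>. \<omega> \<in> space P \<Longrightarrow> \<bar>A (\<rho> (Suc n) \<omega>) \<omega> - A (\<rho> n \<omega>) \<omega>\<bar> \<le> \<epsilon>"
          "\<And>n \<omega>. \<omega> \<in> space P \<Longrightarrow> \<bar>A' (\<rho> (Suc n) \<omega>) \<omega> - A' (\<rho> n \<omega>) \<omega>\<bar> \<le> \<epsilon>"
        and ev: "\<And>\<omega>. \<omega> \<in> space P \<Longrightarrow> \<forall>\<^sub>F n in sequentially. \<rho> n \<omega> = \<sigma> \<omega>"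
        by (rule fine_partition_until[OF A(1) A'(1) \<epsilon> st0 \<sigma> le0]) (assumption | rule that; assumption)+
      have [measurable]: "(\<lambda>\<omega>. V (\<rho> n \<omega>) \<omega>) \<in> borel_measurable P" "(\<lambda>\<omega>. A (\<rho> n \<omega>) \<omega>) \<in> borel_measurable P"
        "(\<lambda>\<omega>. A' (\<rho> n \<omega>) \<omega>) \<in> borel_measurable P" for n
        by (intro stopped_value_measurable_P regV \<rho> A A')+
      have range: "0 \<le> \<rho> n \<omega>" "\<rho> n \<omega> \<le> \<sigma> \<omega>" "\<rho> n \<omega> \<le> T" if "\<omega> \<in> space P" for n \<omega>
        using ST_range[OF \<rho> that, of n] le[of n \<omega>] by auto
      have intV: "integrable P (\<lambda>\<omega>. (V (\<rho> n \<omega>) \<omega>)\<^sup>2)" for n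
        using range by (intro integrable_bounded[where C="(real k)\<^sup>2"]) (auto intro!: V2b)
      have intS: "integrable P (\<lambda>\<omega>. A (\<rho> n \<omega>) \<omega> + A' (\<rho> n \<omega>) \<omega>)" for n
        using range nonneg by (intro integrable_bounded[where C="real k"]) (auto intro!: bound)
      have step: "(\<integral>\<omega>. (V (\<rho> n \<omega>) \<omega>)\<^sup>2 \<partial>P) \<le> \<epsilon> * (\<integral>\<omega>. A (\<rho> n \<omega>) \<omega> + A' (\<rho> n \<omega>) \<omega> \<partial>P)" for n
      proof (induction n)
        case 0
        have "(\<integral>\<omega>. (V (\<rho> 0 \<omega>) \<omega>)\<^sup>2 \<partial>P) = 0" "(\<integral>\<omega>. A (\<rho> 0 \<omega>) \<omega> + A' (\<rho> 0 \<omega>) \<omega> \<partial>P) = 0"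
          by (simp_all add: \<rho>0 V_def A(3) A'(3) cong: Bochner_Integration.integral_cong)
        then show ?case by simp
      next
        case (Suc n)
        let ?D = "\<lambda>\<omega>. V (\<rho> (Suc n) \<omega>) \<omega> - V (\<rho> n \<omega>) \<omega>"
        let ?S = "\<lambda>n \<omega>. A (\<rho> n \<omega>) \<omega> + A' (\<rho> n \<omega>) \<omega>"
        have Vk: "\<bar>V (\<rho> n \<omega>) \<omega>\<bar> \<le> real k" if "\<omega> \<in> space P" for n \<omega>
          using Vb[OF that, of "\<rho> n \<omega>"] range[OF that, of n] by simp
        have 0: "(\<integral>\<omega>. V (\<rho> n \<omega>) \<omega> * ?D \<omega> \<partial>P) = 0"
        proof (rule centered_local_increment[OF cl[folded V_def] regV \<rho> \<rho> mono stopped_value_measurable[OF regV \<rho>] Vk])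
          fix \<omega> s assume \<omega>: "\<omega> \<in> space P" and s: "s \<in> {0..T}"
          have "\<bar>V (min (\<rho> m \<omega>) s) \<omega>\<bar> \<le> real k" for m
            using range[OF \<omega>, of m] s by (intro Vb[OF \<omega>]) (auto simp: min_le_iff_disj)
          from this[of n] this[of "Suc n"]
          have "\<bar>V (min (\<rho> (Suc n) \<omega>) s) \<omega> - V (min (\<rho> n \<omega>) s) \<omega>\<bar> \<le> 2 * real k" by linarith
          then show "\<bar>V (\<rho> n \<omega>) \<omega> * (V (min (\<rho> (Suc n) \<omega>) s) \<omega> - V (min (\<rho> n \<omega>) s) \<omega>)\<bar> \<le> real k * (2 * real k)"
            unfolding abs_mult by (intro mult_mono Vk[OF \<omega>]) auto
        qed auto
        have intD: "integrable P (\<lambda>\<omega>. (?D \<omega>)\<^sup>2)"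
        proof (rule integrable_bounded[where C="(2 * real k)\<^sup>2"])
          fix \<omega> assume \<omega>: "\<omega> \<in> space P"
          have "\<bar>?D \<omega>\<bar> \<le> 2 * real k" using Vk[OF \<omega>, of n] Vk[OF \<omega>, of "Suc n"] by linarith
          then show "\<bar>(?D \<omega>)\<^sup>2\<bar> \<le> (2 * real k)\<^sup>2" using abs_le_square_iff[of "?D \<omega>" "2 * real k"] by simp
        qed simp
        have intVD: "integrable P (\<lambda>\<omega>. V (\<rho> n \<omega>) \<omega> * ?D \<omega>)"
          by (intro integrable_mult_bounded[OF _ Vk] Bochner_Integration.integrable_diff integrable_bounded[OF _ Vk]) auto
        \<comment> \<open>One factor of the square is bounded by \<epsilon>, being a difference of
          two numbers between 0 and \<epsilon>; the other is bounded by the increment of A + A',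
          which telescopes.\<close>
        have D: "(?D \<omega>)\<^sup>2 \<le> \<epsilon> * (?S (Suc n) \<omega> - ?S n \<omega>)" if \<omega>: "\<omega> \<in> space P" for \<omega>
        proof -
          have "A (\<rho> n \<omega>) \<omega> \<le> A (\<rho> (Suc n) \<omega>) \<omega>" "A' (\<rho> n \<omega>) \<omega> \<le> A' (\<rho> (Suc n) \<omega>) \<omega>"
            using range[OF \<omega>] mono[OF \<omega>]
            by (auto intro!: mono_onD[OF A(2)[OF \<omega>]] mono_onD[OF A'(2)[OF \<omega>]])
          then have "\<bar>?D \<omega>\<bar> \<le> \<epsilon>" "\<bar>?D \<omega>\<bar> \<le> ?S (Suc n) \<omega> - ?S n \<omega>"
            using inc[OF \<omega>, of n] by (auto simp: V_def)
          then have "\<bar>?D \<omega>\<bar> * \<bar>?D \<omega>\<bar> \<le> \<epsilon> * (?S (Suc n) \<omega> - ?S n \<omega>)" using \<epsilon> by (intro mult_mono) auto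
          then show ?thesis by (simp add: power2_eq_square)
        qed
        have "(\<integral>\<omega>. (V (\<rho> (Suc n) \<omega>) \<omega>)\<^sup>2 \<partial>P)
            = (\<integral>\<omega>. (V (\<rho> n \<omega>) \<omega>)\<^sup>2 + (?D \<omega>)\<^sup>2 + 2 * (V (\<rho> n \<omega>) \<omega> * ?D \<omega>) \<partial>P)"
          by (intro Bochner_Integration.integral_cong refl) (simp add: power2_eq_square algebra_simps)
        also have "\<dots> = (\<integral>\<omega>. (V (\<rho> n \<omega>) \<omega>)\<^sup>2 \<partial>P) + (\<integral>\<omega>. (?D \<omega>)\<^sup>2 \<partial>P)"
          using intV[of n] intD intVD 0 by simp
        also have "\<dots> \<le> \<epsilon> * (\<integral>\<omega>. ?S n \<omega> \<partial>P) + (\<integral>\<omega>. \<epsilon> * (?S (Suc n) \<omega> - ?S n \<omega>) \<partial>P)"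
          using D intD intS
          by (intro add_mono Suc.IH integral_mono Bochner_Integration.integrable_mult_right Bochner_Integration.integrable_diff) auto
        also have "(\<integral>\<omega>. \<epsilon> * (?S (Suc n) \<omega> - ?S n \<omega>) \<partial>P) = \<epsilon> * ((\<integral>\<omega>. ?S (Suc n) \<omega> \<partial>P) - (\<integral>\<omega>. ?S n \<omega> \<partial>P))"
          by (simp only: integral_mult_right_zero Bochner_Integration.integral_diff[OF intS intS])
        finally show ?case by (simp add: algebra_simps)
      qed
      have "(\<lambda>n. \<integral>\<omega>. (V (\<rho> n \<omega>) \<omega>)\<^sup>2 \<partial>P) \<longlonglongrightarrow> (\<integral>\<omega>. (V (\<sigma> \<omega>) \<omega>)\<^sup>2 \<partial>P)"
      proof (rule integral_dominated_convergence[where w="\<lambda>_. (real k)\<^sup>2"])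
        show "AE \<omega> in P. (\<lambda>n. (V (\<rho> n \<omega>) \<omega>)\<^sup>2) \<longlonglongrightarrow> (V (\<sigma> \<omega>) \<omega>)\<^sup>2"
        proof (rule AE_I2, rule tendsto_eventually)
          fix \<omega> assume "\<omega> \<in> space P"
          from ev[OF this] show "\<forall>\<^sub>F n in sequentially. (V (\<rho> n \<omega>) \<omega>)\<^sup>2 = (V (\<sigma> \<omega>) \<omega>)\<^sup>2"
            by eventually_elim simp
        qed
        show "AE \<omega> in P. norm ((V (\<rho> n \<omega>) \<omega>)\<^sup>2) \<le> (real k)\<^sup>2" for n
          using range by (intro AE_I2) (auto intro!: V2b)
      qed auto
      moreover have "(\<integral>\<omega>. (V (\<rho> n \<omega>) \<omega>)\<^sup>2 \<partial>P) \<le> \<epsilon> * real k" for n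
      proof -
        have "(\<integral>\<omega>. A (\<rho> n \<omega>) \<omega> + A' (\<rho> n \<omega>) \<omega> \<partial>P) \<le> (\<integral>\<omega>. real k \<partial>P)"
          using range by (intro integral_mono intS) (auto intro!: bound)
        then have "(\<integral>\<omega>. A (\<rho> n \<omega>) \<omega> + A' (\<rho> n \<omega>) \<omega> \<partial>P) \<le> real k" by (simp add: prob_space)
        with step[of n] \<epsilon> show ?thesis by (smt (verit) mult_left_mono)
      qed
      ultimately show ?thesis by (intro LIMSEQ_le_const2) auto
    qed
    have "(\<integral>\<omega>. (V (\<sigma> \<omega>) \<omega>)\<^sup>2 \<partial>P) \<le> 0"
    proof (rule field_le_epsilon)
      fix e :: real assume e: "0 < e"
      \<comment> \<open>Division by k + 1 in place of k covers the level k = 0.\<close>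
      have "(\<integral>\<omega>. (V (\<sigma> \<omega>) \<omega>)\<^sup>2 \<partial>P) \<le> e / (real k + 1) * real k" using e by (intro small) auto
      also have "\<dots> \<le> 0 + e" using e by (simp add: field_simps)
      finally show "(\<integral>\<omega>. (V (\<sigma> \<omega>) \<omega>)\<^sup>2 \<partial>P) \<le> 0 + e" .
    qed
    moreover have "0 \<le> (\<integral>\<omega>. (V (\<sigma> \<omega>) \<omega>)\<^sup>2 \<partial>P)" by simp
    ultimately have "AE \<omega> in P. (V (\<sigma> \<omega>) \<omega>)\<^sup>2 = 0"
      using integral_nonneg_eq_0_iff_AE[OF int\<sigma>] by simp
    then show ?thesis by (simp add: \<sigma>_def)
  qed
  \<comment> \<open>T is added by hand: it may be irrational, and the density argument below
    approximates from the right and so reaches only t < T.\<close>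
  have "AE \<omega> in P. \<forall>q\<in>insert T (\<rat> \<inter> {0..T}). \<forall>k. V (min q (h k \<omega>)) \<omega> = 0"
    using countable_rat horizon_pos by (subst AE_ball_countable) (auto simp: AE_all_countable intro!: zero)
  then show ?thesis using AE_space
  proof eventually_elim
    case (elim \<omega>)
    have Vq: "V q \<omega> = 0" if "q \<in> insert T (\<rat> \<inter> {0..T})" for q
    proof -
      have "q \<le> T" using that by auto
      have "\<forall>\<^sub>F k in sequentially. h k \<omega> = T"
        unfolding h_def by (rule hitting_time_eventually[OF regS elim(2)])
      then obtain k where "h k \<omega> = T" by (auto simp: eventually_sequentially)
      with elim(1) that \<open>q \<le> T\<close> show ?thesis by (metis min_absorb1)
    qed
    have "V t \<omega> = 0" if t: "t \<in> {0..<T}" for t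
    proof (rule ccontr)
      assume "V t \<omega> \<noteq> 0"
      have "continuous (at t within {0..T}) (\<lambda>t. V t \<omega>)"
        using regular_cont[OF regV elim(2)] t by (auto simp: continuous_on_eq_continuous_within)
      then have "\<forall>\<^sub>F u in at t within {0..T}. V u \<omega> \<noteq> 0"
        using \<open>V t \<omega> \<noteq> 0\<close> by (intro tendsto_imp_eventually_ne) (auto simp: continuous_within)
      then obtain d where d: "d > 0" "\<And>u. u \<in> {0..T} \<Longrightarrow> u \<noteq> t \<Longrightarrow> dist u t < d \<Longrightarrow> V u \<omega> \<noteq> 0"
        unfolding eventually_at by auto
      obtain q where "q \<in> \<rat>" "t < q" "q < min T (t + d)"
        using Rats_dense_in_real[of t "min T (t + d)"] t d by auto
      then show False using Vq[of q] d(2)[of q] t by (auto simp: dist_real_def)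
    qed
    moreover have "V T \<omega> = 0" by (rule Vq) simp
    ultimately show ?case
      by (metis V_def atLeastAtMost_iff atLeastLessThan_iff eq_iff_diff_eq_0 order_le_less)
  qed
qed

text \<open>A version of a local martingale together with its square characteristic for which all
  pathwise properties hold at every point and both local martingale properties are in the form that
  can be stopped further.\<close>

definition characteristic_pair :: "(real \<Rightarrow> 'a \<Rightarrow> real) \<Rightarrow> (real \<Rightarrow> 'a \<Rightarrow> real) \<Rightarrow> bool" where
  "characteristic_pair M A \<longleftrightarrow> regular M \<and> regular A \<and>
     (\<forall>\<omega>\<in>space P. M 0 \<omega> = 0 \<and> A 0 \<omega> = 0 \<and> mono_on {0..T} (\<lambda>t. A t \<omega>)) \<and>
     centered_local M \<and> centered_local (\<lambda>t \<omega>. (M t \<omega>)\<^sup>2 - A t \<omega>)"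

section \<open>A Dynkin formula\<close>

lemma measurable_F_AE_eq:
  fixes f g :: "'a \<Rightarrow> real"
  assumes t: "t \<in> {0..T}" and f: "f \<in> borel_measurable (F t)" and ae: "AE \<omega> in P. f \<omega> = g \<omega>"
  shows "g \<in> borel_measurable (F t)"
  by (rule measurable_AE_eq[OF space_F sets_F_mono f ae]) (use t in auto)

lemma regular_modification:
  assumes N: "adapted F T N" and null: "B \<in> null_sets P"
    and cont: "\<And>\<omega>. \<omega> \<in> space P - B \<Longrightarrow> continuous_on {0..T} (\<lambda>t. N t \<omega>)"
  shows "regular (\<lambda>t \<omega>. if \<omega> \<in> B then 0 else N t \<omega>)"
  unfolding regular_def adapted_def
proof (intro conjI ballI)
  fix t assume t: "t \<in> {0..T}"
  show "(\<lambda>\<omega>. if \<omega> \<in> B then 0 else N t \<omega>) \<in> borel_measurable (F t)"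
  proof (rule measurable_F_AE_eq[OF t])
    show "N t \<in> borel_measurable (F t)" using N t by (auto simp: adapted_def)
    show "AE \<omega> in P. N t \<omega> = (if \<omega> \<in> B then 0 else N t \<omega>)"
      using AE_not_in[OF null] by eventually_elim simp
  qed
next
  fix \<omega> assume "\<omega> \<in> space P"
  then show "continuous_on {0..T} (\<lambda>t. if \<omega> \<in> B then 0 else N t \<omega>)"
    using cont[of \<omega>] by (cases "\<omega> \<in> B") auto
qed

text \<open>Both processes are set to 0 on one common null set that contains all exceptional paths;
  the zero path satisfies every requirement.\<close>

lemma characteristic_pair_modification:
  assumes A: "is_square_characteristic P F T M A" and M0: "AE \<omega> in P. M 0 \<omega> = 0"
  obtains M' A' where "characteristic_pair M' A'"
    "AE \<omega> in P. \<forall>t\<in>{0..T}. M t \<omega> = M' t \<omega> \<and> A t \<omega> = A' t \<omega>"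
proof -
  have "AE \<omega> in P. continuous_on {0..T} (\<lambda>t. M t \<omega>)" "AE \<omega> in P. continuous_on {0..T} (\<lambda>t. A t \<omega>)"
    "AE \<omega> in P. A 0 \<omega> = 0" "AE \<omega> in P. mono_on {0..T} (\<lambda>t. A t \<omega>)"
    using A by (auto simp: is_square_characteristic_def continuous_local_martingale_def continuous_paths_def)
  with M0 have "AE \<omega> in P. continuous_on {0..T} (\<lambda>t. M t \<omega>) \<and> continuous_on {0..T} (\<lambda>t. A t \<omega>) \<and>
      A 0 \<omega> = 0 \<and> mono_on {0..T} (\<lambda>t. A t \<omega>) \<and> M 0 \<omega> = 0"
    by eventually_elim simp
  then obtain B where B: "B \<in> null_sets P" and good: "\<And>\<omega>. \<omega> \<in> space P - B \<Longrightarrow>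
      continuous_on {0..T} (\<lambda>t. M t \<omega>) \<and> continuous_on {0..T} (\<lambda>t. A t \<omega>) \<and>
      A 0 \<omega> = 0 \<and> mono_on {0..T} (\<lambda>t. A t \<omega>) \<and> M 0 \<omega> = 0"
    by (rule AE_E3) blast
  let ?M = "\<lambda>t \<omega>. if \<omega> \<in> B then 0 else M t \<omega>"
  let ?A = "\<lambda>t \<omega>. if \<omega> \<in> B then 0 else A t \<omega>"
  have reg: "regular ?M" "regular ?A"
    using A good by (auto intro!: regular_modification B simp: is_square_characteristic_def continuous_local_martingale_def)
  have eq: "AE \<omega> in P. \<forall>t\<in>{0..T}. M t \<omega> = ?M t \<omega> \<and> A t \<omega> = ?A t \<omega>"
    using AE_not_in[OF B] by eventually_elim simp
  have regQ: "regular (\<lambda>t \<omega>. (?M t \<omega>)\<^sup>2 - ?A t \<omega>)"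
    by (rule regular_comp2[OF reg]) (auto intro!: continuous_intros)
  have zero: "?M 0 \<omega> = 0" "?A 0 \<omega> = 0" if "\<omega> \<in> space P" for \<omega>
    using good[of \<omega>] that by auto
  have cM: "centered_local ?M"
  proof (rule centered_localI[OF _ reg(1)])
    show "continuous_local_martingale P F T M" using A by (simp add: is_square_characteristic_def)
    show "AE \<omega> in P. \<forall>t\<in>{0..T}. M t \<omega> = ?M t \<omega>" using eq by eventually_elim simp
    show "AE \<omega> in P. ?M 0 \<omega> = 0" using zero(1) by (intro AE_I2)
  qed
  have cQ: "centered_local (\<lambda>t \<omega>. (?M t \<omega>)\<^sup>2 - ?A t \<omega>)"
  proof (rule centered_localI[OF _ regQ])
    show "continuous_local_martingale P F T (\<lambda>t \<omega>. (M t \<omega>)\<^sup>2 - A t \<omega>)"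
      using A by (simp add: is_square_characteristic_def)
    show "AE \<omega> in P. \<forall>t\<in>{0..T}. (M t \<omega>)\<^sup>2 - A t \<omega> = (?M t \<omega>)\<^sup>2 - ?A t \<omega>" using eq by eventually_elim simp
    show "AE \<omega> in P. (?M 0 \<omega>)\<^sup>2 - ?A 0 \<omega> = 0" using zero by (intro AE_I2) simp
  qed
  have mono: "mono_on {0..T} (\<lambda>t. ?A t \<omega>)" if "\<omega> \<in> space P" for \<omega>
    using good[of \<omega>] that by (cases "\<omega> \<in> B") (auto simp: mono_on_def)
  show ?thesis
  proof (rule that[OF _ eq])
    show "characteristic_pair ?M ?A"
      unfolding characteristic_pair_def using reg zero mono cM cQ by blast
  qed
qed

text \<open>Both processes compensate the square of the same M, so their difference is a local
  martingale of finite variation. This identifies any version with the one that the BMO norm picks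
  by choice.\<close>

lemma square_characteristic_unique:
  assumes A: "is_square_characteristic P F T M A" and A': "is_square_characteristic P F T M A'"
    and M0: "AE \<omega> in P. M 0 \<omega> = 0"
  shows "AE \<omega> in P. \<forall>t\<in>{0..T}. A t \<omega> = A' t \<omega>"
proof -
  obtain M1 A1 where 1: "characteristic_pair M1 A1" "AE \<omega> in P. \<forall>t\<in>{0..T}. M t \<omega> = M1 t \<omega> \<and> A t \<omega> = A1 t \<omega>"
    by (rule characteristic_pair_modification[OF A M0])
  obtain M2 A2 where 2: "characteristic_pair M2 A2" "AE \<omega> in P. \<forall>t\<in>{0..T}. M t \<omega> = M2 t \<omega> \<and> A' t \<omega> = A2 t \<omega>"
    by (rule characteristic_pair_modification[OF A' M0])
  have reg: "regular M1" "regular A1" "regular A2" using 1 2 by (auto simp: characteristic_pair_def)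
  \<comment> \<open>A2 came with its own version M2 of M; it is paired with M1 here so that the
    squares cancel exactly in the difference.\<close>
  have "centered_local (\<lambda>t \<omega>. (M1 t \<omega>)\<^sup>2 - A2 t \<omega>)"
  proof (rule centered_localI)
    show "continuous_local_martingale P F T (\<lambda>t \<omega>. (M t \<omega>)\<^sup>2 - A' t \<omega>)"
      using A' by (simp add: is_square_characteristic_def)
    show "regular (\<lambda>t \<omega>. (M1 t \<omega>)\<^sup>2 - A2 t \<omega>)"
      by (rule regular_comp2[OF reg(1,3)]) (auto intro!: continuous_intros)
    show "AE \<omega> in P. \<forall>t\<in>{0..T}. (M t \<omega>)\<^sup>2 - A' t \<omega> = (M1 t \<omega>)\<^sup>2 - A2 t \<omega>"
      using 1(2) 2(2) by eventually_elim simp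
    show "AE \<omega> in P. (M1 0 \<omega>)\<^sup>2 - A2 0 \<omega> = 0"
      using 1(1) 2(1) by (intro AE_I2) (simp add: characteristic_pair_def)
  qed
  moreover have "centered_local (\<lambda>t \<omega>. (M1 t \<omega>)\<^sup>2 - A1 t \<omega>)" using 1 by (simp add: characteristic_pair_def)
  ultimately have "centered_local (\<lambda>t \<omega>. ((M1 t \<omega>)\<^sup>2 - A2 t \<omega>) - ((M1 t \<omega>)\<^sup>2 - A1 t \<omega>))"
    by (rule centered_local_diff)
  then have "centered_local (\<lambda>t \<omega>. A1 t \<omega> - A2 t \<omega>)" by simp
  then have "AE \<omega> in P. \<forall>t\<in>{0..T}. A1 t \<omega> = A2 t \<omega>"
    using 1(1) 2(1) by (intro finite_variation_centered_local_zero) (auto simp: characteristic_pair_def)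
  with 1(2) 2(2) show ?thesis by eventually_elim simp
qed

lemma continuous_local_martingale_AE_cong:
  assumes N: "continuous_local_martingale P F T N" and eq: "AE \<omega> in P. \<forall>t\<in>{0..T}. N t \<omega> = N' t \<omega>"
  shows "continuous_local_martingale P F T N'"
  unfolding continuous_local_martingale_def
proof (intro conjI)
  show "adapted F T N'"
    unfolding adapted_def
  proof
    fix t assume t: "t \<in> {0..T}"
    have "AE \<omega> in P. N t \<omega> = N' t \<omega>" using eq by eventually_elim (use t in simp)
    moreover have "N t \<in> borel_measurable (F t)"
      using N t by (auto simp: adapted_def continuous_local_martingale_def)
    ultimately show "N' t \<in> borel_measurable (F t)" by (rule measurable_F_AE_eq[OF t, rotated])
  qed
  have "AE \<omega> in P. continuous_on {0..T} (\<lambda>t. N t \<omega>)"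
    using N by (simp add: continuous_local_martingale_def continuous_paths_def)
  with eq show "continuous_paths P T N'"
    unfolding continuous_paths_def
  proof eventually_elim
    case (elim \<omega>)
    then show ?case using continuous_on_cong[of "{0..T}" "{0..T}" "\<lambda>t. N t \<omega>" "\<lambda>t. N' t \<omega>"] by simp
  qed
  from N obtain \<tau> where \<tau>: "localizing_sequence P F T \<tau>"
    and mart: "\<And>n. martingale P F T (\<lambda>t \<omega>. N (min t (\<tau> n \<omega>)) \<omega> - N 0 \<omega>)"
    by (auto simp: continuous_local_martingale_def)
  have ST: "\<tau> n \<in> ST" for n using \<tau> by (auto simp: localizing_sequence_def)
  have "martingale P F T (\<lambda>t \<omega>. N' (min t (\<tau> n \<omega>)) \<omega> - N' 0 \<omega>)" for n
  proof (rule martingale_AE_cong[OF mart[of n]])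
    fix t assume t: "t \<in> {0..T}"
    show "AE \<omega> in P. N (min t (\<tau> n \<omega>)) \<omega> - N 0 \<omega> = N' (min t (\<tau> n \<omega>)) \<omega> - N' 0 \<omega>"
      using eq AE_space
    proof eventually_elim
      case (elim \<omega>)
      have "min t (\<tau> n \<omega>) \<in> {0..T}" "0 \<in> {0..T}" using ST_range[OF ST elim(2), of n] t by auto
      then show ?case using elim by auto
    qed
  qed
  with \<tau> show "\<exists>\<tau>. localizing_sequence P F T \<tau> \<and>
      (\<forall>n. martingale P F T (\<lambda>t \<omega>. N' (min t (\<tau> n \<omega>)) \<omega> - N' 0 \<omega>))" by blast
qed

lemma is_square_characteristic_AE_cong:
  assumes A: "is_square_characteristic P F T M A"
    and eq: "AE \<omega> in P. \<forall>t\<in>{0..T}. M t \<omega> = M' t \<omega> \<and> A t \<omega> = A' t \<omega>"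
  shows "is_square_characteristic P F T M' A'"
  unfolding is_square_characteristic_def
proof (intro conjI)
  show "continuous_local_martingale P F T M'"
  proof (rule continuous_local_martingale_AE_cong)
    show "continuous_local_martingale P F T M" using A by (simp add: is_square_characteristic_def)
    show "AE \<omega> in P. \<forall>t\<in>{0..T}. M t \<omega> = M' t \<omega>" using eq by eventually_elim simp
  qed
  show "continuous_local_martingale P F T (\<lambda>t \<omega>. (M' t \<omega>)\<^sup>2 - A' t \<omega>)"
  proof (rule continuous_local_martingale_AE_cong)
    show "continuous_local_martingale P F T (\<lambda>t \<omega>. (M t \<omega>)\<^sup>2 - A t \<omega>)" using A by (simp add: is_square_characteristic_def)
    show "AE \<omega> in P. \<forall>t\<in>{0..T}. (M t \<omega>)\<^sup>2 - A t \<omega> = (M' t \<omega>)\<^sup>2 - A' t \<omega>" using eq by eventually_elim simp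
  qed
  show "adapted F T A'"
    unfolding adapted_def
  proof
    fix t assume t: "t \<in> {0..T}"
    have "AE \<omega> in P. A t \<omega> = A' t \<omega>" using eq by eventually_elim (use t in simp)
    moreover have "A t \<in> borel_measurable (F t)"
      using A t by (auto simp: adapted_def is_square_characteristic_def)
    ultimately show "A' t \<in> borel_measurable (F t)" by (rule measurable_F_AE_eq[OF t, rotated])
  qed
  have "AE \<omega> in P. continuous_on {0..T} (\<lambda>t. A t \<omega>)" "AE \<omega> in P. A 0 \<omega> = 0" "AE \<omega> in P. mono_on {0..T} (\<lambda>t. A t \<omega>)"
    using A by (auto simp: is_square_characteristic_def continuous_paths_def)
  with eq have "AE \<omega> in P. continuous_on {0..T} (\<lambda>t. A' t \<omega>) \<and> A' 0 \<omega> = 0 \<and> mono_on {0..T} (\<lambda>t. A' t \<omega>)"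
  proof eventually_elim
    case (elim \<omega>)
    have "A' 0 \<omega> = 0" using elim horizon_pos by auto
    moreover have "mono_on {0..T} (\<lambda>t. A' t \<omega>)" using elim(1,4) by (simp add: mono_on_def)
    moreover have "continuous_on {0..T} (\<lambda>t. A' t \<omega>)"
      using elim(1,2) continuous_on_cong[of "{0..T}" "{0..T}" "\<lambda>t. A t \<omega>" "\<lambda>t. A' t \<omega>"] by simp
    ultimately show ?case by simp
  qed
  then show "continuous_paths P T A'" "AE \<omega> in P. A' 0 \<omega> = 0" "AE \<omega> in P. mono_on {0..T} (\<lambda>t. A' t \<omega>)"
    unfolding continuous_paths_def by (auto elim: eventually_mono)
qed

text \<open>This stands in for Ito's formula when the drift vanishes. For smooth f the principal
  part amounts to g1 = f_m, g2 = f_mm / 2 and f_a + f_mm / 2 = 0, subscripts denoting partial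
  derivatives. A step of the partition then changes the expectation by at most K \<epsilon>
  E[x^2 + b] = 2 K \<epsilon> E[b], and the sum of these errors is at most 2 K \<epsilon> k.\<close>

lemma dynkin_formula:
  assumes cp: "characteristic_pair M A" and \<sigma>: "\<sigma> \<in> ST"
    and bound: "\<And>\<omega> s. \<omega> \<in> space P \<Longrightarrow> 0 \<le> s \<Longrightarrow> s \<le> \<sigma> \<omega> \<Longrightarrow> \<bar>M s \<omega>\<bar> \<le> k \<and> A s \<omega> \<le> k"
    and cont: "continuous_on UNIV (\<lambda>z. f (fst z) (snd z))" "continuous_on UNIV (\<lambda>z. g1 (fst z) (snd z))"
      "continuous_on UNIV (\<lambda>z. g2 (fst z) (snd z))"
    and K: "0 \<le> K" "\<And>\<epsilon> m a x b. 0 < \<epsilon> \<Longrightarrow> \<epsilon> \<le> 1 \<Longrightarrow> \<bar>m\<bar> \<le> k \<Longrightarrow> 0 \<le> a \<Longrightarrow> a \<le> k \<Longrightarrow> \<bar>x\<bar> \<le> \<epsilon> \<Longrightarrow> 0 \<le> b \<Longrightarrow> b \<le> \<epsilon> \<Longrightarrow>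
      \<bar>f (m + x) (a + b) - f m a - g1 m a * x - g2 m a * (x\<^sup>2 - b)\<bar> \<le> K * \<epsilon> * (x\<^sup>2 + b)"
  shows "(\<integral>\<omega>. f (M (\<sigma> \<omega>) \<omega>) (A (\<sigma> \<omega>) \<omega>) \<partial>P) = f 0 0"
proof -
  have M: "regular M" "centered_local M" and A: "regular A" "centered_local (\<lambda>t \<omega>. (M t \<omega>)\<^sup>2 - A t \<omega>)"
    and zero: "\<And>\<omega>. \<omega> \<in> space P \<Longrightarrow> M 0 \<omega> = 0 \<and> A 0 \<omega> = 0"
    and Amono: "\<And>\<omega>. \<omega> \<in> space P \<Longrightarrow> mono_on {0..T} (\<lambda>t. A t \<omega>)"
    using cp by (auto simp: characteristic_pair_def)
  obtain Cf where Cf: "\<And>m a. \<bar>m\<bar> \<le> k \<Longrightarrow> 0 \<le> a \<Longrightarrow> a \<le> k \<Longrightarrow> \<bar>f m a\<bar> \<le> Cf"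
    by (rule continuous_bounded_on_box[OF cont(1)]) (rule that; assumption)
  obtain C1 where C1: "\<And>m a. \<bar>m\<bar> \<le> k \<Longrightarrow> 0 \<le> a \<Longrightarrow> a \<le> k \<Longrightarrow> \<bar>g1 m a\<bar> \<le> C1"
    by (rule continuous_bounded_on_box[OF cont(2)]) (rule that; assumption)
  obtain C2 where C2: "\<And>m a. \<bar>m\<bar> \<le> k \<Longrightarrow> 0 \<le> a \<Longrightarrow> a \<le> k \<Longrightarrow> \<bar>g2 m a\<bar> \<le> C2"
    by (rule continuous_bounded_on_box[OF cont(3)]) (rule that; assumption)
  have Anonneg: "0 \<le> A s \<omega>" if "\<omega> \<in> space P" "0 \<le> s" "s \<le> T" for s \<omega>
    using mono_onD[OF Amono[OF that(1)], of 0 s] zero[OF that(1)] that by auto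
  have small: "\<bar>(\<integral>\<omega>. f (M (\<sigma> \<omega>) \<omega>) (A (\<sigma> \<omega>) \<omega>) \<partial>P) - f 0 0\<bar> \<le> 2 * K * \<epsilon> * k" if \<epsilon>: "0 < \<epsilon>" "\<epsilon> \<le> 1" for \<epsilon>
  proof -
    have st0: "(\<lambda>_. 0) \<in> ST" using horizon_pos by (intro ST_const) auto
    have le0: "0 \<le> \<sigma> \<omega>" if "\<omega> \<in> space P" for \<omega> using ST_range[OF \<sigma> that] by simp
    obtain \<rho> :: "nat \<Rightarrow> 'a \<Rightarrow> real" where \<rho>0: "\<And>\<omega>. \<omega> \<in> space P \<Longrightarrow> \<rho> 0 \<omega> = 0" and \<rho>: "\<And>n. \<rho> n \<in> ST"
      and mono: "\<And>n \<omega>. \<omega> \<in> space P \<Longrightarrow> \<rho> n \<omega> \<le> \<rho> (Suc n) \<omega>" and le: "\<And>n \<omega>. \<rho> n \<omega> \<le> \<sigma> \<omega>"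
      and incM: "\<And>n \<omega> t. \<omega> \<in> space P \<Longrightarrow> t \<in> {0..T} \<Longrightarrow> \<bar>M (min (\<rho> (Suc n) \<omega>) t) \<omega> - M (min (\<rho> n \<omega>) t) \<omega>\<bar> \<le> \<epsilon>"
      and incA: "\<And>n \<omega> t. \<omega> \<in> space P \<Longrightarrow> t \<in> {0..T} \<Longrightarrow> \<bar>A (min (\<rho> (Suc n) \<omega>) t) \<omega> - A (min (\<rho> n \<omega>) t) \<omega>\<bar> \<le> \<epsilon>"
      and inc: "\<And>n \<omega>. \<omega> \<in> space P \<Longrightarrow> \<bar>M (\<rho> (Suc n) \<omega>) \<omega> - M (\<rho> n \<omega>) \<omega>\<bar> \<le> \<epsilon>"
        "\<And>n \<omega>. \<omega> \<in> space P \<Longrightarrow> \<bar>A (\<rho> (Suc n) \<omega>) \<omega> - A (\<rho> n \<omega>) \<omega>\<bar> \<le> \<epsilon>"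
      and ev: "\<And>\<omega>. \<omega> \<in> space P \<Longrightarrow> \<forall>\<^sub>F n in sequentially. \<rho> n \<omega> = \<sigma> \<omega>"
      by (rule fine_partition_until[OF M(1) A(1) \<epsilon>(1) st0 \<sigma> le0]) (assumption | rule that; assumption)+
    have range: "0 \<le> \<rho> n \<omega>" "\<rho> n \<omega> \<le> \<sigma> \<omega>" "\<rho> n \<omega> \<le> T" if "\<omega> \<in> space P" for n \<omega>
      using ST_range[OF \<rho> that, of n] le[of n \<omega>] by auto
    define m where "m n \<omega> = M (\<rho> n \<omega>) \<omega>" for n \<omega>
    define a where "a n \<omega> = A (\<rho> n \<omega>) \<omega>" for n \<omega>
    have box: "\<bar>m n \<omega>\<bar> \<le> k" "0 \<le> a n \<omega>" "a n \<omega> \<le> k" if "\<omega> \<in> space P" for n \<omega>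
      using bound[OF that, of "\<rho> n \<omega>"] Anonneg[OF that, of "\<rho> n \<omega>"] range[OF that, of n] by (auto simp: m_def a_def)
    have x: "\<bar>m (Suc n) \<omega> - m n \<omega>\<bar> \<le> \<epsilon>" and b: "0 \<le> a (Suc n) \<omega> - a n \<omega>" "a (Suc n) \<omega> - a n \<omega> \<le> \<epsilon>"
      if "\<omega> \<in> space P" for n \<omega>
      using inc[OF that, of n] mono_onD[OF Amono[OF that], of "\<rho> n \<omega>" "\<rho> (Suc n) \<omega>"]
        range[OF that, of n] range[OF that, of "Suc n"] mono[OF that, of n]
      by (auto simp: m_def a_def)
    have mF[measurable]: "m n \<in> borel_measurable (pre_sigma (\<rho> n))" "a n \<in> borel_measurable (pre_sigma (\<rho> n))" for n
      unfolding m_def a_def by (intro stopped_value_measurable M A \<rho>)+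
    have mP[measurable]: "m n \<in> borel_measurable P" "a n \<in> borel_measurable P" for n
      unfolding m_def a_def by (intro stopped_value_measurable_P M A \<rho>)+
    have meas2: "(\<lambda>\<omega>. h (m n \<omega>) (a n \<omega>)) \<in> borel_measurable (pre_sigma (\<rho> n))"
      if "continuous_on UNIV (\<lambda>z. h (fst z) (snd z))" for h :: "real \<Rightarrow> real \<Rightarrow> real" and n
      using stopped_value_measurable[OF regular_comp2[OF M(1) A(1) that] \<rho>] by (simp add: m_def a_def)
    note meas2P = measurable_from_subalg[OF subalgebra_pre_sigma[OF \<rho>] meas2]
    note [measurable] = meas2P[OF cont(1)] meas2P[OF cont(2)] meas2P[OF cont(3)]
    have intf: "integrable P (\<lambda>\<omega>. f (m n \<omega>) (a n \<omega>))" for n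
      using box by (intro integrable_bounded[where C=Cf]) (auto intro!: Cf)
    have inta: "integrable P (a n)" for n
      using box by (intro integrable_bounded[where C=k]) auto
    have step: "\<bar>(\<integral>\<omega>. f (m n \<omega>) (a n \<omega>) \<partial>P) - f 0 0\<bar> \<le> 2 * K * \<epsilon> * (\<integral>\<omega>. a n \<omega> \<partial>P)" for n
    proof (induction n)
      case 0
      have "(\<integral>\<omega>. f (m 0 \<omega>) (a 0 \<omega>) \<partial>P) = (\<integral>\<omega>. f 0 0 \<partial>P)"
        by (rule Bochner_Integration.integral_cong) (simp_all add: m_def a_def \<rho>0 zero)
      moreover have "(\<integral>\<omega>. a 0 \<omega> \<partial>P) = (\<integral>\<omega>. 0 \<partial>P)"
        by (rule Bochner_Integration.integral_cong) (simp_all add: a_def \<rho>0 zero)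
      ultimately show ?case by (simp add: prob_space)
    next
      case (Suc n)
      let ?x = "\<lambda>\<omega>. m (Suc n) \<omega> - m n \<omega>" and ?b = "\<lambda>\<omega>. a (Suc n) \<omega> - a n \<omega>"
      let ?G1 = "\<lambda>\<omega>. g1 (m n \<omega>) (a n \<omega>)" and ?G2 = "\<lambda>\<omega>. g2 (m n \<omega>) (a n \<omega>)"
      have G1: "\<bar>?G1 \<omega>\<bar> \<le> C1" and G2: "\<bar>?G2 \<omega>\<bar> \<le> C2" if "\<omega> \<in> space P" for \<omega>
        using box[OF that] by (auto intro!: C1 C2)
      have 1: "(\<integral>\<omega>. ?G1 \<omega> * ?x \<omega> \<partial>P) = 0"
        unfolding m_def
      proof (rule centered_local_increment[OF M(2,1) \<rho> \<rho> mono meas2[OF cont(2), unfolded m_def] G1[unfolded m_def]])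
        fix \<omega> t assume "\<omega> \<in> space P" "t \<in> {0..T}"
        then show "\<bar>g1 (M (\<rho> n \<omega>) \<omega>) (a n \<omega>) * (M (min (\<rho> (Suc n) \<omega>) t) \<omega> - M (min (\<rho> n \<omega>) t) \<omega>)\<bar> \<le> C1 * \<epsilon>"
          unfolding abs_mult using order_trans[OF abs_ge_zero G1]
          by (intro mult_mono G1[unfolded m_def] incM) auto
      qed
      have 2: "(\<integral>\<omega>. ?G2 \<omega> * ((?x \<omega>)\<^sup>2 - ?b \<omega>) \<partial>P) = 0"
        unfolding m_def a_def
        by (rule centered_square_increment[OF M(2,1) A(2,1) \<rho> \<rho> mono meas2[OF cont(3), unfolded m_def a_def] G2[unfolded m_def a_def] incM incA])
      \<comment> \<open>The weight 1 gives E[x^2] = E[b] on this step, which turns the error bound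
        into a telescoping quantity.\<close>
      have 3: "(\<integral>\<omega>. 1 * ((?x \<omega>)\<^sup>2 - ?b \<omega>) \<partial>P) = 0"
        unfolding m_def a_def
        by (rule centered_square_increment[OF M(2,1) A(2,1) \<rho> \<rho> mono _ _ incM incA, where C=1]) auto
      have ix: "integrable P ?x" using x by (intro integrable_bounded[where C=\<epsilon>]) auto
      have ib: "integrable P ?b" by (intro Bochner_Integration.integrable_diff inta)
      have ix2: "integrable P (\<lambda>\<omega>. (?x \<omega>)\<^sup>2)"
      proof (rule integrable_bounded[where C="\<epsilon>\<^sup>2"])
        fix \<omega> assume "\<omega> \<in> space P"
        then show "\<bar>(?x \<omega>)\<^sup>2\<bar> \<le> \<epsilon>\<^sup>2" using x[of \<omega> n] \<epsilon> abs_le_square_iff[of "?x \<omega>" \<epsilon>] by simp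
      qed simp
      have i1: "integrable P (\<lambda>\<omega>. ?G1 \<omega> * ?x \<omega>)" by (intro integrable_mult_bounded[OF _ G1] ix) auto
      have i2: "integrable P (\<lambda>\<omega>. ?G2 \<omega> * ((?x \<omega>)\<^sup>2 - ?b \<omega>))"
        by (intro integrable_mult_bounded[OF _ G2] Bochner_Integration.integrable_diff ix2 ib) auto
      let ?R = "\<lambda>\<omega>. f (m (Suc n) \<omega>) (a (Suc n) \<omega>) - f (m n \<omega>) (a n \<omega>) - ?G1 \<omega> * ?x \<omega> - ?G2 \<omega> * ((?x \<omega>)\<^sup>2 - ?b \<omega>)"
      have iR: "integrable P ?R" by (intro Bochner_Integration.integrable_diff[OF _ i2] Bochner_Integration.integrable_diff[OF _ i1] Bochner_Integration.integrable_diff intf)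
      have diff_R: "(\<integral>\<omega>. f (m (Suc n) \<omega>) (a (Suc n) \<omega>) \<partial>P) - (\<integral>\<omega>. f (m n \<omega>) (a n \<omega>) \<partial>P) = (\<integral>\<omega>. ?R \<omega> \<partial>P)"
        by (subst Bochner_Integration.integral_diff[OF _ i2], (intro Bochner_Integration.integrable_diff[OF _ i1] Bochner_Integration.integrable_diff intf),
            subst Bochner_Integration.integral_diff[OF _ i1], (intro Bochner_Integration.integrable_diff intf),
            subst Bochner_Integration.integral_diff[OF intf intf]) (simp add: 1 2)
      have "\<bar>(\<integral>\<omega>. f (m (Suc n) \<omega>) (a (Suc n) \<omega>) \<partial>P) - (\<integral>\<omega>. f (m n \<omega>) (a n \<omega>) \<partial>P)\<bar> \<le> (\<integral>\<omega>. \<bar>?R \<omega>\<bar> \<partial>P)"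
        unfolding diff_R by (rule integral_abs_bound)
      also have "\<dots> \<le> (\<integral>\<omega>. K * \<epsilon> * ((?x \<omega>)\<^sup>2 + ?b \<omega>) \<partial>P)"
      proof (rule integral_mono)
        show "integrable P (\<lambda>\<omega>. \<bar>?R \<omega>\<bar>)" using iR by (rule integrable_abs)
        show "integrable P (\<lambda>\<omega>. K * \<epsilon> * ((?x \<omega>)\<^sup>2 + ?b \<omega>))"
          by (intro Bochner_Integration.integrable_mult_right Bochner_Integration.integrable_add ix2 ib)
        fix \<omega> assume \<omega>: "\<omega> \<in> space P"
        show "\<bar>?R \<omega>\<bar> \<le> K * \<epsilon> * ((?x \<omega>)\<^sup>2 + ?b \<omega>)"
          using K(2)[OF \<epsilon> box[OF \<omega>, of n] x[OF \<omega>, of n] b[OF \<omega>, of n]] by simp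
      qed
      also have "\<dots> = 2 * K * \<epsilon> * (\<integral>\<omega>. a (Suc n) \<omega> \<partial>P) - 2 * K * \<epsilon> * (\<integral>\<omega>. a n \<omega> \<partial>P)"
      proof -
        have "(\<integral>\<omega>. (?x \<omega>)\<^sup>2 \<partial>P) = (\<integral>\<omega>. ?b \<omega> \<partial>P)"
          using 3 Bochner_Integration.integral_diff[OF ix2 ib] by simp
        then have eq: "(\<integral>\<omega>. (?x \<omega>)\<^sup>2 + ?b \<omega> \<partial>P) = 2 * ((\<integral>\<omega>. a (Suc n) \<omega> \<partial>P) - (\<integral>\<omega>. a n \<omega> \<partial>P))"
          unfolding Bochner_Integration.integral_add[OF ix2 ib] Bochner_Integration.integral_diff[OF inta inta] by simp
        show ?thesis unfolding integral_mult_right_zero eq by (simp add: algebra_simps)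
      qed
      finally have "\<bar>(\<integral>\<omega>. f (m (Suc n) \<omega>) (a (Suc n) \<omega>) \<partial>P) - (\<integral>\<omega>. f (m n \<omega>) (a n \<omega>) \<partial>P)\<bar>
          \<le> 2 * K * \<epsilon> * (\<integral>\<omega>. a (Suc n) \<omega> \<partial>P) - 2 * K * \<epsilon> * (\<integral>\<omega>. a n \<omega> \<partial>P)" .
      with Suc.IH show ?case by linarith
    qed
    have "(\<integral>\<omega>. a n \<omega> \<partial>P) \<le> k" for n
      using integral_mono[OF inta, of "\<lambda>_. k" n] box by (simp add: prob_space)
    then have "2 * K * \<epsilon> * (\<integral>\<omega>. a n \<omega> \<partial>P) \<le> 2 * K * \<epsilon> * k" for n
      using K(1) \<epsilon> by (intro mult_left_mono) auto
    then have le: "\<bar>(\<integral>\<omega>. f (m n \<omega>) (a n \<omega>) \<partial>P) - f 0 0\<bar> \<le> 2 * K * \<epsilon> * k" for n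
      using step order_trans by blast
    have "(\<lambda>n. \<integral>\<omega>. f (m n \<omega>) (a n \<omega>) \<partial>P) \<longlonglongrightarrow> (\<integral>\<omega>. f (M (\<sigma> \<omega>) \<omega>) (A (\<sigma> \<omega>) \<omega>) \<partial>P)"
    proof (rule integral_dominated_convergence[where w="\<lambda>_. Cf"])
      show "AE \<omega> in P. (\<lambda>n. f (m n \<omega>) (a n \<omega>)) \<longlonglongrightarrow> f (M (\<sigma> \<omega>) \<omega>) (A (\<sigma> \<omega>) \<omega>)"
      proof (rule AE_I2, rule tendsto_eventually)
        fix \<omega> assume "\<omega> \<in> space P"
        from ev[OF this] show "\<forall>\<^sub>F n in sequentially. f (m n \<omega>) (a n \<omega>) = f (M (\<sigma> \<omega>) \<omega>) (A (\<sigma> \<omega>) \<omega>)"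
          by eventually_elim (simp add: m_def a_def)
      qed
      show "AE \<omega> in P. norm (f (m n \<omega>) (a n \<omega>)) \<le> Cf" for n
        using box by (intro AE_I2) (auto intro!: Cf)
      show "(\<lambda>\<omega>. f (M (\<sigma> \<omega>) \<omega>) (A (\<sigma> \<omega>) \<omega>)) \<in> borel_measurable P"
        using stopped_value_measurable_P[OF regular_comp2[OF M(1) A(1) cont(1)] \<sigma>] by simp
    qed auto
    then have "(\<lambda>n. \<bar>(\<integral>\<omega>. f (m n \<omega>) (a n \<omega>) \<partial>P) - f 0 0\<bar>) \<longlonglongrightarrow> \<bar>(\<integral>\<omega>. f (M (\<sigma> \<omega>) \<omega>) (A (\<sigma> \<omega>) \<omega>) \<partial>P) - f 0 0\<bar>"
      by (intro tendsto_intros)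
    then show ?thesis by (rule LIMSEQ_le_const2) (use le in auto)
  qed
  have "(\<lambda>n. 2 * K * inverse (real (Suc n)) * k) \<longlonglongrightarrow> 2 * K * 0 * k"
    by (intro tendsto_intros LIMSEQ_inverse_real_of_nat)
  moreover have "\<bar>(\<integral>\<omega>. f (M (\<sigma> \<omega>) \<omega>) (A (\<sigma> \<omega>) \<omega>) \<partial>P) - f 0 0\<bar> \<le> 2 * K * inverse (real (Suc n)) * k" for n
    by (rule small) (auto simp: inverse_eq_divide)
  ultimately have "\<bar>(\<integral>\<omega>. f (M (\<sigma> \<omega>) \<omega>) (A (\<sigma> \<omega>) \<omega>) \<partial>P) - f 0 0\<bar> \<le> 2 * K * 0 * k"
    by (intro LIMSEQ_le_const) auto
  then show ?thesis by simp
qed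

lemma optional_stopping_bounded:
  assumes N: "martingale P F T N" "regular N" and \<tau>: "\<tau> \<in> ST"
    and G: "G \<in> borel_measurable (pre_sigma \<tau>)" "\<And>\<omega>. \<omega> \<in> space P \<Longrightarrow> \<bar>G \<omega>\<bar> \<le> C"
  shows "(\<integral>\<omega>. G \<omega> * N T \<omega> \<partial>P) = (\<integral>\<omega>. G \<omega> * N (\<tau> \<omega>) \<omega> \<partial>P)"
proof -
  interpret sub: finite_measure_subalgebra P "pre_sigma \<tau>"
    by (rule pre_sigma_finite_measure_subalgebra[OF \<tau>])
  have NT: "integrable P (N T)" using N(1) horizon_pos by (auto simp: martingale_def)
  have N\<tau>: "integrable P (\<lambda>\<omega>. N (\<tau> \<omega>) \<omega>)" by (rule optional_stopping(1)[OF N \<tau>])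
  have GP: "G \<in> borel_measurable P" by (rule measurable_from_subalg[OF subalgebra_pre_sigma[OF \<tau>] G(1)])
  have "AE \<omega> in P. real_cond_exp P (pre_sigma \<tau>) (N T) \<omega> = N (\<tau> \<omega>) \<omega>"
    using optional_stopping_set[OF N \<tau>] NT N\<tau> stopped_value_measurable[OF N(2) \<tau>]
    by (intro sub.real_cond_exp_charact) (auto simp: set_lebesgue_integral_def)
  then have "(\<integral>\<omega>. G \<omega> * real_cond_exp P (pre_sigma \<tau>) (N T) \<omega> \<partial>P) = (\<integral>\<omega>. G \<omega> * N (\<tau> \<omega>) \<omega> \<partial>P)"
    using GP N\<tau> by (intro integral_cong_AE) auto
  then show ?thesis
    using sub.real_cond_exp_intg(2)[OF integrable_mult_bounded[OF GP G(2) NT] G(1)] NT by simp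
qed

section \<open>Conditional expectation bounds and change of measure\<close>

text \<open>The hypothesis is tested on the events where the conditional expectation is at least c +
  1 / (n + 1). Finiteness of c permits the cancellation in the extended reals that makes these
  events null.\<close>

lemma nn_cond_exp_le_const:
  assumes \<tau>: "\<tau> \<in> ST" and f[measurable]: "f \<in> borel_measurable P" and c: "c < \<infinity>"
    and le: "\<And>B. B \<in> sets (pre_sigma \<tau>) \<Longrightarrow> (\<integral>\<^sup>+\<omega>. indicator B \<omega> * f \<omega> \<partial>P) \<le> c * emeasure P B"
  shows "AE \<omega> in P. nn_cond_exp P (pre_sigma \<tau>) f \<omega> \<le> c"
proof -
  interpret sub: finite_measure_subalgebra P "pre_sigma \<tau>"
    by (rule pre_sigma_finite_measure_subalgebra[OF \<tau>])
  let ?g = "nn_cond_exp P (pre_sigma \<tau>) f"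
  have "AE \<omega> in P. \<not> (c + ennreal (1 / real (Suc n)) \<le> ?g \<omega>)" for n
  proof -
    define B where "B = {\<omega> \<in> space (pre_sigma \<tau>). c + ennreal (1 / real (Suc n)) \<le> ?g \<omega>}"
    have B: "B \<in> sets (pre_sigma \<tau>)" unfolding B_def by measurable
    have BP[measurable]: "B \<in> sets P" by (rule pre_sigma_sets_subset[OF \<tau> B])
    have "c * emeasure P B + ennreal (1 / real (Suc n)) * emeasure P B
        = (\<integral>\<^sup>+\<omega>. (c + ennreal (1 / real (Suc n))) * indicator B \<omega> \<partial>P)"
      by (subst nn_integral_cmult_indicator[OF BP]) (simp add: distrib_right)
    also have "\<dots> \<le> (\<integral>\<^sup>+\<omega>. indicator B \<omega> * ?g \<omega> \<partial>P)"
      by (intro nn_integral_mono) (auto simp: B_def indicator_def)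
    also have "\<dots> = (\<integral>\<^sup>+\<omega>. indicator B \<omega> * f \<omega> \<partial>P)"
      using B by (intro sub.nn_cond_exp_intg) auto
    also have "\<dots> \<le> c * emeasure P B + 0" using le[OF B] by simp
    finally have "ennreal (1 / real (Suc n)) * emeasure P B \<le> 0"
      using c emeasure_finite[of B] by (subst (asm) ennreal_add_left_cancel_le) (auto simp: ennreal_mult_eq_top_iff)
    then have "emeasure P B = 0" by (simp del: of_nat_Suc)
    then have "AE \<omega> in P. \<omega> \<notin> B" using BP by (intro AE_not_in) auto
    then show ?thesis using AE_space by eventually_elim (auto simp: B_def space_pre_sigma)
  qed
  then have "AE \<omega> in P. \<forall>n. \<not> (c + ennreal (1 / real (Suc n)) \<le> ?g \<omega>)" by (simp add: AE_all_countable)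
  then show ?thesis
  proof eventually_elim
    case (elim \<omega>)
    show ?case
    proof (rule ennreal_le_epsilon)
      fix e :: real assume "0 < e"
      then obtain n where n: "inverse (real (Suc n)) < e" using reals_Archimedean by blast
      have "?g \<omega> \<le> c + ennreal (1 / real (Suc n))" using elim by (meson linear)
      also have "\<dots> \<le> c + ennreal e" using n by (intro add_left_mono ennreal_leI) (simp add: inverse_eq_divide)
      finally show "?g \<omega> \<le> c + ennreal e" .
    qed
  qed
qed

lemma bmo_norm_power2_le:
  assumes c: "0 \<le> c"
    and le: "\<And>\<tau>. \<tau> \<in> ST \<Longrightarrow> AE \<omega> in P. nn_cond_exp_at P F \<tau>
      (\<lambda>\<omega>. square_characteristic P F T N T \<omega> - square_characteristic P F T N (\<tau> \<omega>) \<omega>) \<omega> \<le> ennreal c"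
  shows "(bmo_norm P F T N)\<^sup>2 \<le> ennreal c"
proof -
  have m[measurable]: "ennreal_sqrt \<in> borel_measurable borel" unfolding ennreal_sqrt_def by measurable
  have sqrt_le: "ennreal_sqrt x \<le> ennreal (sqrt c)" if "x \<le> ennreal c" for x
  proof -
    have "x \<noteq> \<infinity>" using that by (auto simp: top_unique)
    moreover have "enn2real x \<le> c" by (rule enn2real_leI[OF c that])
    ultimately show ?thesis by (simp add: ennreal_sqrt_def ennreal_leI)
  qed
  have "bmo_norm P F T N \<le> ennreal (sqrt c)"
    unfolding bmo_norm_def
  proof (rule SUP_least)
    fix \<tau> assume \<tau>: "\<tau> \<in> ST"
    have [measurable]: "nn_cond_exp_at P F \<tau> f \<in> borel_measurable P" for f
      unfolding nn_cond_exp_at_def by measurable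
    show "esssup P (\<lambda>\<omega>. ennreal_sqrt (nn_cond_exp_at P F \<tau>
          (\<lambda>\<omega>. square_characteristic P F T N T \<omega> - square_characteristic P F T N (\<tau> \<omega>) \<omega>) \<omega>)) \<le> ennreal (sqrt c)"
    proof (rule esssup_I)
      show "AE \<omega> in P. ennreal_sqrt (nn_cond_exp_at P F \<tau>
          (\<lambda>\<omega>. square_characteristic P F T N T \<omega> - square_characteristic P F T N (\<tau> \<omega>) \<omega>) \<omega>) \<le> ennreal (sqrt c)"
        using le[OF \<tau>] by eventually_elim (rule sqrt_le)
    qed measurable
  qed
  then have "(bmo_norm P F T N)\<^sup>2 \<le> (ennreal (sqrt c))\<^sup>2" by (intro power_mono) auto
  also have "\<dots> = ennreal c" using c by (simp add: ennreal_power)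
  finally show ?thesis .
qed

lemma AE_stopped_eq:
  assumes "AE \<omega> in P. \<forall>t\<in>{0..T}. N t \<omega> = N' t \<omega>" "\<tau> \<in> ST"
  shows "AE \<omega> in P. N (\<tau> \<omega>) \<omega> = N' (\<tau> \<omega>) \<omega>"
  using assms(1) AE_space by eventually_elim (use ST_range[OF assms(2)] in auto)

lemma measurable_P_AE_eq:
  fixes f g :: "'a \<Rightarrow> real"
  shows "f \<in> borel_measurable P \<Longrightarrow> AE \<omega> in P. f \<omega> = g \<omega> \<Longrightarrow> g \<in> borel_measurable P"
  by (rule measurable_AE_eq) (use sets_F_subset[of 0] horizon_pos in auto)

text \<open>Extended nonnegative values allow unbounded weights; both the reciprocal of the
  exponential at \<tau> and the exponential itself occur as such.\<close>

lemma optional_stopping_nn: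
  assumes N: "martingale P F T N" "regular N" and pos: "\<And>t \<omega>. 0 \<le> N t \<omega>" and \<tau>: "\<tau> \<in> ST"
    and g: "g \<in> borel_measurable (pre_sigma \<tau>)"
  shows "(\<integral>\<^sup>+\<omega>. g \<omega> * ennreal (N T \<omega>) \<partial>P) = (\<integral>\<^sup>+\<omega>. g \<omega> * ennreal (N (\<tau> \<omega>) \<omega>) \<partial>P)"
proof -
  interpret sub: finite_measure_subalgebra P "pre_sigma \<tau>"
    by (rule pre_sigma_finite_measure_subalgebra[OF \<tau>])
  have NT: "integrable P (N T)" using N(1) horizon_pos by (auto simp: martingale_def)
  have N\<tau>: "integrable P (\<lambda>\<omega>. N (\<tau> \<omega>) \<omega>)" by (rule optional_stopping(1)[OF N \<tau>])
  have gP[measurable]: "g \<in> borel_measurable P" by (rule measurable_from_subalg[OF subalgebra_pre_sigma[OF \<tau>] g])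
  have N\<tau>F[measurable]: "(\<lambda>\<omega>. N (\<tau> \<omega>) \<omega>) \<in> borel_measurable (pre_sigma \<tau>)" by (rule stopped_value_measurable[OF N(2) \<tau>])
  have eq: "AE \<omega> in P. ennreal (N (\<tau> \<omega>) \<omega>) = nn_cond_exp P (pre_sigma \<tau>) (\<lambda>\<omega>. ennreal (N T \<omega>)) \<omega>"
  proof (rule sub.nn_cond_exp_charact)
    fix B assume B: "B \<in> sets (pre_sigma \<tau>)"
    have BP: "B \<in> sets P" by (rule pre_sigma_sets_subset[OF \<tau> B])
    have e: "(\<integral>\<^sup>+\<omega>\<in>B. ennreal (f \<omega>) \<partial>P) = ennreal (\<integral>\<omega>. indicator B \<omega> * f \<omega> \<partial>P)"
      if "integrable P f" "\<And>\<omega>. 0 \<le> f \<omega>" for f :: "'a \<Rightarrow> real"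
    proof -
      have "(\<integral>\<^sup>+\<omega>\<in>B. ennreal (f \<omega>) \<partial>P) = (\<integral>\<^sup>+\<omega>. ennreal (indicator B \<omega> * f \<omega>) \<partial>P)"
        by (intro nn_integral_cong) (auto simp: indicator_def)
      also have "\<dots> = ennreal (\<integral>\<omega>. indicator B \<omega> * f \<omega> \<partial>P)"
        using that BP by (intro nn_integral_eq_integral integrable_indicator_mult) auto
      finally show ?thesis .
    qed
    show "(\<integral>\<^sup>+\<omega>\<in>B. ennreal (N T \<omega>) \<partial>P) = (\<integral>\<^sup>+\<omega>\<in>B. ennreal (N (\<tau> \<omega>) \<omega>) \<partial>P)"
      using e[OF NT] e[OF N\<tau>] pos optional_stopping_set[OF N \<tau> B] by simp
  qed (use NT in auto)
  have "(\<integral>\<^sup>+\<omega>. g \<omega> * ennreal (N T \<omega>) \<partial>P) = (\<integral>\<^sup>+\<omega>. g \<omega> * nn_cond_exp P (pre_sigma \<tau>) (\<lambda>\<omega>. ennreal (N T \<omega>)) \<omega> \<partial>P)"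
    using g NT by (intro sub.nn_cond_exp_intg[symmetric]) auto
  also have "\<dots> = (\<integral>\<^sup>+\<omega>. g \<omega> * ennreal (N (\<tau> \<omega>) \<omega>) \<partial>P)"
    using eq by (intro nn_integral_cong_AE) auto
  finally show ?thesis .
qed

text \<open>Strict positivity of Z makes every null set of the new measure a null set of P, so
  completeness is inherited; the other conditions concern the sigma-algebras alone.\<close>

lemma density_usual_filtration:
  fixes Z :: "'a \<Rightarrow> real"
  assumes Z: "integrable P Z" "\<And>\<omega>. 0 < Z \<omega>" "(\<integral>\<omega>. Z \<omega> \<partial>P) = 1"
  shows "usual_filtration (density P (\<lambda>\<omega>. ennreal (Z \<omega>))) F T"
proof -
  let ?Q = "density P (\<lambda>\<omega>. ennreal (Z \<omega>))"
  have [measurable]: "Z \<in> borel_measurable P" using Z by auto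
  have "(\<integral>\<^sup>+\<omega>. ennreal (Z \<omega>) \<partial>P) = 1"
    using Z by (subst nn_integral_eq_integral) (auto intro: less_imp_le)
  then have "emeasure ?Q (space ?Q) = 1" by (simp add: emeasure_density cong: nn_integral_cong)
  then have "prob_space ?Q" by (rule prob_spaceI)
  moreover have "filtration (space ?Q) F" using filtration_axioms by simp
  moreover have "usual_filtration_axioms ?Q F T"
  proof
    show "0 < T" by (rule horizon_pos)
    show "subalgebra ?Q (F t)" if "t \<in> {0..T}" for t
      using subalgebra_F[OF that] by (simp add: subalgebra_def)
    show "sets (F t) = (\<Inter>s\<in>{t<..T}. sets (F s))" if "t \<in> {0..<T}" for t
      by (rule right_continuous[OF that])
    fix N B assume N: "N \<in> null_sets ?Q" and B: "B \<subseteq> N"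
    have "N \<in> sets P" and ae: "AE \<omega> in P. \<omega> \<in> N \<longrightarrow> ennreal (Z \<omega>) = 0"
      using N by (auto simp: null_sets_density_iff)
    moreover have "AE \<omega> in P. \<omega> \<notin> N"
      using ae by eventually_elim (metis Z(2) ennreal_eq_0_iff not_le)
    ultimately have "N \<in> null_sets P" by (simp add: AE_iff_null_sets)
    then show "B \<in> sets (F 0)" using B by (rule complete)
  qed
  ultimately show ?thesis by (intro usual_filtration.intro)
qed

section \<open>Girsanov's theorem and the reverse Hoelder step\<close>

text \<open>The localizing times are the hitting times of |M| + A: up to them M and A are bounded by
  k, hence so is N. Under the new measure the expectation of N at a stopping time s is the
  P-expectation of N_s Z_T, and so of N_s Z_s by optional stopping. This is 0 by
  \<open>zero\<close>, and the converse of optional stopping under the new measure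
  concludes.\<close>

lemma continuous_local_martingale_density:
  assumes cp: "characteristic_pair M A" and mart: "martingale P F T (stoch_exp M A)"
    and \<phi>: "continuous_on UNIV (\<lambda>z. \<phi> (fst z) (snd z))" "\<phi> 0 0 = 0"
    and zero: "\<And>\<sigma> k. \<sigma> \<in> ST \<Longrightarrow>
      (\<And>\<omega> s. \<omega> \<in> space P \<Longrightarrow> 0 \<le> s \<Longrightarrow> s \<le> \<sigma> \<omega> \<Longrightarrow> \<bar>M s \<omega>\<bar> \<le> real k \<and> A s \<omega> \<le> real k) \<Longrightarrow>
      (\<integral>\<omega>. exp (M (\<sigma> \<omega>) \<omega> - A (\<sigma> \<omega>) \<omega> / 2) * \<phi> (M (\<sigma> \<omega>) \<omega>) (A (\<sigma> \<omega>) \<omega>) \<partial>P) = 0"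
    and uf: "usual_filtration (density P (\<lambda>\<omega>. ennreal (stoch_exp M A T \<omega>))) F T"
  shows "continuous_local_martingale (density P (\<lambda>\<omega>. ennreal (stoch_exp M A T \<omega>))) F T (\<lambda>t \<omega>. \<phi> (M t \<omega>) (A t \<omega>))"
proof -
  let ?Q = "density P (\<lambda>\<omega>. ennreal (stoch_exp M A T \<omega>))"
  let ?N = "\<lambda>t \<omega>. \<phi> (M t \<omega>) (A t \<omega>)"
  interpret Q: usual_filtration ?Q F T by (rule uf)
  have M: "regular M" and A: "regular A" and init: "\<And>\<omega>. \<omega> \<in> space P \<Longrightarrow> M 0 \<omega> = 0 \<and> A 0 \<omega> = 0"
    and Amono: "\<And>\<omega>. \<omega> \<in> space P \<Longrightarrow> mono_on {0..T} (\<lambda>t. A t \<omega>)"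
    using cp by (auto simp: characteristic_pair_def)
  have regN: "regular ?N" by (rule regular_comp2[OF M A \<phi>(1)])
  have regZ: "regular (stoch_exp M A)"
    unfolding stoch_exp_def[abs_def] by (rule regular_comp2[OF M A]) (auto intro!: continuous_intros)
  have [measurable]: "stoch_exp M A T \<in> borel_measurable P"
    using stopped_value_measurable_P[OF regZ ST_const[of T]] horizon_pos by simp
  define h where "h k = hitting_time (\<lambda>t \<omega>. \<bar>M t \<omega>\<bar> + A t \<omega>) (real k)" for k
  have regS: "regular (\<lambda>t \<omega>. \<bar>M t \<omega>\<bar> + A t \<omega>)" by (intro regular_add regular_abs M A)
  have h: "h k \<in> ST" for k unfolding h_def by (rule hitting_time_ST[OF regS])
  have loc: "localizing_sequence ?Q F T h"
    unfolding localizing_sequence_def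
  proof (intro conjI allI)
    show "h n \<in> stopping_times (space ?Q) F T" for n using h by simp
    show "AE \<omega> in ?Q. incseq (\<lambda>n. h n \<omega>)"
      by (intro AE_I2) (auto simp: incseq_def h_def intro!: hitting_time_mono)
    show "AE \<omega> in ?Q. \<forall>\<^sub>F n in sequentially. h n \<omega> = T"
      unfolding h_def by (intro AE_I2 hitting_time_eventually[OF regS]) simp
  qed
  have "martingale ?Q F T (\<lambda>t \<omega>. ?N (min t (h k \<omega>)) \<omega> - ?N 0 \<omega>)" for k
  proof -
    have "martingale ?Q F T (\<lambda>t \<omega>. ?N (min t (h k \<omega>)) \<omega>)"
    proof (rule Q.martingaleI_stopping_times[where c=0])
      show "adapted F T (\<lambda>t \<omega>. ?N (min t (h k \<omega>)) \<omega>)"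
        using regular_stopped[OF regN h] by (simp add: regular_def)
      obtain C where C: "\<And>m a. \<bar>m\<bar> \<le> real k \<Longrightarrow> 0 \<le> a \<Longrightarrow> a \<le> real k \<Longrightarrow> \<bar>\<phi> m a\<bar> \<le> C"
        by (rule continuous_bounded_on_box[OF \<phi>(1)]) (rule that; assumption)
      fix \<sigma> assume "\<sigma> \<in> stopping_times (space ?Q) F T"
      then have \<sigma>: "\<sigma> \<in> ST" by simp
      let ?s = "\<lambda>\<omega>. min (\<sigma> \<omega>) (h k \<omega>)"
      have s: "?s \<in> ST" by (intro ST_min \<sigma> h)
      have Apos: "0 \<le> A u \<omega>" if "\<omega> \<in> space P" "0 \<le> u" "u \<le> T" for u \<omega>
        using mono_onD[OF Amono[OF that(1)], of 0 u] init[OF that(1)] that by auto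
      have bound: "\<bar>M u \<omega>\<bar> \<le> real k \<and> A u \<omega> \<le> real k" if \<omega>: "\<omega> \<in> space P" and u: "0 \<le> u" "u \<le> ?s \<omega>" for u \<omega>
      proof -
        have "\<bar>M u \<omega>\<bar> + A u \<omega> \<le> real k"
        proof (rule le_hitting_time[OF regS \<omega> _ u(1)])
          show "\<bar>M 0 \<omega>\<bar> + A 0 \<omega> \<le> real k" using init[OF \<omega>] by simp
          show "u \<le> hitting_time (\<lambda>t \<omega>. \<bar>M t \<omega>\<bar> + A t \<omega>) (real k) \<omega>" using u(2) by (simp add: h_def)
        qed
        moreover have "0 \<le> A u \<omega>" using Apos[OF \<omega> u(1)] u(2) ST_range[OF s \<omega>] by simp
        ultimately show ?thesis by linarith
      qed
      have NC: "\<bar>?N (?s \<omega>) \<omega>\<bar> \<le> C" if \<omega>: "\<omega> \<in> space P" for \<omega>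
        using bound[OF \<omega>, of "?s \<omega>"] Apos[OF \<omega>, of "?s \<omega>"] ST_range[OF s \<omega>] by (intro C) auto
      have [measurable]: "(\<lambda>\<omega>. ?N (?s \<omega>) \<omega>) \<in> borel_measurable P" by (rule stopped_value_measurable_P[OF regN s])
      show "integrable ?Q (\<lambda>\<omega>. ?N (?s \<omega>) \<omega>)"
        using NC by (intro Q.integrable_bounded[where C=C]) auto
      have "(\<integral>\<omega>. ?N (?s \<omega>) \<omega> \<partial>?Q) = (\<integral>\<omega>. ?N (?s \<omega>) \<omega> * stoch_exp M A T \<omega> \<partial>P)"
        by (subst integral_density) (auto simp: stoch_exp_def mult.commute)
      also have "\<dots> = (\<integral>\<omega>. ?N (?s \<omega>) \<omega> * stoch_exp M A (?s \<omega>) \<omega> \<partial>P)"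
        by (rule optional_stopping_bounded[OF mart regZ s stopped_value_measurable[OF regN s] NC])
      also have "\<dots> = (\<integral>\<omega>. exp (M (?s \<omega>) \<omega> - A (?s \<omega>) \<omega> / 2) * ?N (?s \<omega>) \<omega> \<partial>P)"
        by (simp add: stoch_exp_def mult.commute)
      also have "\<dots> = 0" by (rule zero[OF s bound])
      finally show "(\<integral>\<omega>. ?N (?s \<omega>) \<omega> \<partial>?Q) = 0" .
    qed
    then show ?thesis
      by (rule Q.martingale_AE_cong) (auto intro!: AE_I2 simp: init \<phi>(2))
  qed
  moreover have "continuous_paths ?Q T ?N"
    unfolding continuous_paths_def by (intro AE_I2 regular_cont[OF regN]) simp
  ultimately show ?thesis
    using loc regN unfolding continuous_local_martingale_def regular_def by blast
qed

text \<open>A - M and (A - M)^2 - A are functions of the pair (M, A) whose products with the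
  exponential have drift-free expansions. The Dynkin formula thus gives the vanishing expectations
  required by the density lemma in both cases.\<close>

theorem girsanov:
  assumes cp: "characteristic_pair M A" and mart: "martingale P F T (stoch_exp M A)"
  shows "usual_filtration (density P (\<lambda>\<omega>. ennreal (stoch_exp M A T \<omega>))) F T"
    and "is_square_characteristic (density P (\<lambda>\<omega>. ennreal (stoch_exp M A T \<omega>))) F T (\<lambda>t \<omega>. A t \<omega> - M t \<omega>) A"
proof -
  let ?Q = "density P (\<lambda>\<omega>. ennreal (stoch_exp M A T \<omega>))"
  have M: "regular M" and A: "regular A" and init: "\<And>\<omega>. \<omega> \<in> space P \<Longrightarrow> M 0 \<omega> = 0 \<and> A 0 \<omega> = 0"
    and Amono: "\<And>\<omega>. \<omega> \<in> space P \<Longrightarrow> mono_on {0..T} (\<lambda>t. A t \<omega>)"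
    using cp by (auto simp: characteristic_pair_def)
  have regZ: "regular (stoch_exp M A)"
    unfolding stoch_exp_def[abs_def] by (rule regular_comp2[OF M A]) (auto intro!: continuous_intros)
  show uf: "usual_filtration ?Q F T"
  proof (rule density_usual_filtration)
    show "integrable P (stoch_exp M A T)" using mart horizon_pos by (auto simp: martingale_def)
    have "(\<integral>\<omega>. stoch_exp M A T \<omega> \<partial>P) = (\<integral>\<omega>. stoch_exp M A 0 \<omega> \<partial>P)"
      using optional_stopping(2)[OF mart regZ ST_const[of 0]] horizon_pos by simp
    also have "\<dots> = (\<integral>\<omega>. 1 \<partial>P)" by (rule Bochner_Integration.integral_cong) (simp_all add: stoch_exp_def init)
    finally show "(\<integral>\<omega>. stoch_exp M A T \<omega> \<partial>P) = 1" by (simp add: prob_space)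
  qed (simp add: stoch_exp_def)
  have 1: "continuous_local_martingale ?Q F T (\<lambda>t \<omega>. A t \<omega> - M t \<omega>)"
  proof (rule continuous_local_martingale_density[OF cp mart _ _ _ uf, of "\<lambda>m a. a - m"])
    fix \<sigma> k assume \<sigma>: "\<sigma> \<in> ST"
      and bound: "\<And>\<omega> s. \<omega> \<in> space P \<Longrightarrow> 0 \<le> s \<Longrightarrow> s \<le> \<sigma> \<omega> \<Longrightarrow> \<bar>M s \<omega>\<bar> \<le> real k \<and> A s \<omega> \<le> real k"
    obtain K where K: "0 \<le> K" "\<And>\<epsilon> m a x b. 0 < \<epsilon> \<Longrightarrow> \<epsilon> \<le> 1 \<Longrightarrow> \<bar>m\<bar> \<le> real k \<Longrightarrow> 0 \<le> a \<Longrightarrow> a \<le> real k \<Longrightarrow> \<bar>x\<bar> \<le> \<epsilon> \<Longrightarrow> 0 \<le> b \<Longrightarrow> b \<le> \<epsilon> \<Longrightarrow>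
      \<bar>exp ((m + x) - (a + b) / 2) * ((a + b) - (m + x)) - exp (m - a / 2) * (a - m)
        - (exp (m - a / 2) * (a - m - 1)) * x - (exp (m - a / 2) * ((a - m) / 2 - 1)) * (x\<^sup>2 - b)\<bar> \<le> K * \<epsilon> * (x\<^sup>2 + b)"
      by (rule girsanov_first_order[OF of_nat_0_le_iff[of k]]) (rule that; assumption)
    show "(\<integral>\<omega>. exp (M (\<sigma> \<omega>) \<omega> - A (\<sigma> \<omega>) \<omega> / 2) * (A (\<sigma> \<omega>) \<omega> - M (\<sigma> \<omega>) \<omega>) \<partial>P) = 0"
      using dynkin_formula[OF cp \<sigma> bound, where f="\<lambda>m a. exp (m - a / 2) * (a - m)"
          and ?g1.0="\<lambda>m a. exp (m - a / 2) * (a - m - 1)" and ?g2.0="\<lambda>m a. exp (m - a / 2) * ((a - m) / 2 - 1)" and K=K]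
        K by (simp add: continuous_intros)
  qed (auto intro!: continuous_intros)
  have 2: "continuous_local_martingale ?Q F T (\<lambda>t \<omega>. (A t \<omega> - M t \<omega>)\<^sup>2 - A t \<omega>)"
  proof (rule continuous_local_martingale_density[OF cp mart _ _ _ uf, of "\<lambda>m a. (a - m)\<^sup>2 - a"])
    fix \<sigma> k assume \<sigma>: "\<sigma> \<in> ST"
      and bound: "\<And>\<omega> s. \<omega> \<in> space P \<Longrightarrow> 0 \<le> s \<Longrightarrow> s \<le> \<sigma> \<omega> \<Longrightarrow> \<bar>M s \<omega>\<bar> \<le> real k \<and> A s \<omega> \<le> real k"
    obtain K where K: "0 \<le> K" "\<And>\<epsilon> m a x b. 0 < \<epsilon> \<Longrightarrow> \<epsilon> \<le> 1 \<Longrightarrow> \<bar>m\<bar> \<le> real k \<Longrightarrow> 0 \<le> a \<Longrightarrow> a \<le> real k \<Longrightarrow> \<bar>x\<bar> \<le> \<epsilon> \<Longrightarrow> 0 \<le> b \<Longrightarrow> b \<le> \<epsilon> \<Longrightarrow>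
      \<bar>exp ((m + x) - (a + b) / 2) * (((a + b) - (m + x))\<^sup>2 - (a + b)) - exp (m - a / 2) * ((a - m)\<^sup>2 - a)
        - (exp (m - a / 2) * ((a - m)\<^sup>2 - a - 2 * (a - m))) * x
        - (exp (m - a / 2) * (((a - m)\<^sup>2 - a) / 2 - 2 * (a - m) + 1)) * (x\<^sup>2 - b)\<bar> \<le> K * \<epsilon> * (x\<^sup>2 + b)"
      by (rule girsanov_second_order[OF of_nat_0_le_iff[of k]]) (rule that; assumption)
    show "(\<integral>\<omega>. exp (M (\<sigma> \<omega>) \<omega> - A (\<sigma> \<omega>) \<omega> / 2) * ((A (\<sigma> \<omega>) \<omega> - M (\<sigma> \<omega>) \<omega>)\<^sup>2 - A (\<sigma> \<omega>) \<omega>) \<partial>P) = 0"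
      using dynkin_formula[OF cp \<sigma> bound, where f="\<lambda>m a. exp (m - a / 2) * ((a - m)\<^sup>2 - a)"
          and ?g1.0="\<lambda>m a. exp (m - a / 2) * ((a - m)\<^sup>2 - a - 2 * (a - m))"
          and ?g2.0="\<lambda>m a. exp (m - a / 2) * (((a - m)\<^sup>2 - a) / 2 - 2 * (a - m) + 1)" and K=K]
        K by (simp add: continuous_intros)
  qed (auto intro!: continuous_intros)
  show "is_square_characteristic ?Q F T (\<lambda>t \<omega>. A t \<omega> - M t \<omega>) A"
    unfolding is_square_characteristic_def
  proof (intro conjI 1 2)
    show "adapted F T A" using A by (simp add: regular_def)
    show "continuous_paths ?Q T A" unfolding continuous_paths_def by (intro AE_I2 regular_cont[OF A]) simp
    show "AE \<omega> in ?Q. A 0 \<omega> = 0" using init by (intro AE_I2) simp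
    show "AE \<omega> in ?Q. mono_on {0..T} (\<lambda>t. A t \<omega>)" by (intro AE_I2 Amono) simp
  qed
qed

text \<open>One summand of the telescoping sum. X and X' are arbitrary variables with values in
  [1, C], measurable at the two ends of the step and linked by \<open>tower\<close>, so every
  property of the conditional p-th moments that enters is visible in the hypotheses.\<close>

lemma reverse_hoelder_step:
  assumes cp: "characteristic_pair M A" and \<epsilon>: "0 < \<epsilon>" "\<epsilon> \<le> 1"
    and \<sigma>: "\<sigma> \<in> ST" and \<tau>: "\<tau> \<in> ST" and le: "\<And>\<omega>. \<omega> \<in> space P \<Longrightarrow> \<sigma> \<omega> \<le> \<tau> \<omega>"
    and incM: "\<And>\<omega> t. \<omega> \<in> space P \<Longrightarrow> t \<in> {0..T} \<Longrightarrow> \<bar>M (min (\<tau> \<omega>) t) \<omega> - M (min (\<sigma> \<omega>) t) \<omega>\<bar> \<le> \<epsilon>"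
    and incA: "\<And>\<omega> t. \<omega> \<in> space P \<Longrightarrow> t \<in> {0..T} \<Longrightarrow> \<bar>A (min (\<tau> \<omega>) t) \<omega> - A (min (\<sigma> \<omega>) t) \<omega>\<bar> \<le> \<epsilon>"
    and p: "1 < p" and \<beta>: "0 < \<beta>" "p \<le> \<beta> * (p - 1)"
    and K: "0 \<le> K" "\<And>X x b. 1 \<le> X \<Longrightarrow> X \<le> C \<Longrightarrow> \<bar>x\<bar> \<le> \<epsilon> \<Longrightarrow> 0 \<le> b \<Longrightarrow> b \<le> \<epsilon> \<Longrightarrow>
      \<beta> * p * X * x + (\<beta> * X * p\<^sup>2 - p\<^sup>2) / 2 * (x\<^sup>2 - b) + b * ((\<beta> * X * (p\<^sup>2 - p) - p\<^sup>2) / 2) - K * \<epsilon> * (x\<^sup>2 + b)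
      \<le> exp (p * (x - b / 2)) - exp (p * (x - b / 2)) * (p * (x - b / 2)) + \<beta> * X * (exp (p * (x - b / 2)) - 1) - 1"
    and small: "2 * K * \<epsilon> \<le> p * (\<beta> * (p - 1) - p) / 2"
    and X: "X \<in> borel_measurable (pre_sigma \<sigma>)" "\<And>\<omega>. \<omega> \<in> space P \<Longrightarrow> 1 \<le> X \<omega> \<and> X \<omega> \<le> C"
    and X': "X' \<in> borel_measurable (pre_sigma \<tau>)" "\<And>\<omega>. \<omega> \<in> space P \<Longrightarrow> 1 \<le> X' \<omega> \<and> X' \<omega> \<le> C"
    and tower: "\<And>H c. H \<in> borel_measurable (pre_sigma \<sigma>) \<Longrightarrow> (\<And>\<omega>. \<omega> \<in> space P \<Longrightarrow> \<bar>H \<omega>\<bar> \<le> c) \<Longrightarrow>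
      (\<integral>\<omega>. H \<omega> * exp (p * (M (\<tau> \<omega>) \<omega> - M (\<sigma> \<omega>) \<omega> - (A (\<tau> \<omega>) \<omega> - A (\<sigma> \<omega>) \<omega>) / 2)) * X' \<omega> \<partial>P) = (\<integral>\<omega>. H \<omega> * X \<omega> \<partial>P)"
    and B: "B \<in> sets (pre_sigma \<sigma>)"
  shows "(p * (\<beta> * (p - 1) - p) / 2 - 2 * K * \<epsilon>) * exp (- \<beta> * C) * (\<integral>\<omega>. indicator B \<omega> * (A (\<tau> \<omega>) \<omega> - A (\<sigma> \<omega>) \<omega>) \<partial>P)
    \<le> (\<integral>\<omega>. indicator B \<omega> * exp (- \<beta> * X' \<omega>) \<partial>P) - (\<integral>\<omega>. indicator B \<omega> * exp (- \<beta> * X \<omega>) \<partial>P)"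
proof -
  have M: "regular M" "centered_local M" and A: "regular A" "centered_local (\<lambda>t \<omega>. (M t \<omega>)\<^sup>2 - A t \<omega>)"
    and Amono: "\<And>\<omega>. \<omega> \<in> space P \<Longrightarrow> mono_on {0..T} (\<lambda>t. A t \<omega>)"
    using cp by (auto simp: characteristic_pair_def)
  define c0 where "c0 = p * (\<beta> * (p - 1) - p) / 2"
  define x where "x \<omega> = M (\<tau> \<omega>) \<omega> - M (\<sigma> \<omega>) \<omega>" for \<omega>
  define b where "b \<omega> = A (\<tau> \<omega>) \<omega> - A (\<sigma> \<omega>) \<omega>" for \<omega>
  define z where "z \<omega> = p * (x \<omega> - b \<omega> / 2)" for \<omega>
  define H where "H \<omega> = indicator B \<omega> * exp (- \<beta> * X \<omega>)" for \<omega>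
  have BP[measurable]: "B \<in> sets P" by (rule pre_sigma_sets_subset[OF \<sigma> B])
  note fromP = measurable_from_subalg[OF subalgebra_pre_sigma[OF \<sigma>]]
  note [measurable] = fromP[OF X(1)] measurable_from_subalg[OF subalgebra_pre_sigma[OF \<tau>] X'(1)]
  have [measurable]: "x \<in> borel_measurable P" "b \<in> borel_measurable P" unfolding x_def b_def
    by (intro borel_measurable_diff stopped_value_measurable_P M A \<sigma> \<tau>)+
  have Hm: "H \<in> borel_measurable (pre_sigma \<sigma>)" unfolding H_def using X(1) B by measurable
  note [measurable] = fromP[OF Hm]
  have zm[measurable]: "z \<in> borel_measurable P" unfolding z_def by measurable
  have C1: "1 \<le> C" using X(2) not_empty by fastforce
  have H01: "0 \<le> H \<omega>" "H \<omega> \<le> 1" and Habs: "\<bar>H \<omega>\<bar> \<le> 1" if "\<omega> \<in> space P" for \<omega>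
    using X(2)[OF that] \<beta>(1) by (auto simp: H_def indicator_def)
  have xb: "\<bar>x \<omega>\<bar> \<le> \<epsilon>" "0 \<le> b \<omega>" "b \<omega> \<le> \<epsilon>" if \<omega>: "\<omega> \<in> space P" for \<omega>
  proof -
    have "min (\<tau> \<omega>) T = \<tau> \<omega>" "min (\<sigma> \<omega>) T = \<sigma> \<omega>" using ST_range[OF \<sigma> \<omega>] ST_range[OF \<tau> \<omega>] by (auto simp: min_def)
    then show "\<bar>x \<omega>\<bar> \<le> \<epsilon>" "b \<omega> \<le> \<epsilon>" using incM[OF \<omega>, of T] incA[OF \<omega>, of T] horizon_pos by (auto simp: x_def b_def)
    show "0 \<le> b \<omega>" using mono_onD[OF Amono[OF \<omega>], of "\<sigma> \<omega>" "\<tau> \<omega>"] ST_range[OF \<sigma> \<omega>] ST_range[OF \<tau> \<omega>] le[OF \<omega>]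
      by (auto simp: b_def)
  qed
  have x2: "(x \<omega>)\<^sup>2 \<le> 1" if "\<omega> \<in> space P" for \<omega>
    using xb(1)[OF that] \<epsilon> abs_le_square_iff[of "x \<omega>" 1] by simp
  have zb: "\<bar>z \<omega>\<bar> \<le> p * 2" if "\<omega> \<in> space P" for \<omega>
    unfolding z_def abs_mult using xb[OF that] \<epsilon> p by (intro mult_mono) auto
  have ez: "\<bar>exp (z \<omega>)\<bar> \<le> exp (p * 2)" if "\<omega> \<in> space P" for \<omega>
    using zb[OF that] by auto
  have HX: "\<bar>H \<omega> * X \<omega>\<bar> \<le> 1 * C" if "\<omega> \<in> space P" for \<omega>
    unfolding abs_mult using Habs[OF that] X(2)[OF that] by (intro mult_mono) auto
  have HXm: "(\<lambda>\<omega>. H \<omega> * X \<omega>) \<in> borel_measurable (pre_sigma \<sigma>)" using Hm X(1) by measurable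
  have iH: "integrable P H" by (rule integrable_bounded[OF _ Habs]) measurable
  have iHX: "integrable P (\<lambda>\<omega>. H \<omega> * X \<omega>)" by (rule integrable_bounded[OF _ HX]) measurable
  have ix: "integrable P x" by (rule integrable_bounded[OF _ xb(1)]) measurable
  have ib: "integrable P b" using xb by (intro integrable_bounded[where C=\<epsilon>]) auto
  have ix2: "integrable P (\<lambda>\<omega>. (x \<omega>)\<^sup>2)" using x2 by (intro integrable_bounded[where C=1]) auto
  have iHb: "integrable P (\<lambda>\<omega>. H \<omega> * b \<omega>)" by (intro integrable_mult_bounded[OF _ Habs] ib) measurable
  have iHx2: "integrable P (\<lambda>\<omega>. H \<omega> * (x \<omega>)\<^sup>2)" by (intro integrable_mult_bounded[OF _ Habs] ix2) measurable
  have e1: "(\<integral>\<omega>. (H \<omega> * X \<omega>) * x \<omega> \<partial>P) = 0"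
    unfolding x_def
  proof (rule centered_local_increment[OF M(2,1) \<sigma> \<tau> le HXm HX])
    fix \<omega> t assume "\<omega> \<in> space P" "t \<in> {0..T}"
    then show "\<bar>H \<omega> * X \<omega> * (M (min (\<tau> \<omega>) t) \<omega> - M (min (\<sigma> \<omega>) t) \<omega>)\<bar> \<le> (1 * C) * \<epsilon>"
      unfolding abs_mult[of "H \<omega> * X \<omega>"] using C1 by (intro mult_mono HX incM) auto
  qed
  have e2: "(\<integral>\<omega>. (H \<omega> * X \<omega>) * ((x \<omega>)\<^sup>2 - b \<omega>) \<partial>P) = 0"
    unfolding x_def b_def by (rule centered_square_increment[OF M(2,1) A(2,1) \<sigma> \<tau> le HXm HX incM incA])
  have e3: "(\<integral>\<omega>. H \<omega> * ((x \<omega>)\<^sup>2 - b \<omega>) \<partial>P) = 0"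
    unfolding x_def b_def by (rule centered_square_increment[OF M(2,1) A(2,1) \<sigma> \<tau> le Hm Habs incM incA])
  have i1: "integrable P (\<lambda>\<omega>. (H \<omega> * X \<omega>) * x \<omega>)" by (intro integrable_mult_bounded[OF _ HX] ix) measurable
  have i2: "integrable P (\<lambda>\<omega>. (H \<omega> * X \<omega>) * ((x \<omega>)\<^sup>2 - b \<omega>))"
    by (intro integrable_mult_bounded[OF _ HX] Bochner_Integration.integrable_diff ix2 ib) measurable
  have i3: "integrable P (\<lambda>\<omega>. H \<omega> * ((x \<omega>)\<^sup>2 - b \<omega>))"
    by (intro integrable_mult_bounded[OF _ Habs] Bochner_Integration.integrable_diff ix2 ib) measurable
  have iez: "integrable P (\<lambda>\<omega>. exp (z \<omega>))" by (rule integrable_bounded[OF _ ez]) measurable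
  have iX': "integrable P X'" using X'(2) C1 by (intro integrable_bounded[where C=C]) fastforce+
  have iezX': "integrable P (\<lambda>\<omega>. exp (z \<omega>) * X' \<omega>)" by (intro integrable_mult_bounded[OF _ ez] iX') measurable
  have iHezX': "integrable P (\<lambda>\<omega>. H \<omega> * (exp (z \<omega>) * X' \<omega>))" by (intro integrable_mult_bounded[OF _ Habs] iezX') measurable
  let ?\<phi> = "\<lambda>\<omega>. exp (z \<omega>) - exp (z \<omega>) * z \<omega> + \<beta> * X \<omega> * (exp (z \<omega>) - 1) - 1"
  have i\<phi>0: "integrable P (\<lambda>\<omega>. exp (z \<omega>) * z \<omega>)"
    by (intro integrable_mult_bounded[OF _ ez] integrable_bounded[OF _ zb]) measurable
  have iX: "integrable P X" using X(2) C1 by (intro integrable_bounded[where C=C]) fastforce+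
  have i\<phi>1: "integrable P (\<lambda>\<omega>. (exp (z \<omega>) - 1) * X \<omega>)"
  proof (intro integrable_mult_bounded[OF _ _ iX])
    show "\<bar>exp (z \<omega>) - 1\<bar> \<le> exp (p * 2) + 1" if "\<omega> \<in> space P" for \<omega>
      using ez[OF that] abs_triangle_ineq4[of "exp (z \<omega>)" 1] by linarith
  qed measurable
  have i\<phi>: "integrable P ?\<phi>"
    using Bochner_Integration.integrable_diff[OF Bochner_Integration.integrable_add[OF Bochner_Integration.integrable_diff[OF iez i\<phi>0]
      Bochner_Integration.integrable_mult_right[OF i\<phi>1, of \<beta>]], of "\<lambda>_. 1"] by (simp add: mult_ac)
  have iH\<phi>: "integrable P (\<lambda>\<omega>. H \<omega> * ?\<phi> \<omega>)" by (intro integrable_mult_bounded[OF _ Habs] i\<phi>) measurable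
  have lower: "(c0 - 2 * K * \<epsilon>) * (\<integral>\<omega>. H \<omega> * b \<omega> \<partial>P) \<le> (\<integral>\<omega>. H \<omega> * ?\<phi> \<omega> \<partial>P)"
  proof -
    let ?L = "\<lambda>\<omega>. (\<beta> * p) * ((H \<omega> * X \<omega>) * x \<omega>) + (\<beta> * p\<^sup>2 / 2) * ((H \<omega> * X \<omega>) * ((x \<omega>)\<^sup>2 - b \<omega>))
      - (p\<^sup>2 / 2) * (H \<omega> * ((x \<omega>)\<^sup>2 - b \<omega>)) + c0 * (H \<omega> * b \<omega>) - (K * \<epsilon>) * (H \<omega> * (x \<omega>)\<^sup>2 + H \<omega> * b \<omega>)"
    \<comment> \<open>Hence the error weight x^2 + b integrates to twice the integral of b against
      H, which is the source of 2 K \<epsilon>.\<close>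
    have x2b: "(\<integral>\<omega>. H \<omega> * (x \<omega>)\<^sup>2 \<partial>P) = (\<integral>\<omega>. H \<omega> * b \<omega> \<partial>P)"
      using e3 Bochner_Integration.integral_diff[OF iHx2 iHb] by (simp add: right_diff_distrib)
    have "(\<integral>\<omega>. ?L \<omega> \<partial>P) = (\<beta> * p) * (\<integral>\<omega>. (H \<omega> * X \<omega>) * x \<omega> \<partial>P) + (\<beta> * p\<^sup>2 / 2) * (\<integral>\<omega>. (H \<omega> * X \<omega>) * ((x \<omega>)\<^sup>2 - b \<omega>) \<partial>P)
      - (p\<^sup>2 / 2) * (\<integral>\<omega>. H \<omega> * ((x \<omega>)\<^sup>2 - b \<omega>) \<partial>P) + c0 * (\<integral>\<omega>. H \<omega> * b \<omega> \<partial>P) - (K * \<epsilon>) * ((\<integral>\<omega>. H \<omega> * (x \<omega>)\<^sup>2 \<partial>P) + (\<integral>\<omega>. H \<omega> * b \<omega> \<partial>P))"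
      using i1 i2 i3 iHb iHx2
      by (simp only: Bochner_Integration.integral_diff Bochner_Integration.integral_add integral_mult_right_zero
          Bochner_Integration.integrable_diff Bochner_Integration.integrable_add Bochner_Integration.integrable_mult_right)
    also have "\<dots> = (c0 - 2 * K * \<epsilon>) * (\<integral>\<omega>. H \<omega> * b \<omega> \<partial>P)"
      unfolding e1 e2 e3 x2b by (simp add: algebra_simps)
    finally have "(c0 - 2 * K * \<epsilon>) * (\<integral>\<omega>. H \<omega> * b \<omega> \<partial>P) = (\<integral>\<omega>. ?L \<omega> \<partial>P)" ..
    also have "\<dots> \<le> (\<integral>\<omega>. H \<omega> * ?\<phi> \<omega> \<partial>P)"
    proof (rule integral_mono)
      show "integrable P ?L" using i1 i2 i3 iHb iHx2
        by (intro Bochner_Integration.integrable_diff Bochner_Integration.integrable_add Bochner_Integration.integrable_mult_right)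
      show "integrable P (\<lambda>\<omega>. H \<omega> * ?\<phi> \<omega>)" by (rule iH\<phi>)
      fix \<omega> assume \<omega>: "\<omega> \<in> space P"
      have Xb: "1 \<le> X \<omega>" "X \<omega> \<le> C" using X(2)[OF \<omega>] by auto
      \<comment> \<open>The coefficient of b in the expansion increases with X, so its value at X =
        1, namely \<open>c0\<close>, is a lower bound.\<close>
      have "0 \<le> (X \<omega> - 1) * (\<beta> * (p\<^sup>2 - p))"
        using Xb(1) \<beta>(1) p by (intro mult_nonneg_nonneg) (auto simp: power2_eq_square)
      then have "c0 \<le> (\<beta> * X \<omega> * (p\<^sup>2 - p) - p\<^sup>2) / 2"
        by (simp add: c0_def power2_eq_square field_simps)
      then have "b \<omega> * c0 \<le> b \<omega> * ((\<beta> * X \<omega> * (p\<^sup>2 - p) - p\<^sup>2) / 2)"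
        using xb(2)[OF \<omega>] by (rule mult_left_mono)
      with K(2)[OF Xb xb[OF \<omega>]]
      have "\<beta> * p * X \<omega> * x \<omega> + (\<beta> * X \<omega> * p\<^sup>2 - p\<^sup>2) / 2 * ((x \<omega>)\<^sup>2 - b \<omega>) + b \<omega> * c0 - K * \<epsilon> * ((x \<omega>)\<^sup>2 + b \<omega>) \<le> ?\<phi> \<omega>"
        unfolding z_def by linarith
      then have "H \<omega> * (\<beta> * p * X \<omega> * x \<omega> + (\<beta> * X \<omega> * p\<^sup>2 - p\<^sup>2) / 2 * ((x \<omega>)\<^sup>2 - b \<omega>) + b \<omega> * c0 - K * \<epsilon> * ((x \<omega>)\<^sup>2 + b \<omega>)) \<le> H \<omega> * ?\<phi> \<omega>"
        using H01[OF \<omega>] by (intro mult_left_mono)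
      then show "?L \<omega> \<le> H \<omega> * ?\<phi> \<omega>" by (simp add: field_simps)
    qed
    finally show ?thesis .
  qed
  have "(c0 - 2 * K * \<epsilon>) * exp (- \<beta> * C) * (\<integral>\<omega>. indicator B \<omega> * b \<omega> \<partial>P) = (c0 - 2 * K * \<epsilon>) * (\<integral>\<omega>. exp (- \<beta> * C) * (indicator B \<omega> * b \<omega>) \<partial>P)"
    by simp
  also have "\<dots> \<le> (c0 - 2 * K * \<epsilon>) * (\<integral>\<omega>. H \<omega> * b \<omega> \<partial>P)"
  proof (intro mult_left_mono integral_mono)
    \<comment> \<open>Nonnegativity of this factor is the reason for the smallness condition on
      \<epsilon>: it allows H to be replaced by its lower bound exp (- \<beta> C) on B.\<close>
    show "0 \<le> c0 - 2 * K * \<epsilon>" using small by (simp add: c0_def)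
    show "integrable P (\<lambda>\<omega>. exp (- \<beta> * C) * (indicator B \<omega> * b \<omega>))"
      by (intro Bochner_Integration.integrable_mult_right integrable_indicator_mult BP ib)
    show "integrable P (\<lambda>\<omega>. H \<omega> * b \<omega>)" by (rule iHb)
    show "exp (- \<beta> * C) * (indicator B \<omega> * b \<omega>) \<le> H \<omega> * b \<omega>" if \<omega>: "\<omega> \<in> space P" for \<omega>
      using xb(2)[OF \<omega>] X(2)[OF \<omega>] \<beta>(1) by (auto simp: H_def indicator_def intro!: mult_right_mono)
  qed
  also have "\<dots> \<le> (\<integral>\<omega>. H \<omega> * ?\<phi> \<omega> \<partial>P)" by (rule lower)
  \<comment> \<open>The two added terms cancel in expectation by the tower property. Pointwise they
    turn the integrand into the left side of \<open>exp_tangent_bound\<close> minus H, which brings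
    X' in.\<close>
  also have "\<dots> = (\<integral>\<omega>. H \<omega> * ?\<phi> \<omega> - \<beta> * (H \<omega> * (exp (z \<omega>) * X' \<omega>)) + \<beta> * (H \<omega> * X \<omega>) \<partial>P)"
  proof -
    have "(\<integral>\<omega>. H \<omega> * (exp (z \<omega>) * X' \<omega>) \<partial>P) = (\<integral>\<omega>. H \<omega> * X \<omega> \<partial>P)"
      using tower[OF Hm Habs] by (simp add: z_def x_def b_def mult.assoc)
    then show ?thesis
      using iH\<phi> iHezX' iHX
      by (simp only: Bochner_Integration.integral_diff Bochner_Integration.integral_add integral_mult_right_zero
          Bochner_Integration.integrable_diff Bochner_Integration.integrable_add Bochner_Integration.integrable_mult_right)
  qed
  also have "\<dots> \<le> (\<integral>\<omega>. indicator B \<omega> * exp (- \<beta> * X' \<omega>) - H \<omega> \<partial>P)"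
  proof (rule integral_mono)
    show "integrable P (\<lambda>\<omega>. H \<omega> * ?\<phi> \<omega> - \<beta> * (H \<omega> * (exp (z \<omega>) * X' \<omega>)) + \<beta> * (H \<omega> * X \<omega>))"
      using iH\<phi> iHezX' iHX
      by (intro Bochner_Integration.integrable_diff Bochner_Integration.integrable_add Bochner_Integration.integrable_mult_right)
    have "integrable P (\<lambda>\<omega>. exp (- \<beta> * X' \<omega>))"
    proof (rule integrable_bounded[where C=1])
      fix \<omega> assume "\<omega> \<in> space P"
      then have "0 \<le> \<beta> * X' \<omega>" using X'(2)[of \<omega>] \<beta>(1) by simp
      then show "\<bar>exp (- \<beta> * X' \<omega>)\<bar> \<le> 1" by simp
    qed measurable
    then show "integrable P (\<lambda>\<omega>. indicator B \<omega> * exp (- \<beta> * X' \<omega>) - H \<omega>)"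
      by (intro Bochner_Integration.integrable_diff integrable_indicator_mult BP iH)
    fix \<omega> assume \<omega>: "\<omega> \<in> space P"
    have "indicator B \<omega> * (exp (- \<beta> * X \<omega>) * (exp (z \<omega>) - exp (z \<omega>) * z \<omega> - \<beta> * (X' \<omega> - X \<omega>) * exp (z \<omega>)))
        \<le> indicator B \<omega> * exp (- \<beta> * X' \<omega>)"
      by (intro mult_left_mono exp_tangent_bound) simp
    then show "H \<omega> * ?\<phi> \<omega> - \<beta> * (H \<omega> * (exp (z \<omega>) * X' \<omega>)) + \<beta> * (H \<omega> * X \<omega>) \<le> indicator B \<omega> * exp (- \<beta> * X' \<omega>) - H \<omega>"
      by (simp add: H_def algebra_simps)
  qed
  also have "\<dots> = (\<integral>\<omega>. indicator B \<omega> * exp (- \<beta> * X' \<omega>) \<partial>P) - (\<integral>\<omega>. indicator B \<omega> * exp (- \<beta> * X \<omega>) \<partial>P)"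
  proof -
    have "integrable P (\<lambda>\<omega>. indicator B \<omega> * exp (- \<beta> * X' \<omega>))"
    proof (rule integrable_bounded[where C=1])
      fix \<omega> assume "\<omega> \<in> space P"
      then have "0 \<le> \<beta> * X' \<omega>" using X'(2)[of \<omega>] \<beta>(1) by simp
      then show "\<bar>indicator B \<omega> * exp (- \<beta> * X' \<omega>)\<bar> \<le> 1" by (simp add: indicator_def)
    qed measurable
    then show ?thesis unfolding H_def[symmetric] by (rule Bochner_Integration.integral_diff[OF _ iH])
  qed
  finally show ?thesis unfolding c0_def b_def .
qed

section \<open>The reverse Hoelder bound\<close>

text \<open>The hypothesis \<open>norm\<close> says that the exponential from \<tau> to T has
  conditional expectation 1. It is the form in which the martingale property of the exponential
  enters, and it can be checked under either measure. The conclusion 1 \<le> C matters because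
  \<open>ennreal\<close> sends negative reals to 0; here it certifies that the stated constant is
  genuine.\<close>

lemma reverse_hoelder_characteristic_bound:
  assumes cp: "characteristic_pair M A" and p: "1 < p" and \<beta>: "p / (p - 1) < \<beta>"
    and norm: "\<And>\<tau> B. \<tau> \<in> ST \<Longrightarrow> B \<in> sets (pre_sigma \<tau>) \<Longrightarrow>
      (\<integral>\<^sup>+\<omega>. indicator B \<omega> * ennreal (stoch_exp_from M A \<tau> T \<omega>) \<partial>P) = emeasure P B"
    and R: "R_condition P F T M A p C"
  shows "1 \<le> C" and "\<And>\<tau>. \<tau> \<in> ST \<Longrightarrow> AE \<omega> in P. nn_cond_exp_at P F \<tau> (\<lambda>\<omega>. A T \<omega> - A (\<tau> \<omega>) \<omega>) \<omega>
      \<le> ennreal (2 * (exp (\<beta> * (C - 1)) - 1) / (p * (\<beta> * (p - 1) - p)))"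
proof -
  have M: "regular M" and A: "regular A" and Amono: "\<And>\<omega>. \<omega> \<in> space P \<Longrightarrow> mono_on {0..T} (\<lambda>t. A t \<omega>)"
    using cp by (auto simp: characteristic_pair_def)
  have [measurable]: "M T \<in> borel_measurable P" "A T \<in> borel_measurable P"
    using stopped_value_measurable_P[OF M ST_const[of T]] stopped_value_measurable_P[OF A ST_const[of T]] horizon_pos by simp_all
  define L where "L s \<omega> = M T \<omega> - M (s \<omega>) \<omega> - (A T \<omega> - A (s \<omega>) \<omega>) / 2" for s \<omega>
  define E where "E s \<omega> = exp (p * L s \<omega>)" for s \<omega>
  have from_exp: "stoch_exp_from M A s T \<omega> = exp (L s \<omega>)" for s \<omega>
    unfolding stoch_exp_from_def stoch_exp_def L_def exp_diff[symmetric]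
    by (rule arg_cong[where f=exp]) (simp add: field_simps)
  have from_powr: "stoch_exp_from M A s T \<omega> powr p = E s \<omega>" for s \<omega>
    unfolding from_exp E_def by (simp add: powr_def)
  have Lm[measurable]: "L s \<in> borel_measurable P" if "s \<in> ST" for s
    using stopped_value_measurable_P[OF M that] stopped_value_measurable_P[OF A that] unfolding L_def by measurable
  have Em[measurable]: "E s \<in> borel_measurable P" if "s \<in> ST" for s
    using Lm[OF that] unfolding E_def by measurable
  have Rs: "AE \<omega> in P. nn_cond_exp P (pre_sigma s) (\<lambda>\<omega>. ennreal (E s \<omega>)) \<omega> \<le> ennreal C" if "s \<in> ST" for s
    using R that by (auto simp: R_condition_def nn_cond_exp_at_def from_powr)
  have nnE: "(\<integral>\<^sup>+\<omega>. ennreal (E s \<omega>) \<partial>P) \<le> ennreal C" if s: "s \<in> ST" for s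
  proof -
    interpret sub: finite_measure_subalgebra P "pre_sigma s" by (rule pre_sigma_finite_measure_subalgebra[OF s])
    have "(\<integral>\<^sup>+\<omega>. ennreal (E s \<omega>) \<partial>P) = (\<integral>\<^sup>+\<omega>. 1 * nn_cond_exp P (pre_sigma s) (\<lambda>\<omega>. ennreal (E s \<omega>)) \<omega> \<partial>P)"
      using Em[OF s] by (subst sub.nn_cond_exp_intg) auto
    also have "\<dots> \<le> (\<integral>\<^sup>+\<omega>. ennreal C \<partial>P)" using Rs[OF s] by (intro nn_integral_mono_AE) auto
    also have "\<dots> = ennreal C" by (simp add: emeasure_space_1)
    finally show ?thesis .
  qed
  have iE: "integrable P (E s)" if s: "s \<in> ST" for s
  proof (rule integrableI_nonneg)
    show "(\<integral>\<^sup>+\<omega>. ennreal (E s \<omega>) \<partial>P) < \<infinity>" using nnE[OF s] by (rule le_less_trans) simp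
  qed (use Em[OF s] in \<open>auto simp: E_def\<close>)
  have spaceB: "space P \<in> sets (pre_sigma s)" for s
    using sets.top[of "pre_sigma s"] by (simp add: space_pre_sigma)
  have iL: "integrable P (\<lambda>\<omega>. exp (L s \<omega>))" if s: "s \<in> ST" for s
  proof (rule integrableI_nonneg)
    have "(\<integral>\<^sup>+\<omega>. ennreal (exp (L s \<omega>)) \<partial>P) = (\<integral>\<^sup>+\<omega>. indicator (space P) \<omega> * ennreal (stoch_exp_from M A s T \<omega>) \<partial>P)"
      by (intro nn_integral_cong) (simp add: from_exp)
    also have "\<dots> < \<infinity>" unfolding norm[OF s spaceB] by (simp add: emeasure_space_1)
    finally show "(\<integral>\<^sup>+\<omega>. ennreal (exp (L s \<omega>)) \<partial>P) < \<infinity>" .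
  qed (use Lm[OF s] in auto)
  have normL: "(\<integral>\<omega>. indicator B \<omega> * exp (L s \<omega>) \<partial>P) = measure P B" if s: "s \<in> ST" and B: "B \<in> sets (pre_sigma s)" for s B
  proof -
    have BP: "B \<in> sets P" by (rule pre_sigma_sets_subset[OF s B])
    have "ennreal (\<integral>\<omega>. indicator B \<omega> * exp (L s \<omega>) \<partial>P) = (\<integral>\<^sup>+\<omega>. ennreal (indicator B \<omega> * exp (L s \<omega>)) \<partial>P)"
      by (intro nn_integral_eq_integral[symmetric] integrable_indicator_mult BP iL s) auto
    also have "\<dots> = (\<integral>\<^sup>+\<omega>. indicator B \<omega> * ennreal (stoch_exp_from M A s T \<omega>) \<partial>P)"
      by (intro nn_integral_cong) (auto simp: from_exp indicator_def)
    also have "\<dots> = ennreal (measure P B)" unfolding norm[OF s B] by (rule emeasure_eq_measure)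
    finally show ?thesis by (simp add: ennreal_inj)
  qed
  \<comment> \<open>Bernoulli's inequality u^p \<ge> 1 + p (u - 1) at u = exp (L s), from convexity
    of exp. As the right side is affine in u and u has conditional expectation 1, conditioning gives
    X \<ge> 1.\<close>
  have E_ge: "1 + p * (exp (L s \<omega>) - 1) \<le> E s \<omega>" for s \<omega>
  proof -
    have "exp (p * ((1 - 1 / p) *\<^sub>R 0 + (1 / p) *\<^sub>R L s \<omega>)) \<le> (1 - 1 / p) * exp (p * 0) + (1 / p) * exp (p * L s \<omega>)"
      using p by (intro convex_onD[OF convex_on_exp[of p]]) auto
    then have "p * exp (L s \<omega>) \<le> p * ((1 - 1 / p) + (1 / p) * exp (p * L s \<omega>))"
      using p by (intro mult_left_mono) auto
    also have "\<dots> = (p - 1) + exp (p * L s \<omega>)" using p by (simp add: field_simps)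
    finally show ?thesis by (simp add: E_def algebra_simps)
  qed
  have "1 \<le> ennreal C"
  proof -
    let ?s = "\<lambda>_::'a. 0 :: real"
    have s: "?s \<in> ST" using horizon_pos by (intro ST_const) auto
    have "(\<integral>\<omega>. indicator (space P) \<omega> * exp (L ?s \<omega>) \<partial>P) = (\<integral>\<omega>. exp (L ?s \<omega>) \<partial>P)"
      by (intro Bochner_Integration.integral_cong) auto
    then have one: "(\<integral>\<omega>. exp (L ?s \<omega>) \<partial>P) = 1" using normL[OF s spaceB] by (simp add: prob_space)
    have "1 = (\<integral>\<omega>. 1 + p * (exp (L ?s \<omega>) - 1) \<partial>P)" using iL[OF s] one by (simp add: prob_space)
    also have "\<dots> \<le> (\<integral>\<omega>. E ?s \<omega> \<partial>P)" using iL[OF s] iE[OF s] E_ge by (intro integral_mono) auto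
    finally have "1 \<le> ennreal (\<integral>\<omega>. E ?s \<omega> \<partial>P)" by simp
    also have "\<dots> = (\<integral>\<^sup>+\<omega>. ennreal (E ?s \<omega>) \<partial>P)" by (intro nn_integral_eq_integral[symmetric] AE_I2 iE[OF s]) (simp add: E_def)
    also have "\<dots> \<le> ennreal C" by (rule nnE[OF s])
    finally show ?thesis .
  qed
  then show C1: "1 \<le> C" by simp
  \<comment> \<open>Clamping to [1, C] alters the conditional expectation only on a null set and
    provides the bounds at every point.\<close>
  define X where "X s \<omega> = max 1 (min C (real_cond_exp P (pre_sigma s) (E s) \<omega>))" for s \<omega>
  have Xm: "X s \<in> borel_measurable (pre_sigma s)" for s unfolding X_def by measurable
  have Xb: "1 \<le> X s \<omega> \<and> X s \<omega> \<le> C" for s \<omega> using C1 by (auto simp: X_def)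
  have X_AE: "AE \<omega> in P. X s \<omega> = real_cond_exp P (pre_sigma s) (E s) \<omega>" if s: "s \<in> ST" for s
  proof -
    interpret sub: finite_measure_subalgebra P "pre_sigma s" by (rule pre_sigma_finite_measure_subalgebra[OF s])
    have "AE \<omega> in P. real_cond_exp P (pre_sigma s) (\<lambda>\<omega>. exp (L s \<omega>)) \<omega> = 1"
    proof (rule sub.real_cond_exp_charact)
      fix B assume B: "B \<in> sets (pre_sigma s)"
      show "(\<integral>\<omega>\<in>B. exp (L s \<omega>) \<partial>P) = (\<integral>\<omega>\<in>B. 1 \<partial>P)"
        using normL[OF s B] pre_sigma_sets_subset[OF s B] by (simp add: set_lebesgue_integral_def)
    qed (use iL[OF s] in auto)
    moreover have "AE \<omega> in P. real_cond_exp P (pre_sigma s) (\<lambda>\<omega>. (1 - p) + p * exp (L s \<omega>)) \<omega>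
        = real_cond_exp P (pre_sigma s) (\<lambda>\<omega>. 1 - p) \<omega> + real_cond_exp P (pre_sigma s) (\<lambda>\<omega>. p * exp (L s \<omega>)) \<omega>"
      using iL[OF s] by (intro sub.real_cond_exp_add) auto
    moreover have "AE \<omega> in P. real_cond_exp P (pre_sigma s) (\<lambda>\<omega>. p * exp (L s \<omega>)) \<omega> = p * real_cond_exp P (pre_sigma s) (\<lambda>\<omega>. exp (L s \<omega>)) \<omega>"
      using iL[OF s] by (intro sub.real_cond_exp_cmult)
    moreover have "AE \<omega> in P. real_cond_exp P (pre_sigma s) (\<lambda>\<omega>. 1 - p) \<omega> = 1 - p"
      by (rule sub.real_cond_exp_F_meas) auto
    moreover have "AE \<omega> in P. real_cond_exp P (pre_sigma s) (\<lambda>\<omega>. (1 - p) + p * exp (L s \<omega>)) \<omega> \<le> real_cond_exp P (pre_sigma s) (E s) \<omega>"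
      using iL[OF s] iE[OF s] E_ge[of s] by (intro sub.real_cond_exp_mono) (auto simp: algebra_simps)
    ultimately have lower: "AE \<omega> in P. 1 \<le> real_cond_exp P (pre_sigma s) (E s) \<omega>" by eventually_elim simp
    have upper: "AE \<omega> in P. real_cond_exp P (pre_sigma s) (E s) \<omega> \<le> C"
      using Rs[OF s]
    proof eventually_elim
      case (elim \<omega>)
      have "enn2real (nn_cond_exp P (pre_sigma s) (\<lambda>\<omega>. ennreal (E s \<omega>)) \<omega>) \<le> C"
        using C1 elim by (intro enn2real_leI) auto
      moreover have "0 \<le> enn2real (nn_cond_exp P (pre_sigma s) (\<lambda>\<omega>. ennreal (- E s \<omega>)) \<omega>)" by simp
      ultimately show ?case unfolding real_cond_exp_def by linarith
    qed
    from lower upper show ?thesis by eventually_elim (simp add: X_def)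
  qed
  have XE: "(\<integral>\<omega>. H \<omega> * X s \<omega> \<partial>P) = (\<integral>\<omega>. H \<omega> * E s \<omega> \<partial>P)"
    if s: "s \<in> ST" and H: "H \<in> borel_measurable (pre_sigma s)" "\<And>\<omega>. \<omega> \<in> space P \<Longrightarrow> \<bar>H \<omega>\<bar> \<le> c" for s H c
  proof -
    interpret sub: finite_measure_subalgebra P "pre_sigma s" by (rule pre_sigma_finite_measure_subalgebra[OF s])
    have HP[measurable]: "H \<in> borel_measurable P" by (rule measurable_from_subalg[OF subalgebra_pre_sigma[OF s] H(1)])
    have [measurable]: "X s \<in> borel_measurable P" by (rule measurable_from_subalg[OF subalgebra_pre_sigma[OF s] Xm])
    have "(\<integral>\<omega>. H \<omega> * X s \<omega> \<partial>P) = (\<integral>\<omega>. H \<omega> * real_cond_exp P (pre_sigma s) (E s) \<omega> \<partial>P)"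
      using X_AE[OF s] by (intro integral_cong_AE) auto
    also have "\<dots> = (\<integral>\<omega>. H \<omega> * E s \<omega> \<partial>P)"
      using integrable_mult_bounded[OF HP H(2) iE[OF s]] H(1) Em[OF s] by (intro sub.real_cond_exp_intg(2)) auto
    finally show ?thesis .
  qed
  have \<beta>pos: "0 < \<beta>" using \<beta> p by (smt (verit) divide_pos_pos)
  have \<beta>p: "p < \<beta> * (p - 1)" using \<beta> p by (simp add: pos_divide_less_eq)
  define c0 where "c0 = p * (\<beta> * (p - 1) - p) / 2"
  have c0: "0 < c0" using p \<beta>p by (simp add: c0_def)
  obtain K where K: "0 \<le> K" "\<And>\<epsilon> X x b. 0 < \<epsilon> \<Longrightarrow> \<epsilon> \<le> 1 \<Longrightarrow> 1 \<le> X \<Longrightarrow> X \<le> C \<Longrightarrow> \<bar>x\<bar> \<le> \<epsilon> \<Longrightarrow> 0 \<le> b \<Longrightarrow> b \<le> \<epsilon> \<Longrightarrow>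
    \<beta> * p * X * x + (\<beta> * X * p\<^sup>2 - p\<^sup>2) / 2 * (x\<^sup>2 - b) + b * ((\<beta> * X * (p\<^sup>2 - p) - p\<^sup>2) / 2) - K * \<epsilon> * (x\<^sup>2 + b)
    \<le> exp (p * (x - b / 2)) - exp (p * (x - b / 2)) * (p * (x - b / 2)) + \<beta> * X * (exp (p * (x - b / 2)) - 1) - 1"
  proof -
    have "0 \<le> p" "0 \<le> \<beta>" using p \<beta>pos by auto
    then show thesis by (rule reverse_hoelder_expansion[OF _ _ C1]) (rule that; assumption)
  qed
  fix \<tau> assume \<tau>: "\<tau> \<in> ST"
  have TS: "(\<lambda>_. T) \<in> ST" using horizon_pos by (intro ST_const) auto
  have \<tau>T: "\<tau> \<omega> \<le> T" if "\<omega> \<in> space P" for \<omega> using ST_range[OF \<tau> that] by simp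
  have A\<tau>[measurable]: "(\<lambda>\<omega>. A (\<tau> \<omega>) \<omega>) \<in> borel_measurable P" by (rule stopped_value_measurable_P[OF A \<tau>])
  have step: "(c0 - 2 * K * \<epsilon>) * exp (- \<beta> * C) * (\<integral>\<omega>. indicator B \<omega> * (A (\<sigma>' \<omega>) \<omega> - A (\<sigma> \<omega>) \<omega>) \<partial>P)
      \<le> (\<integral>\<omega>. indicator B \<omega> * exp (- \<beta> * X \<sigma>' \<omega>) \<partial>P) - (\<integral>\<omega>. indicator B \<omega> * exp (- \<beta> * X \<sigma> \<omega>) \<partial>P)"
    if \<epsilon>: "0 < \<epsilon>" "\<epsilon> \<le> 1" "2 * K * \<epsilon> \<le> c0" and \<sigma>: "\<sigma> \<in> ST" and \<sigma>': "\<sigma>' \<in> ST"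
      and le: "\<And>\<omega>. \<omega> \<in> space P \<Longrightarrow> \<sigma> \<omega> \<le> \<sigma>' \<omega>"
      and incM: "\<And>\<omega> t. \<omega> \<in> space P \<Longrightarrow> t \<in> {0..T} \<Longrightarrow> \<bar>M (min (\<sigma>' \<omega>) t) \<omega> - M (min (\<sigma> \<omega>) t) \<omega>\<bar> \<le> \<epsilon>"
      and incA: "\<And>\<omega> t. \<omega> \<in> space P \<Longrightarrow> t \<in> {0..T} \<Longrightarrow> \<bar>A (min (\<sigma>' \<omega>) t) \<omega> - A (min (\<sigma> \<omega>) t) \<omega>\<bar> \<le> \<epsilon>"
      and B: "B \<in> sets (pre_sigma \<sigma>)" for \<epsilon> \<sigma> \<sigma>' B
    unfolding c0_def
  proof (rule reverse_hoelder_step[OF cp \<epsilon>(1,2) \<sigma> \<sigma>' le incM incA p \<beta>pos _ K(1) K(2)[OF \<epsilon>(1,2)] _ Xm Xb Xm Xb _ B])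
    show "p \<le> \<beta> * (p - 1)" using \<beta>p by simp
    show "2 * K * \<epsilon> \<le> p * (\<beta> * (p - 1) - p) / 2" using \<epsilon>(3) by (simp add: c0_def)
    fix H :: "'a \<Rightarrow> real" and c assume H: "H \<in> borel_measurable (pre_sigma \<sigma>)" "\<And>\<omega>. \<omega> \<in> space P \<Longrightarrow> \<bar>H \<omega>\<bar> \<le> c"
    let ?w = "\<lambda>\<omega>. exp (p * (M (\<sigma>' \<omega>) \<omega> - M (\<sigma> \<omega>) \<omega> - (A (\<sigma>' \<omega>) \<omega> - A (\<sigma> \<omega>) \<omega>) / 2))"
    note mono = measurable_pre_sigma_mono[OF \<sigma> \<sigma>' le]
    have [measurable]: "(\<lambda>\<omega>. M (\<sigma>' \<omega>) \<omega>) \<in> borel_measurable (pre_sigma \<sigma>')" "(\<lambda>\<omega>. A (\<sigma>' \<omega>) \<omega>) \<in> borel_measurable (pre_sigma \<sigma>')"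
      "(\<lambda>\<omega>. M (\<sigma> \<omega>) \<omega>) \<in> borel_measurable (pre_sigma \<sigma>')" "(\<lambda>\<omega>. A (\<sigma> \<omega>) \<omega>) \<in> borel_measurable (pre_sigma \<sigma>')"
      "H \<in> borel_measurable (pre_sigma \<sigma>')"
      by (intro stopped_value_measurable M A \<sigma>' mono \<sigma> H(1); assumption)+
    have wb: "\<bar>H \<omega> * ?w \<omega>\<bar> \<le> c * exp (p * 2)" if \<omega>: "\<omega> \<in> space P" for \<omega>
    proof -
      have "min (\<sigma>' \<omega>) T = \<sigma>' \<omega>" "min (\<sigma> \<omega>) T = \<sigma> \<omega>" using ST_range[OF \<sigma> \<omega>] ST_range[OF \<sigma>' \<omega>] by (auto simp: min_def)
      then have "\<bar>M (\<sigma>' \<omega>) \<omega> - M (\<sigma> \<omega>) \<omega>\<bar> \<le> 1" "\<bar>A (\<sigma>' \<omega>) \<omega> - A (\<sigma> \<omega>) \<omega>\<bar> \<le> 1"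
        using incM[OF \<omega>, of T] incA[OF \<omega>, of T] \<epsilon> horizon_pos by auto
      moreover have "u - v / 2 \<le> 2" if "\<bar>u\<bar> \<le> 1" "\<bar>v\<bar> \<le> 1" for u v :: real using that by auto
      ultimately have "M (\<sigma>' \<omega>) \<omega> - M (\<sigma> \<omega>) \<omega> - (A (\<sigma>' \<omega>) \<omega> - A (\<sigma> \<omega>) \<omega>) / 2 \<le> 2" by blast
      then have "?w \<omega> \<le> exp (p * 2)" using p by simp
      then show ?thesis unfolding abs_mult using H(2)[OF \<omega>] by (intro mult_mono) auto
    qed
    have "(\<integral>\<omega>. H \<omega> * ?w \<omega> * X \<sigma>' \<omega> \<partial>P) = (\<integral>\<omega>. H \<omega> * ?w \<omega> * E \<sigma>' \<omega> \<partial>P)"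
      by (rule XE[OF \<sigma>' _ wb]) measurable
    also have "\<dots> = (\<integral>\<omega>. H \<omega> * E \<sigma> \<omega> \<partial>P)"
    proof (intro Bochner_Integration.integral_cong refl)
      fix \<omega>
      \<comment> \<open>Exponentials over consecutive intervals multiply; conditioning this identity
        is the tower property of X.\<close>
      have "?w \<omega> * E \<sigma>' \<omega> = E \<sigma> \<omega>"
        unfolding E_def L_def exp_add[symmetric] by (rule arg_cong[where f=exp]) (simp add: field_simps)
      then show "H \<omega> * ?w \<omega> * E \<sigma>' \<omega> = H \<omega> * E \<sigma> \<omega>" by (simp add: mult.assoc)
    qed
    also have "\<dots> = (\<integral>\<omega>. H \<omega> * X \<sigma> \<omega> \<partial>P)" by (rule XE[OF \<sigma> H, symmetric])
    finally show "(\<integral>\<omega>. H \<omega> * ?w \<omega> * X \<sigma>' \<omega> \<partial>P) = (\<integral>\<omega>. H \<omega> * X \<sigma> \<omega> \<partial>P)" .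
  qed
  \<comment> \<open>Along a partition from \<tau> to T the right sides of \<open>step\<close>
    telescope, and exp (- \<beta> X) stays between exp (- \<beta> C) and exp (- \<beta>), so the
    total is at most the difference of these times the probability of B.\<close>
  have bound_\<epsilon>: "(\<integral>\<^sup>+\<omega>. indicator B \<omega> * ennreal (A T \<omega> - A (\<tau> \<omega>) \<omega>) \<partial>P)
      \<le> ennreal ((exp (- \<beta>) - exp (- \<beta> * C)) * measure P B / ((c0 - 2 * K * \<epsilon>) * exp (- \<beta> * C)))"
    if \<epsilon>: "0 < \<epsilon>" "\<epsilon> \<le> 1" "2 * K * \<epsilon> < c0" and B: "B \<in> sets (pre_sigma \<tau>)" for \<epsilon> B
  proof -
    have BP[measurable]: "B \<in> sets P" by (rule pre_sigma_sets_subset[OF \<tau> B])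
    obtain \<rho> :: "nat \<Rightarrow> 'a \<Rightarrow> real" where \<rho>0: "\<And>\<omega>. \<omega> \<in> space P \<Longrightarrow> \<rho> 0 \<omega> = \<tau> \<omega>" and \<rho>: "\<And>n. \<rho> n \<in> ST"
      and mono: "\<And>n \<omega>. \<omega> \<in> space P \<Longrightarrow> \<rho> n \<omega> \<le> \<rho> (Suc n) \<omega>" and le: "\<And>n \<omega>. \<rho> n \<omega> \<le> T"
      and incM: "\<And>n \<omega> t. \<omega> \<in> space P \<Longrightarrow> t \<in> {0..T} \<Longrightarrow> \<bar>M (min (\<rho> (Suc n) \<omega>) t) \<omega> - M (min (\<rho> n \<omega>) t) \<omega>\<bar> \<le> \<epsilon>"
      and incA: "\<And>n \<omega> t. \<omega> \<in> space P \<Longrightarrow> t \<in> {0..T} \<Longrightarrow> \<bar>A (min (\<rho> (Suc n) \<omega>) t) \<omega> - A (min (\<rho> n \<omega>) t) \<omega>\<bar> \<le> \<epsilon>"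
      and inc: "\<And>n \<omega>. \<omega> \<in> space P \<Longrightarrow> \<bar>M (\<rho> (Suc n) \<omega>) \<omega> - M (\<rho> n \<omega>) \<omega>\<bar> \<le> \<epsilon>"
        "\<And>n \<omega>. \<omega> \<in> space P \<Longrightarrow> \<bar>A (\<rho> (Suc n) \<omega>) \<omega> - A (\<rho> n \<omega>) \<omega>\<bar> \<le> \<epsilon>"
      and ev: "\<And>\<omega>. \<omega> \<in> space P \<Longrightarrow> \<forall>\<^sub>F n in sequentially. \<rho> n \<omega> = T"
      by (rule fine_partition_until[OF M A \<epsilon>(1) \<tau> TS \<tau>T]) (assumption | rule that; assumption)+
    have \<tau>\<rho>: "\<tau> \<omega> \<le> \<rho> n \<omega>" if "\<omega> \<in> space P" for n \<omega>
      by (induction n) (use \<rho>0[OF that] mono[OF that] order_trans in auto)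
    have B\<rho>: "B \<in> sets (pre_sigma (\<rho> n))" for n using pre_sigma_mono[OF \<tau> \<rho> \<tau>\<rho>] B by blast
    have Amono': "A s \<omega> \<le> A t \<omega>" if "\<omega> \<in> space P" "0 \<le> s" "s \<le> t" "t \<le> T" for s t \<omega>
      using mono_onD[OF Amono[OF that(1)], of s t] that by auto
    have [measurable]: "(\<lambda>\<omega>. A (\<rho> n \<omega>) \<omega>) \<in> borel_measurable P" for n by (rule stopped_value_measurable_P[OF A \<rho>])
    have [measurable]: "X (\<rho> n) \<in> borel_measurable P" for n
      by (rule measurable_from_subalg[OF subalgebra_pre_sigma[OF \<rho>] Xm])
    define \<kappa> where "\<kappa> = (c0 - 2 * K * \<epsilon>) * exp (- \<beta> * C)"
    have \<kappa>: "0 < \<kappa>" using \<epsilon> by (simp add: \<kappa>_def)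
    have inc_nonneg: "0 \<le> A (\<rho> n \<omega>) \<omega> - A (\<tau> \<omega>) \<omega>" if "\<omega> \<in> space P" for n \<omega>
      using Amono'[OF that _ \<tau>\<rho>[OF that] le] ST_range[OF \<tau> that] by simp
    \<comment> \<open>A crude bound that gives integrability for fixed n. The whole increment up to
      T is not yet known to be integrable, which is why the limit in n is taken with Fatou's
      lemma.\<close>
    have inc_bd: "A (\<rho> n \<omega>) \<omega> - A (\<tau> \<omega>) \<omega> \<le> real n * \<epsilon>" if "\<omega> \<in> space P" for n \<omega>
    proof (induction n)
      case (Suc n)
      have "A (\<rho> (Suc n) \<omega>) \<omega> - A (\<rho> n \<omega>) \<omega> \<le> \<epsilon>" using inc(2)[OF that, of n] by linarith
      with Suc show ?case by (simp add: algebra_simps)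
    qed (simp add: \<rho>0[OF that])
    have iA: "integrable P (\<lambda>\<omega>. A (\<rho> n \<omega>) \<omega> - A (\<tau> \<omega>) \<omega>)" for n
      using inc_nonneg inc_bd by (intro integrable_bounded[where C="real n * \<epsilon>"]) auto
    have iX: "integrable P (\<lambda>\<omega>. indicator B \<omega> * exp (- \<beta> * X (\<rho> n) \<omega>))" for n
    proof (rule integrable_bounded[where C=1])
      fix \<omega>
      have "0 \<le> \<beta> * X (\<rho> n) \<omega>" using Xb[of "\<rho> n" \<omega>] \<beta>pos by (intro mult_nonneg_nonneg) auto
      then show "\<bar>indicator B \<omega> * exp (- \<beta> * X (\<rho> n) \<omega>)\<bar> \<le> 1" by (simp add: indicator_def)
    qed measurable
    have tele: "\<kappa> * (\<integral>\<omega>. indicator B \<omega> * (A (\<rho> n \<omega>) \<omega> - A (\<tau> \<omega>) \<omega>) \<partial>P)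
        \<le> (\<integral>\<omega>. indicator B \<omega> * exp (- \<beta> * X (\<rho> n) \<omega>) \<partial>P) - (\<integral>\<omega>. indicator B \<omega> * exp (- \<beta> * X (\<rho> 0) \<omega>) \<partial>P)" for n
    proof (induction n)
      case 0
      have "(\<integral>\<omega>. indicator B \<omega> * (A (\<rho> 0 \<omega>) \<omega> - A (\<tau> \<omega>) \<omega>) \<partial>P) = (\<integral>\<omega>. 0 \<partial>P)"
        by (rule Bochner_Integration.integral_cong) (simp_all add: \<rho>0)
      then show ?case by simp
    next
      case (Suc n)
      let ?D = "\<lambda>\<omega>. A (\<rho> (Suc n) \<omega>) \<omega> - A (\<rho> n \<omega>) \<omega>"
      have iD: "integrable P ?D"
        using Bochner_Integration.integrable_diff[OF iA[of "Suc n"] iA[of n]] by simp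
      have "(\<integral>\<omega>. indicator B \<omega> * (A (\<rho> (Suc n) \<omega>) \<omega> - A (\<tau> \<omega>) \<omega>) \<partial>P)
          = (\<integral>\<omega>. indicator B \<omega> * ?D \<omega> + indicator B \<omega> * (A (\<rho> n \<omega>) \<omega> - A (\<tau> \<omega>) \<omega>) \<partial>P)"
        by (intro Bochner_Integration.integral_cong refl) (simp add: algebra_simps)
      also have "\<dots> = (\<integral>\<omega>. indicator B \<omega> * ?D \<omega> \<partial>P) + (\<integral>\<omega>. indicator B \<omega> * (A (\<rho> n \<omega>) \<omega> - A (\<tau> \<omega>) \<omega>) \<partial>P)"
        by (intro Bochner_Integration.integral_add integrable_indicator_mult BP iD iA)
      finally have split: "(\<integral>\<omega>. indicator B \<omega> * (A (\<rho> (Suc n) \<omega>) \<omega> - A (\<tau> \<omega>) \<omega>) \<partial>P)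
          = (\<integral>\<omega>. indicator B \<omega> * ?D \<omega> \<partial>P) + (\<integral>\<omega>. indicator B \<omega> * (A (\<rho> n \<omega>) \<omega> - A (\<tau> \<omega>) \<omega>) \<partial>P)" .
      have "\<kappa> * (\<integral>\<omega>. indicator B \<omega> * ?D \<omega> \<partial>P)
          \<le> (\<integral>\<omega>. indicator B \<omega> * exp (- \<beta> * X (\<rho> (Suc n)) \<omega>) \<partial>P) - (\<integral>\<omega>. indicator B \<omega> * exp (- \<beta> * X (\<rho> n) \<omega>) \<partial>P)"
        unfolding \<kappa>_def using \<epsilon> by (intro step[OF _ _ _ \<rho> \<rho> mono incM incA B\<rho>]) auto
      with Suc.IH show ?case unfolding split distrib_left by linarith
    qed
    have est: "(\<integral>\<omega>. indicator B \<omega> * (A (\<rho> n \<omega>) \<omega> - A (\<tau> \<omega>) \<omega>) \<partial>P) \<le> (exp (- \<beta>) - exp (- \<beta> * C)) * measure P B / \<kappa>" for n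
    proof -
      have "(\<integral>\<omega>. indicator B \<omega> * exp (- \<beta> * X (\<rho> n) \<omega>) \<partial>P) \<le> (\<integral>\<omega>. indicator B \<omega> * exp (- \<beta>) \<partial>P)"
        using Xb \<beta>pos by (intro integral_mono iX integrable_indicator_mult BP) (auto simp: indicator_def)
      moreover have "(\<integral>\<omega>. indicator B \<omega> * exp (- \<beta> * C) \<partial>P) \<le> (\<integral>\<omega>. indicator B \<omega> * exp (- \<beta> * X (\<rho> 0) \<omega>) \<partial>P)"
        using Xb \<beta>pos by (intro integral_mono iX integrable_indicator_mult BP) (auto simp: indicator_def)
      ultimately have "\<kappa> * (\<integral>\<omega>. indicator B \<omega> * (A (\<rho> n \<omega>) \<omega> - A (\<tau> \<omega>) \<omega>) \<partial>P) \<le> exp (- \<beta>) * measure P B - exp (- \<beta> * C) * measure P B"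
        using tele[of n] BP by (simp add: mult.commute)
      then show ?thesis using \<kappa> by (simp add: pos_le_divide_eq algebra_simps)
    qed
    have "(\<integral>\<^sup>+\<omega>. indicator B \<omega> * ennreal (A T \<omega> - A (\<tau> \<omega>) \<omega>) \<partial>P)
        = (\<integral>\<^sup>+\<omega>. liminf (\<lambda>n. ennreal (indicator B \<omega> * (A (\<rho> n \<omega>) \<omega> - A (\<tau> \<omega>) \<omega>))) \<partial>P)"
    proof (intro nn_integral_cong)
      fix \<omega> assume \<omega>: "\<omega> \<in> space P"
      have "(\<lambda>n. ennreal (indicator B \<omega> * (A (\<rho> n \<omega>) \<omega> - A (\<tau> \<omega>) \<omega>))) \<longlonglongrightarrow> ennreal (indicator B \<omega> * (A T \<omega> - A (\<tau> \<omega>) \<omega>))"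
        by (rule tendsto_eventually) (use ev[OF \<omega>] in \<open>eventually_elim, simp\<close>)
      then have "liminf (\<lambda>n. ennreal (indicator B \<omega> * (A (\<rho> n \<omega>) \<omega> - A (\<tau> \<omega>) \<omega>))) = ennreal (indicator B \<omega> * (A T \<omega> - A (\<tau> \<omega>) \<omega>))"
        by (intro lim_imp_Liminf) auto
      then show "indicator B \<omega> * ennreal (A T \<omega> - A (\<tau> \<omega>) \<omega>) = liminf (\<lambda>n. ennreal (indicator B \<omega> * (A (\<rho> n \<omega>) \<omega> - A (\<tau> \<omega>) \<omega>)))"
        by (simp add: indicator_def)
    qed
    also have "\<dots> \<le> liminf (\<lambda>n. \<integral>\<^sup>+\<omega>. ennreal (indicator B \<omega> * (A (\<rho> n \<omega>) \<omega> - A (\<tau> \<omega>) \<omega>)) \<partial>P)"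
      by (intro nn_integral_liminf) measurable
    also have "\<dots> \<le> ennreal ((exp (- \<beta>) - exp (- \<beta> * C)) * measure P B / \<kappa>)"
    proof (rule Liminf_le)
      have "(\<integral>\<^sup>+\<omega>. ennreal (indicator B \<omega> * (A (\<rho> n \<omega>) \<omega> - A (\<tau> \<omega>) \<omega>)) \<partial>P) \<le> ennreal ((exp (- \<beta>) - exp (- \<beta> * C)) * measure P B / \<kappa>)" for n
      proof -
        have "(\<integral>\<^sup>+\<omega>. ennreal (indicator B \<omega> * (A (\<rho> n \<omega>) \<omega> - A (\<tau> \<omega>) \<omega>)) \<partial>P) = ennreal (\<integral>\<omega>. indicator B \<omega> * (A (\<rho> n \<omega>) \<omega> - A (\<tau> \<omega>) \<omega>) \<partial>P)"
          by (intro nn_integral_eq_integral integrable_indicator_mult BP iA AE_I2 mult_nonneg_nonneg inc_nonneg) auto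
        also have "\<dots> \<le> ennreal ((exp (- \<beta>) - exp (- \<beta> * C)) * measure P B / \<kappa>)" by (rule ennreal_leI[OF est])
        finally show ?thesis .
      qed
      then show "\<forall>\<^sub>F n in sequentially. (\<integral>\<^sup>+\<omega>. ennreal (indicator B \<omega> * (A (\<rho> n \<omega>) \<omega> - A (\<tau> \<omega>) \<omega>)) \<partial>P) \<le> ennreal ((exp (- \<beta>) - exp (- \<beta> * C)) * measure P B / \<kappa>)"
        by simp
    qed simp
    finally show ?thesis unfolding \<kappa>_def .
  qed
  define c where "c = 2 * (exp (\<beta> * (C - 1)) - 1) / (p * (\<beta> * (p - 1) - p))"
  have c: "0 \<le> c" using C1 \<beta>pos p \<beta>p by (simp add: c_def)
  have "AE \<omega> in P. nn_cond_exp P (pre_sigma \<tau>) (\<lambda>\<omega>. ennreal (A T \<omega> - A (\<tau> \<omega>) \<omega>)) \<omega> \<le> ennreal c"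
  proof (rule nn_cond_exp_le_const[OF \<tau>])
    fix B assume B: "B \<in> sets (pre_sigma \<tau>)"
    define r where "r \<epsilon> = (exp (- \<beta>) - exp (- \<beta> * C)) * measure P B / ((c0 - 2 * K * \<epsilon>) * exp (- \<beta> * C))" for \<epsilon>
    \<comment> \<open>Letting \<epsilon> tend to 0 from the right removes the expansion error from
      the denominator.\<close>
    have "(r \<longlongrightarrow> (exp (- \<beta>) - exp (- \<beta> * C)) * measure P B / ((c0 - 2 * K * 0) * exp (- \<beta> * C))) (at_right 0)"
      unfolding r_def using c0 by (intro tendsto_intros) auto
    then have lim: "((\<lambda>\<epsilon>. ennreal (r \<epsilon>)) \<longlongrightarrow> ennreal ((exp (- \<beta>) - exp (- \<beta> * C)) * measure P B / (c0 * exp (- \<beta> * C)))) (at_right 0)"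
      by (intro tendsto_ennrealI) simp
    have "((\<lambda>\<epsilon>. 2 * K * \<epsilon>) \<longlongrightarrow> 2 * K * 0) (at_right 0)" by (intro tendsto_intros)
    then have "\<forall>\<^sub>F \<epsilon> in at_right 0. 2 * K * \<epsilon> < c0" using c0 by (intro order_tendstoD(2)) auto
    moreover have "\<forall>\<^sub>F \<epsilon> in at_right 0. \<epsilon> \<in> {0<..<1::real}" by (rule eventually_at_right_real) simp
    ultimately have "\<forall>\<^sub>F \<epsilon> in at_right 0. (\<integral>\<^sup>+\<omega>. indicator B \<omega> * ennreal (A T \<omega> - A (\<tau> \<omega>) \<omega>) \<partial>P) \<le> ennreal (r \<epsilon>)"
    proof eventually_elim
      case (elim \<epsilon>)
      then show ?case unfolding r_def by (intro bound_\<epsilon> B) auto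
    qed
    then have "(\<integral>\<^sup>+\<omega>. indicator B \<omega> * ennreal (A T \<omega> - A (\<tau> \<omega>) \<omega>) \<partial>P)
        \<le> ennreal ((exp (- \<beta>) - exp (- \<beta> * C)) * measure P B / (c0 * exp (- \<beta> * C)))"
      by (intro tendsto_lowerbound[OF lim]) simp_all
    also have "(exp (- \<beta>) - exp (- \<beta> * C)) * measure P B / (c0 * exp (- \<beta> * C)) = c * measure P B"
    proof -
      have "exp (- \<beta>) = exp (\<beta> * (C - 1)) * exp (- \<beta> * C)"
        unfolding exp_add[symmetric] by (rule arg_cong[where f=exp]) (simp add: algebra_simps)
      then have "exp (- \<beta>) - exp (- \<beta> * C) = (exp (\<beta> * (C - 1)) - 1) * exp (- \<beta> * C)" by (simp add: algebra_simps)
      then show ?thesis by (simp add: c_def c0_def)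
    qed
    also have "ennreal (c * measure P B) = ennreal c * emeasure P B"
      using c by (simp add: ennreal_mult emeasure_eq_measure)
    finally show "(\<integral>\<^sup>+\<omega>. indicator B \<omega> * ennreal (A T \<omega> - A (\<tau> \<omega>) \<omega>) \<partial>P) \<le> ennreal c * emeasure P B" .
  qed auto
  then show "AE \<omega> in P. nn_cond_exp_at P F \<tau> (\<lambda>\<omega>. A T \<omega> - A (\<tau> \<omega>) \<omega>) \<omega>
      \<le> ennreal (2 * (exp (\<beta> * (C - 1)) - 1) / (p * (\<beta> * (p - 1) - p)))"
    by (simp add: nn_cond_exp_at_def c_def)
qed

section \<open>BMO norms\<close>

lemma stoch_exp_from_AE_cong:
  assumes "AE \<omega> in P. \<forall>t\<in>{0..T}. M t \<omega> = M' t \<omega> \<and> A t \<omega> = A' t \<omega>" "\<tau> \<in> ST"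
  shows "AE \<omega> in P. stoch_exp_from M A \<tau> T \<omega> = stoch_exp_from M' A' \<tau> T \<omega>"
  using assms(1) AE_space
  by eventually_elim (use ST_range[OF assms(2)] horizon_pos in \<open>simp add: stoch_exp_from_def stoch_exp_def\<close>)

lemma regular_stoch_exp: "regular M \<Longrightarrow> regular A \<Longrightarrow> regular (stoch_exp M A)"
  unfolding stoch_exp_def[abs_def] by (rule regular_comp2) (auto intro!: continuous_intros)

lemma stoch_exp_from_measurable:
  assumes M: "regular M" and A: "regular A" and \<tau>: "\<tau> \<in> ST"
  shows "stoch_exp_from M A \<tau> T \<in> borel_measurable P"
proof -
  have [measurable]: "stoch_exp M A T \<in> borel_measurable P" "(\<lambda>\<omega>. stoch_exp M A (\<tau> \<omega>) \<omega>) \<in> borel_measurable P"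
    using stopped_value_measurable_P[OF regular_stoch_exp[OF M A] ST_const[of T]]
      stopped_value_measurable_P[OF regular_stoch_exp[OF M A] \<tau>] horizon_pos by simp_all
  show ?thesis unfolding stoch_exp_from_def[abs_def] by measurable
qed

text \<open>Carries the bound from a regular modification back to M, and from its characteristic to
  the version used in the norm. Being stated for any filtered space with \<open>norm\<close> as a
  hypothesis, it yields part (1) under P and part (2) under the changed measure.\<close>

theorem bmo_norm_power2_bound:
  assumes A: "is_square_characteristic P F T M A" and M0: "AE \<omega> in P. M 0 \<omega> = 0"
    and p: "1 < p" and \<beta>: "p / (p - 1) < \<beta>"
    and norm: "\<And>\<tau> B. \<tau> \<in> ST \<Longrightarrow> B \<in> sets (pre_sigma \<tau>) \<Longrightarrow>
      (\<integral>\<^sup>+\<omega>. indicator B \<omega> * ennreal (stoch_exp_from M A \<tau> T \<omega>) \<partial>P) = emeasure P B"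
    and R: "R_condition P F T M A p C"
  shows "(bmo_norm P F T M)\<^sup>2 \<le> ennreal (2 * (exp (\<beta> * (C - 1)) - 1) / (p * (\<beta> * (p - 1) - p)))"
proof -
  obtain M1 A1 where cp: "characteristic_pair M1 A1"
    and eq: "AE \<omega> in P. \<forall>t\<in>{0..T}. M t \<omega> = M1 t \<omega> \<and> A t \<omega> = A1 t \<omega>"
    by (rule characteristic_pair_modification[OF A M0])
  have reg: "regular M1" "regular A1" using cp by (auto simp: characteristic_pair_def)
  have m1[measurable]: "stoch_exp_from M1 A1 \<tau> T \<in> borel_measurable P" if "\<tau> \<in> ST" for \<tau>
    by (rule stoch_exp_from_measurable[OF reg that])
  have eqE: "AE \<omega> in P. stoch_exp_from M1 A1 \<tau> T \<omega> = stoch_exp_from M A \<tau> T \<omega>" if "\<tau> \<in> ST" for \<tau>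
    using stoch_exp_from_AE_cong[OF eq that] by eventually_elim simp
  have m[measurable]: "stoch_exp_from M A \<tau> T \<in> borel_measurable P" if "\<tau> \<in> ST" for \<tau>
    by (rule measurable_P_AE_eq[OF m1[OF that] eqE[OF that]])
  have norm1: "(\<integral>\<^sup>+\<omega>. indicator B \<omega> * ennreal (stoch_exp_from M1 A1 \<tau> T \<omega>) \<partial>P) = emeasure P B"
    if "\<tau> \<in> ST" "B \<in> sets (pre_sigma \<tau>)" for \<tau> B
    unfolding norm[OF that, symmetric]
  proof (rule nn_integral_cong_AE)
    show "AE \<omega> in P. indicator B \<omega> * ennreal (stoch_exp_from M1 A1 \<tau> T \<omega>) = indicator B \<omega> * ennreal (stoch_exp_from M A \<tau> T \<omega>)"
      using eqE[OF that(1)] by eventually_elim simp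
  qed
  have R1: "R_condition P F T M1 A1 p C"
    unfolding R_condition_def
  proof
    fix \<tau> assume \<tau>: "\<tau> \<in> ST"
    interpret sub: finite_measure_subalgebra P "pre_sigma \<tau>" by (rule pre_sigma_finite_measure_subalgebra[OF \<tau>])
    have "AE \<omega> in P. nn_cond_exp P (pre_sigma \<tau>) (\<lambda>\<omega>. ennreal (stoch_exp_from M A \<tau> T \<omega> powr p)) \<omega>
        = nn_cond_exp P (pre_sigma \<tau>) (\<lambda>\<omega>. ennreal (stoch_exp_from M1 A1 \<tau> T \<omega> powr p)) \<omega>"
    proof (rule sub.nn_cond_exp_cong)
      show "AE \<omega> in P. ennreal (stoch_exp_from M A \<tau> T \<omega> powr p) = ennreal (stoch_exp_from M1 A1 \<tau> T \<omega> powr p)"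
        using eqE[OF \<tau>] by eventually_elim simp
    qed (use m[OF \<tau>] m1[OF \<tau>] in measurable)
    moreover have "AE \<omega> in P. nn_cond_exp P (pre_sigma \<tau>) (\<lambda>\<omega>. ennreal (stoch_exp_from M A \<tau> T \<omega> powr p)) \<omega> \<le> ennreal C"
      using R \<tau> by (auto simp: R_condition_def nn_cond_exp_at_def)
    ultimately show "AE \<omega> in P. nn_cond_exp_at P F \<tau> (\<lambda>\<omega>. stoch_exp_from M1 A1 \<tau> T \<omega> powr p) \<omega> \<le> ennreal C"
      unfolding nn_cond_exp_at_def by eventually_elim simp
  qed
  have C: "1 \<le> C" by (rule reverse_hoelder_characteristic_bound(1)[OF cp p \<beta> norm1 R1])
  have bound: "AE \<omega> in P. nn_cond_exp_at P F \<tau> (\<lambda>\<omega>. A1 T \<omega> - A1 (\<tau> \<omega>) \<omega>) \<omega>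
      \<le> ennreal (2 * (exp (\<beta> * (C - 1)) - 1) / (p * (\<beta> * (p - 1) - p)))" if "\<tau> \<in> ST" for \<tau>
    by (rule reverse_hoelder_characteristic_bound(2)[OF cp p \<beta> norm1 R1 that])
  \<comment> \<open>The norm rests on a choice among all versions; A witnesses that one exists, and
    uniqueness makes the chosen one indistinguishable from A1.\<close>
  define S where "S = square_characteristic P F T M"
  have "is_square_characteristic P F T M S"
    unfolding S_def square_characteristic_def by (rule someI[of _ A]) (rule A)
  from square_characteristic_unique[OF this A M0] eq
  have eqS: "AE \<omega> in P. \<forall>t\<in>{0..T}. A1 t \<omega> = S t \<omega>" by eventually_elim simp
  show ?thesis
  proof (rule bmo_norm_power2_le)
    have "0 < \<beta>" using \<beta> p by (smt (verit) divide_pos_pos)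
    moreover have "p < \<beta> * (p - 1)" using \<beta> p by (simp add: pos_divide_less_eq)
    ultimately show "0 \<le> 2 * (exp (\<beta> * (C - 1)) - 1) / (p * (\<beta> * (p - 1) - p))"
      using p C by simp
    fix \<tau> assume \<tau>: "\<tau> \<in> ST"
    interpret sub: finite_measure_subalgebra P "pre_sigma \<tau>" by (rule pre_sigma_finite_measure_subalgebra[OF \<tau>])
    have eq\<tau>: "AE \<omega> in P. A1 T \<omega> - A1 (\<tau> \<omega>) \<omega> = S T \<omega> - S (\<tau> \<omega>) \<omega>"
    proof -
      have "(\<lambda>_. T) \<in> ST" using horizon_pos by (intro ST_const) auto
      from AE_stopped_eq[OF eqS this] AE_stopped_eq[OF eqS \<tau>] show ?thesis by eventually_elim simp
    qed
    have mA: "(\<lambda>\<omega>. A1 T \<omega> - A1 (\<tau> \<omega>) \<omega>) \<in> borel_measurable P"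
      using stopped_value_measurable_P[OF reg(2) \<tau>] stopped_value_measurable_P[OF reg(2) ST_const[of T]] horizon_pos
      by auto
    have "AE \<omega> in P. nn_cond_exp P (pre_sigma \<tau>) (\<lambda>\<omega>. ennreal (A1 T \<omega> - A1 (\<tau> \<omega>) \<omega>)) \<omega>
        = nn_cond_exp P (pre_sigma \<tau>) (\<lambda>\<omega>. ennreal (S T \<omega> - S (\<tau> \<omega>) \<omega>)) \<omega>"
    proof (rule sub.nn_cond_exp_cong)
      show "AE \<omega> in P. ennreal (A1 T \<omega> - A1 (\<tau> \<omega>) \<omega>) = ennreal (S T \<omega> - S (\<tau> \<omega>) \<omega>)"
        using eq\<tau> by eventually_elim simp
    qed (use mA measurable_P_AE_eq[OF mA eq\<tau>] in measurable)
    with bound[OF \<tau>]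
    show "AE \<omega> in P. nn_cond_exp_at P F \<tau> (\<lambda>\<omega>. square_characteristic P F T M T \<omega> - square_characteristic P F T M (\<tau> \<omega>) \<omega>) \<omega>
        \<le> ennreal (2 * (exp (\<beta> * (C - 1)) - 1) / (p * (\<beta> * (p - 1) - p)))"
      unfolding nn_cond_exp_at_def S_def[symmetric] by eventually_elim simp
  qed
qed

end

theorem mainTheorem3:
  fixes P :: "'a measure" and F :: "real \<Rightarrow> 'a measure" and T p :: real
    and M A :: "real \<Rightarrow> 'a \<Rightarrow> real"
  defines "P' \<equiv> density P (\<lambda>\<omega>. ennreal (stoch_exp M A T \<omega>))"
    and "M' \<equiv> (\<lambda>t \<omega>. A t \<omega> - M t \<omega>)"
  assumes "usual_filtration P F T"
    and "continuous_local_martingale P F T M"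
    and "AE \<omega> in P. M 0 \<omega> = 0"
    and "is_square_characteristic P F T M A"
    and "martingale P F T (stoch_exp M A)"
    and "uniformly_integrable P T (stoch_exp M A)"
    and "1 < p"
  shows "(\<forall>C \<beta>. R_condition P F T M A p C \<longrightarrow> p / (p - 1) < \<beta> \<longrightarrow>
            (bmo_norm P F T M)\<^sup>2
              \<le> ennreal (2 * (exp (\<beta> * (C - 1)) - 1) / (p * (\<beta> * (p - 1) - p)))) \<and>
         (\<forall>D \<beta>. A_condition P F T M A p D \<longrightarrow> p < \<beta> \<longrightarrow>
            (bmo_norm P' F T M')\<^sup>2
              \<le> ennreal (2 * (p - 1)\<^sup>2 / (p * (\<beta> - p)) * (exp (\<beta> * (D - 1)) - 1)))"
proof -
  interpret usual_filtration P F T by fact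
  note M0 = \<open>AE \<omega> in P. M 0 \<omega> = 0\<close> and A = \<open>is_square_characteristic P F T M A\<close>
    and mart = \<open>martingale P F T (stoch_exp M A)\<close> and p = \<open>1 < p\<close>
  let ?Z = "stoch_exp M A"
  obtain M1 A1 where cp: "characteristic_pair M1 A1"
    and eq: "AE \<omega> in P. \<forall>t\<in>{0..T}. M t \<omega> = M1 t \<omega> \<and> A t \<omega> = A1 t \<omega>"
    by (rule characteristic_pair_modification[OF A M0])
  let ?Z1 = "stoch_exp M1 A1"
  have reg: "regular M1" "regular A1" using cp by (auto simp: characteristic_pair_def)
  have eqZ: "AE \<omega> in P. \<forall>t\<in>{0..T}. ?Z t \<omega> = ?Z1 t \<omega>" using eq by eventually_elim (simp add: stoch_exp_def)
  have regZ1: "regular ?Z1" by (rule regular_stoch_exp[OF reg])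
  have mart1: "martingale P F T ?Z1"
  proof (rule martingale_AE_cong[OF mart])
    show "AE \<omega> in P. ?Z t \<omega> = ?Z1 t \<omega>" if "t \<in> {0..T}" for t
      using eqZ by eventually_elim (use that in simp)
  qed
  have TS: "(\<lambda>_. T) \<in> ST" using horizon_pos by (intro ST_const) auto
  have eqZT: "AE \<omega> in P. ?Z1 T \<omega> = ?Z T \<omega>" using AE_stopped_eq[OF eqZ TS] by eventually_elim simp
  have eqZ\<tau>: "AE \<omega> in P. ?Z (\<tau> \<omega>) \<omega> = ?Z1 (\<tau> \<omega>) \<omega>" if "\<tau> \<in> ST" for \<tau> by (rule AE_stopped_eq[OF eqZ that])
  have Z1T[measurable]: "?Z1 T \<in> borel_measurable P" using stopped_value_measurable_P[OF regZ1 TS] by simp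
  have ZT[measurable]: "?Z T \<in> borel_measurable P" by (rule measurable_P_AE_eq[OF Z1T eqZT])
  have m_from: "stoch_exp_from M A \<tau> T \<in> borel_measurable P" if "\<tau> \<in> ST" for \<tau>
  proof (rule measurable_P_AE_eq[OF stoch_exp_from_measurable[OF reg that]])
    show "AE \<omega> in P. stoch_exp_from M1 A1 \<tau> T \<omega> = stoch_exp_from M A \<tau> T \<omega>"
      using stoch_exp_from_AE_cong[OF eq that] by eventually_elim simp
  qed
  have pos: "0 < ?Z t \<omega>" "0 < ?Z1 t \<omega>" for t \<omega> by (simp_all add: stoch_exp_def)
  have stop: "(\<integral>\<^sup>+\<omega>. g \<omega> * ennreal (?Z1 T \<omega>) \<partial>P) = (\<integral>\<^sup>+\<omega>. g \<omega> * ennreal (?Z1 (\<tau> \<omega>) \<omega>) \<partial>P)"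
    if "\<tau> \<in> ST" "g \<in> borel_measurable (pre_sigma \<tau>)" for \<tau> g
    by (rule optional_stopping_nn[OF mart1 regZ1 _ that]) (simp add: pos less_imp_le)
  have "(bmo_norm P F T M)\<^sup>2 \<le> ennreal (2 * (exp (\<beta> * (C - 1)) - 1) / (p * (\<beta> * (p - 1) - p)))"
    if R: "R_condition P F T M A p C" and \<beta>: "p / (p - 1) < \<beta>" for C \<beta>
  proof (rule bmo_norm_power2_bound[OF A M0 p \<beta> _ R])
    fix \<tau> B assume \<tau>: "\<tau> \<in> ST" and B: "B \<in> sets (pre_sigma \<tau>)"
    have BP: "B \<in> sets P" by (rule pre_sigma_sets_subset[OF \<tau> B])
    \<comment> \<open>Optional stopping with this weight, the indicator of B divided by the
      exponential at \<tau>, shows that the exponential from \<tau> to T has conditional expectation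
      1.\<close>
    let ?g = "\<lambda>\<omega>. indicator B \<omega> * ennreal (1 / ?Z1 (\<tau> \<omega>) \<omega>)"
    have "(\<lambda>\<omega>. 1 / ?Z1 (\<tau> \<omega>) \<omega>) \<in> borel_measurable (pre_sigma \<tau>)"
      by (rule borel_measurable_divide[OF borel_measurable_const stopped_value_measurable[OF regZ1 \<tau>]])
    then have gm: "?g \<in> borel_measurable (pre_sigma \<tau>)"
      by (intro borel_measurable_times_ennreal borel_measurable_indicator B measurable_compose[OF _ measurable_ennreal])
    have "(\<integral>\<^sup>+\<omega>. indicator B \<omega> * ennreal (stoch_exp_from M A \<tau> T \<omega>) \<partial>P) = (\<integral>\<^sup>+\<omega>. ?g \<omega> * ennreal (?Z1 T \<omega>) \<partial>P)"
    proof (rule nn_integral_cong_AE)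
      show "AE \<omega> in P. indicator B \<omega> * ennreal (stoch_exp_from M A \<tau> T \<omega>) = ?g \<omega> * ennreal (?Z1 T \<omega>)"
        using stoch_exp_from_AE_cong[OF eq \<tau>]
      proof eventually_elim
        case (elim \<omega>)
        have "ennreal (1 / ?Z1 (\<tau> \<omega>) \<omega>) * ennreal (?Z1 T \<omega>) = ennreal (stoch_exp_from M1 A1 \<tau> T \<omega>)"
          using pos(2) by (subst ennreal_mult[symmetric]) (auto simp: stoch_exp_from_def less_imp_le)
        then show ?case by (simp add: elim mult.assoc)
      qed
    qed
    also have "\<dots> = (\<integral>\<^sup>+\<omega>. ?g \<omega> * ennreal (?Z1 (\<tau> \<omega>) \<omega>) \<partial>P)"
      by (rule stop[OF \<tau> gm])
    also have "\<dots> = (\<integral>\<^sup>+\<omega>. indicator B \<omega> \<partial>P)"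
    proof (rule nn_integral_cong)
      fix \<omega>
      have "ennreal (1 / ?Z1 (\<tau> \<omega>) \<omega>) * ennreal (?Z1 (\<tau> \<omega>) \<omega>) = 1"
        using pos(2)[of "\<tau> \<omega>" \<omega>] by (subst ennreal_mult[symmetric]) auto
      then show "?g \<omega> * ennreal (?Z1 (\<tau> \<omega>) \<omega>) = indicator B \<omega>" by (simp add: mult.assoc)
    qed
    also have "\<dots> = emeasure P B" using BP by simp
    finally show "(\<integral>\<^sup>+\<omega>. indicator B \<omega> * ennreal (stoch_exp_from M A \<tau> T \<omega>) \<partial>P) = emeasure P B" .
  qed
  moreover have "(bmo_norm P' F T M')\<^sup>2 \<le> ennreal (2 * (p - 1)\<^sup>2 / (p * (\<beta> - p)) * (exp (\<beta> * (D - 1)) - 1))"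
    if AD: "A_condition P F T M A p D" and \<beta>: "p < \<beta>" for D \<beta>
  proof -
    \<comment> \<open>The regular version of the exponential defines the very same measure, so
      Girsanov's theorem for M1 and A1 is a statement about P'.\<close>
    have P'_eq: "density P (\<lambda>\<omega>. ennreal (?Z1 T \<omega>)) = P'"
      unfolding P'_def
    proof (rule density_cong)
      show "AE \<omega> in P. ennreal (?Z1 T \<omega>) = ennreal (?Z T \<omega>)" using eqZT by eventually_elim simp
    qed measurable
    note gir = girsanov[OF cp mart1, unfolded P'_eq]
    interpret Q: usual_filtration P' F T by (rule gir(1))
    have spaceQ: "space P' = space P" by (simp add: P'_def)
    have eqQ: "AE \<omega> in P'. \<forall>t\<in>{0..T}. A1 t \<omega> - M1 t \<omega> = M' t \<omega> \<and> A1 t \<omega> = A t \<omega>"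
      unfolding P'_def by (subst AE_density) (use eq in \<open>auto simp: M'_def elim: eventually_mono\<close>)
    have A': "is_square_characteristic P' F T M' A"
      by (rule Q.is_square_characteristic_AE_cong[OF gir(2) eqQ])
    have M'0: "AE \<omega> in P'. M' 0 \<omega> = 0"
    proof -
      have "AE \<omega> in P'. A1 0 \<omega> - M1 0 \<omega> = 0"
        using cp by (intro AE_I2) (simp add: spaceQ characteristic_pair_def)
      with eqQ show ?thesis
      proof eventually_elim
        case (elim \<omega>)
        have "0 \<in> {0..T}" using horizon_pos by simp
        with elim show ?case by metis
      qed
    qed
    \<comment> \<open>For the conjugate exponent, q / (q - 1) = p turns the requirement of part (1)
      into \<beta> > p, and 1 - q = - 1 / (p - 1) is the exponent in
      \<open>A_condition\<close>.\<close>
    define q where "q = p / (p - 1)"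
    have q: "1 < q" "q / (q - 1) = p" "1 - q = - 1 / (p - 1)" using p by (auto simp: q_def field_simps)
    have from': "stoch_exp_from M' A \<tau> T \<omega> = ?Z (\<tau> \<omega>) \<omega> / ?Z T \<omega>" for \<tau> \<omega>
      unfolding stoch_exp_from_def stoch_exp_def M'_def exp_diff[symmetric]
      by (rule arg_cong[where f=exp]) (simp add: field_simps)
    have Z\<tau>m: "(\<lambda>\<omega>. ?Z (\<tau> \<omega>) \<omega>) \<in> borel_measurable P" if "\<tau> \<in> ST" for \<tau>
    proof (rule measurable_P_AE_eq[OF stopped_value_measurable_P[OF regZ1 that]])
      show "AE \<omega> in P. ?Z1 (\<tau> \<omega>) \<omega> = ?Z (\<tau> \<omega>) \<omega>" using eqZ\<tau>[OF that] by eventually_elim simp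
    qed
    \<comment> \<open>On events known at \<tau>, the density of P' with respect to P is the
      exponential at \<tau>.\<close>
    have P'B: "(\<integral>\<^sup>+\<omega>. indicator B \<omega> * ennreal (?Z1 (\<tau> \<omega>) \<omega>) \<partial>P) = emeasure P' B"
      if \<tau>: "\<tau> \<in> ST" and B: "B \<in> sets (pre_sigma \<tau>)" for \<tau> B
    proof -
      have "(\<integral>\<^sup>+\<omega>. indicator B \<omega> * ennreal (?Z1 (\<tau> \<omega>) \<omega>) \<partial>P) = (\<integral>\<^sup>+\<omega>. indicator B \<omega> * ennreal (?Z1 T \<omega>) \<partial>P)"
        by (rule stop[OF \<tau> borel_measurable_indicator[OF B], symmetric])
      also have "\<dots> = emeasure P' B"
        unfolding P'_eq[symmetric] using pre_sigma_sets_subset[OF \<tau> B]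
        by (subst emeasure_density) (auto simp: mult.commute)
      finally show ?thesis .
    qed
    have "(bmo_norm P' F T M')\<^sup>2 \<le> ennreal (2 * (exp (\<beta> * (D - 1)) - 1) / (q * (\<beta> * (q - 1) - q)))"
    proof (rule Q.bmo_norm_power2_bound[OF A' M'0 q(1)])
      show "q / (q - 1) < \<beta>" using q \<beta> by simp
    next
      fix \<tau> B assume "\<tau> \<in> stopping_times (space P') F T" and "B \<in> sets (filtration.pre_sigma (space P') F \<tau>)"
      then have \<tau>: "\<tau> \<in> ST" and B: "B \<in> sets (pre_sigma \<tau>)" by (simp_all add: spaceQ)
      have BP[measurable]: "B \<in> sets P" by (rule pre_sigma_sets_subset[OF \<tau> B])
      note [measurable] = Z\<tau>m[OF \<tau>]
      have "(\<integral>\<^sup>+\<omega>. indicator B \<omega> * ennreal (stoch_exp_from M' A \<tau> T \<omega>) \<partial>P')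
          = (\<integral>\<^sup>+\<omega>. ennreal (?Z T \<omega>) * (indicator B \<omega> * ennreal (?Z (\<tau> \<omega>) \<omega> / ?Z T \<omega>)) \<partial>P)"
        unfolding P'_def from' by (rule nn_integral_density) measurable
      also have "\<dots> = (\<integral>\<^sup>+\<omega>. indicator B \<omega> * ennreal (?Z1 (\<tau> \<omega>) \<omega>) \<partial>P)"
      proof (rule nn_integral_cong_AE)
        show "AE \<omega> in P. ennreal (?Z T \<omega>) * (indicator B \<omega> * ennreal (?Z (\<tau> \<omega>) \<omega> / ?Z T \<omega>)) = indicator B \<omega> * ennreal (?Z1 (\<tau> \<omega>) \<omega>)"
          using eqZ\<tau>[OF \<tau>]
        proof eventually_elim
          case (elim \<omega>)
          have "ennreal (?Z T \<omega>) * ennreal (?Z (\<tau> \<omega>) \<omega> / ?Z T \<omega>) = ennreal (?Z (\<tau> \<omega>) \<omega>)"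
            using pos(1)[of T \<omega>] pos(1)[of "\<tau> \<omega>" \<omega>] by (subst ennreal_mult[symmetric]) auto
          then show ?case unfolding elim[symmetric] by (metis mult.left_commute)
        qed
      qed
      also have "\<dots> = emeasure P' B" by (rule P'B[OF \<tau> B])
      finally show "(\<integral>\<^sup>+\<omega>. indicator B \<omega> * ennreal (stoch_exp_from M' A \<tau> T \<omega>) \<partial>P') = emeasure P' B" .
    next
      show "R_condition P' F T M' A q D"
        unfolding R_condition_def
      proof
        fix \<tau> assume "\<tau> \<in> stopping_times (space P') F T"
        then have \<tau>: "\<tau> \<in> ST" and \<tau>Q: "\<tau> \<in> Q.ST" by (simp_all add: spaceQ)
        interpret sub: finite_measure_subalgebra P "pre_sigma \<tau>" by (rule pre_sigma_finite_measure_subalgebra[OF \<tau>])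
        note [measurable] = Z\<tau>m[OF \<tau>] m_from[OF \<tau>]
        have "AE \<omega> in P'. nn_cond_exp P' (Q.pre_sigma \<tau>) (\<lambda>\<omega>. ennreal (stoch_exp_from M' A \<tau> T \<omega> powr q)) \<omega> \<le> ennreal D"
        proof (rule Q.nn_cond_exp_le_const[OF \<tau>Q])
          show "(\<lambda>\<omega>. ennreal (stoch_exp_from M' A \<tau> T \<omega> powr q)) \<in> borel_measurable P'"
            unfolding from' P'_def by measurable
          fix B assume "B \<in> sets (Q.pre_sigma \<tau>)"
          then have B: "B \<in> sets (pre_sigma \<tau>)" by (simp add: spaceQ)
          have BP[measurable]: "B \<in> sets P" by (rule pre_sigma_sets_subset[OF \<tau> B])
          let ?f = "\<lambda>\<omega>. ennreal (stoch_exp_from M A \<tau> T \<omega> powr (- 1 / (p - 1)))"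
          let ?g = "\<lambda>\<omega>. indicator B \<omega> * ennreal (?Z1 (\<tau> \<omega>) \<omega>)"
          have gm: "?g \<in> borel_measurable (pre_sigma \<tau>)"
            by (intro borel_measurable_times_ennreal borel_measurable_indicator B
                measurable_compose[OF stopped_value_measurable[OF regZ1 \<tau>] measurable_ennreal])
          have [measurable]: "?g \<in> borel_measurable P" by (rule measurable_from_subalg[OF subalgebra_pre_sigma[OF \<tau>] gm])
          have "(\<integral>\<^sup>+\<omega>. indicator B \<omega> * ennreal (stoch_exp_from M' A \<tau> T \<omega> powr q) \<partial>P')
              = (\<integral>\<^sup>+\<omega>. ennreal (?Z T \<omega>) * (indicator B \<omega> * ennreal ((?Z (\<tau> \<omega>) \<omega> / ?Z T \<omega>) powr q)) \<partial>P)"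
            unfolding P'_def from' by (rule nn_integral_density) measurable
          also have "\<dots> = (\<integral>\<^sup>+\<omega>. ?g \<omega> * ?f \<omega> \<partial>P)"
          proof (rule nn_integral_cong_AE)
            show "AE \<omega> in P. ennreal (?Z T \<omega>) * (indicator B \<omega> * ennreal ((?Z (\<tau> \<omega>) \<omega> / ?Z T \<omega>) powr q)) = ?g \<omega> * ?f \<omega>"
              using eqZ\<tau>[OF \<tau>]
            proof eventually_elim
              case (elim \<omega>)
              define u where "u = ?Z T \<omega>"
              define v where "v = ?Z (\<tau> \<omega>) \<omega>"
              have uv: "0 < u" "0 < v" using pos(1) by (auto simp: u_def v_def)
              \<comment> \<open>With u the exponential at T and v its value at \<tau>, the factor u
                changes the measure at T, while the factor v is what P' weighs events at \<tau>
                with. So the reverse Hoelder condition with exponent q under P' is the condition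
                \<open>A_condition\<close> under P, with the same constant D.\<close>
              have "u * (v / u) powr q = v * (u / v) powr (1 - q)"
                using uv by (simp add: powr_diff powr_divide)
              then have "ennreal u * ennreal ((v / u) powr q) = ennreal v * ennreal ((u / v) powr (1 - q))"
                using uv by (simp add: ennreal_mult[symmetric])
              then show ?case
                unfolding elim[symmetric] stoch_exp_from_def q(3)[symmetric] u_def[symmetric] v_def[symmetric]
                by (metis mult.left_commute mult.assoc)
            qed
          qed
          also have "\<dots> = (\<integral>\<^sup>+\<omega>. ?g \<omega> * nn_cond_exp P (pre_sigma \<tau>) ?f \<omega> \<partial>P)"
            by (rule sub.nn_cond_exp_intg[OF gm, symmetric]) measurable
          also have "\<dots> \<le> (\<integral>\<^sup>+\<omega>. ennreal D * ?g \<omega> \<partial>P)"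
          proof (rule nn_integral_mono_AE)
            have "AE \<omega> in P. nn_cond_exp P (pre_sigma \<tau>) ?f \<omega> \<le> ennreal D"
              using AD \<tau> by (auto simp: A_condition_def nn_cond_exp_at_def)
            then show "AE \<omega> in P. ?g \<omega> * nn_cond_exp P (pre_sigma \<tau>) ?f \<omega> \<le> ennreal D * ?g \<omega>"
            proof eventually_elim
              case (elim \<omega>)
              then show ?case unfolding mult.commute[of "ennreal D"] by (rule mult_left_mono) simp
            qed
          qed
          also have "\<dots> = ennreal D * emeasure P' B"
            unfolding P'B[OF \<tau> B, symmetric] by (rule nn_integral_cmult) measurable
          finally show "(\<integral>\<^sup>+\<omega>. indicator B \<omega> * ennreal (stoch_exp_from M' A \<tau> T \<omega> powr q) \<partial>P') \<le> ennreal D * emeasure P' B" .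
        qed simp
        then show "AE \<omega> in P'. nn_cond_exp_at P' F \<tau> (\<lambda>\<omega>. stoch_exp_from M' A \<tau> T \<omega> powr q) \<omega> \<le> ennreal D"
          by (simp add: nn_cond_exp_at_def)
      qed
    qed
    also have "2 * (exp (\<beta> * (D - 1)) - 1) / (q * (\<beta> * (q - 1) - q)) = 2 * (p - 1)\<^sup>2 / (p * (\<beta> - p)) * (exp (\<beta> * (D - 1)) - 1)"
    proof -
      \<comment> \<open>One factor p - 1 in the denominator comes from q, the other from \<beta> (q
        - 1) - q = (\<beta> - p) / (p - 1); together they give the square in the bound of part
        (2).\<close>
      have "q * (\<beta> * (q - 1) - q) = p * (\<beta> - p) / (p - 1)\<^sup>2"
      proof -
        have "q - 1 = 1 / (p - 1)" using p by (simp add: q_def field_simps)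
        then have "\<beta> * (q - 1) - q = (\<beta> - p) / (p - 1)" by (simp add: q_def diff_divide_distrib)
        then show ?thesis by (simp add: q_def power2_eq_square)
      qed
      then show ?thesis by simp
    qed
    finally show ?thesis .
  qed
  ultimately show ?thesis by blast
qed

end
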